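(* For any $\epsilon\in(0,1/8)$, there exists a polynomial-time randomized $(1/8-\epsilon)$-approximation algorithm for the maximum weight matching problem with Lipschitz constant $O(\epsilon^{-1})$.
   Context: Maximum weight matching problem: given an undirected graph $G=(V,E)$ and $w\in\mathbb{R}_{\geq0}^E$, output a matching $M\subseteq E$ maximizing $\sum_{e\in M}w(e)$. A randomized algorithm is an $\alpha$-approximation if the expected weight of its output matching is at least $\alpha$ times the maximum weight of a matching. For edge sets $F,F'$, $d_w((F,w),(F',w'))=\|\sum_{e\in F}w(e)\mathbf{1}_e-\sum_{e\in F'}w'(e)\mathbf{1}_e\|_1$ ($\mathbf{1}_e$ the indicator vector of $e$); $\mathrm{EM}_\mathrm{w}$ of two output distributions is the minimum over couplings of the expected $d_w$. The Lipschitz constant of $\mathcal{A}$ on $G$ is $\sup_{w\neq w'\in\mathbb{R}_{\geq0}^E}\mathrm{EM}_\mathrm{w}((\mathcal{A}(G,w),w),(\mathcal{A}(G,w'),w'))/\|w-w'\|_1$, and the bound $O(\epsilon^{-1})$ holds for every input graph. *)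

theory Defs
  imports "HOL-Probability.Probability" "HOL-Computational_Algebra.Polynomial"
begin

section \<open>Graphs and matchings\<close>

text \<open>A finite simple undirected graph \<open>(n, E)\<close> has vertex set \<open>{..<n}\<close>; an edge is a two-element
  set of vertices. Weight vectors in \<open>\<real>\<^sub>\<ge>\<^sub>0\<^sup>E\<close> are extensional functions, so that they are
  equal iff they agree on \<open>E\<close>.\<close>

type_synonym edge = "nat set"
type_synonym ugraph = "nat \<times> edge set"

definition verts :: "ugraph \<Rightarrow> nat set" where
  "verts G = {..<fst G}"

definition edges :: "ugraph \<Rightarrow> edge set" where
  "edges G = snd G"

definition wf_ugraph :: "ugraph \<Rightarrow> bool" where
  "wf_ugraph G \<longleftrightarrow> (\<forall>e\<in>edges G. e \<subseteq> verts G \<and> card e = 2)"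

definition weightings :: "ugraph \<Rightarrow> (edge \<Rightarrow> real) set" where
  "weightings G = (edges G \<rightarrow>\<^sub>E {0..})"

definition matching :: "ugraph \<Rightarrow> edge set \<Rightarrow> bool" where
  "matching G M \<longleftrightarrow> M \<subseteq> edges G \<and> (\<forall>e\<in>M. \<forall>f\<in>M. e \<noteq> f \<longrightarrow> e \<inter> f = {})"

definition weight :: "(edge \<Rightarrow> real) \<Rightarrow> edge set \<Rightarrow> real" where
  "weight w M = (\<Sum>e\<in>M. w e)"

definition max_matching_weight :: "ugraph \<Rightarrow> (edge \<Rightarrow> real) \<Rightarrow> real" where
  "max_matching_weight G w = Max (weight w ` {M. matching G M})"

section \<open>Approximation ratio and Lipschitz constant\<close>

type_synonym rand_alg = "ugraph \<Rightarrow> (edge \<Rightarrow> real) \<Rightarrow> edge set pmf"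

definition approx_max_weight_matching :: "real \<Rightarrow> rand_alg \<Rightarrow> bool" where
  "approx_max_weight_matching \<alpha> A \<longleftrightarrow>
     (\<forall>G w. wf_ugraph G \<longrightarrow> w \<in> weightings G \<longrightarrow>
        (\<forall>M\<in>set_pmf (A G w). matching G M) \<and>
        measure_pmf.expectation (A G w) (weight w) \<ge> \<alpha> * max_matching_weight G w)"

definition l1_norm :: "ugraph \<Rightarrow> (edge \<Rightarrow> real) \<Rightarrow> real" where
  "l1_norm G x = (\<Sum>e\<in>edges G. \<bar>x e\<bar>)"

definition weighted_indicator :: "edge set \<Rightarrow> (edge \<Rightarrow> real) \<Rightarrow> edge \<Rightarrow> real" where
  "weighted_indicator F w = (\<lambda>g. \<Sum>e\<in>F. w e * indicator {e} g)"

definition dist_w :: "ugraph \<Rightarrow> edge set \<times> (edge \<Rightarrow> real) \<Rightarrow> edge set \<times> (edge \<Rightarrow> real) \<Rightarrow> real" where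
  "dist_w G = (\<lambda>(F, w) (F', w').
     l1_norm G (\<lambda>g. weighted_indicator F w g - weighted_indicator F' w' g))"

definition couplings :: "'a pmf \<Rightarrow> 'b pmf \<Rightarrow> ('a \<times> 'b) pmf set" where
  "couplings p q = {c. map_pmf fst c = p \<and> map_pmf snd c = q}"

text \<open>For finitely supported distributions the infimum below is attained.\<close>

definition EM_w :: "ugraph \<Rightarrow> edge set pmf \<times> (edge \<Rightarrow> real) \<Rightarrow> edge set pmf \<times> (edge \<Rightarrow> real) \<Rightarrow> ennreal" where
  "EM_w G = (\<lambda>(p, w) (q, w').
     INF c\<in>couplings p q. \<integral>\<^sup>+ (F, F'). ennreal (dist_w G (F, w) (F', w')) \<partial>measure_pmf c)"

definition lipschitz_constant :: "rand_alg \<Rightarrow> ugraph \<Rightarrow> ennreal" where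
  "lipschitz_constant A G =
     (SUP (w, w')\<in>{(w, w'). w \<in> weightings G \<and> w' \<in> weightings G \<and> w \<noteq> w'}.
        EM_w G (A G w, w) (A G w', w') / ennreal (l1_norm G (\<lambda>e. w e - w' e)))"

section \<open>Polynomial time: a randomized real RAM\<close>

text \<open>Weights are arbitrary reals, so the machine model is the real RAM: exact field operations
  and comparisons on reals at unit cost, no rounding and no conversion of reals to integers. It is
  extended by an instruction drawing a fresh uniform sample from \<open>[0,1]\<close>. A program uses
  finitely many integer arrays and real arrays, named by numerals in the program text and indexed
  by integer expressions (a scalar is an array used at index \<open>0\<close> only). Integer arithmetic is
  restricted to sums and truncated differences, so that bit lengths grow by at most a constant per
  step and unit cost is legitimate; real constants are integers, so no information can be hidden in
  them.\<close>

datatype iexp =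
    IConst nat
  | IGet nat iexp
  | IAdd iexp iexp
  | ISub iexp iexp

datatype rexp =
    RConst int
  | RGet nat iexp
  | RAdd rexp rexp
  | RSub rexp rexp
  | RMul rexp rexp
  | RDiv rexp rexp

datatype bexp =
    ILess iexp iexp
  | RLess rexp rexp
  | BNot bexp
  | BAnd bexp bexp

datatype com =
    Skip
  | ISet nat iexp iexp
  | RSet nat iexp rexp
  | Sample nat iexp
  | Seq com com
  | Cond bexp com com
  | While bexp com

text \<open>Randomness is modelled by a tape of independent uniform samples; \<open>drawn\<close> counts the
  samples consumed so far.\<close>

record state =
  ints :: "nat \<Rightarrow> nat \<Rightarrow> nat"
  reals :: "nat \<Rightarrow> nat \<Rightarrow> real"
  drawn :: nat

fun ival :: "iexp \<Rightarrow> state \<Rightarrow> nat" where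
  "ival (IConst k) s = k"
| "ival (IGet a i) s = ints s a (ival i s)"
| "ival (IAdd i j) s = ival i s + ival j s"
| "ival (ISub i j) s = ival i s - ival j s"

fun rval :: "rexp \<Rightarrow> state \<Rightarrow> real" where
  "rval (RConst k) s = of_int k"
| "rval (RGet a i) s = reals s a (ival i s)"
| "rval (RAdd x y) s = rval x s + rval y s"
| "rval (RSub x y) s = rval x s - rval y s"
| "rval (RMul x y) s = rval x s * rval y s"
| "rval (RDiv x y) s = rval x s / rval y s"

fun bval :: "bexp \<Rightarrow> state \<Rightarrow> bool" where
  "bval (ILess i j) s \<longleftrightarrow> ival i s < ival j s"
| "bval (RLess x y) s \<longleftrightarrow> rval x s < rval y s"
| "bval (BNot b) s \<longleftrightarrow> \<not> bval b s"
| "bval (BAnd b c) s \<longleftrightarrow> bval b s \<and> bval c s"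

definition iupd :: "nat \<Rightarrow> nat \<Rightarrow> nat \<Rightarrow> state \<Rightarrow> state" where
  "iupd a i x s = s\<lparr>ints := (ints s)(a := (ints s a)(i := x))\<rparr>"

definition rupd :: "nat \<Rightarrow> nat \<Rightarrow> real \<Rightarrow> state \<Rightarrow> state" where
  "rupd a i x s = s\<lparr>reals := (reals s)(a := (reals s a)(i := x))\<rparr>"

text \<open>\<open>exec \<omega> c s t s'\<close>: on tape \<open>\<omega>\<close>, command \<open>c\<close> started in \<open>s\<close> halts in \<open>s'\<close> after \<open>t\<close>
  steps. Each assignment and each test costs one step; the expressions in it have constant size,
  since the program does not depend on the input.\<close>

inductive exec :: "(nat \<Rightarrow> real) \<Rightarrow> com \<Rightarrow> state \<Rightarrow> nat \<Rightarrow> state \<Rightarrow> bool" for \<omega> where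
  Skip: "exec \<omega> Skip s 1 s"
| ISet: "exec \<omega> (ISet a i e) s 1 (iupd a (ival i s) (ival e s) s)"
| RSet: "exec \<omega> (RSet a i e) s 1 (rupd a (ival i s) (rval e s) s)"
| Sample: "exec \<omega> (Sample a i) s 1
             ((rupd a (ival i s) (\<omega> (drawn s)) s)\<lparr>drawn := Suc (drawn s)\<rparr>)"
| Seq: "exec \<omega> c s t s' \<Longrightarrow> exec \<omega> d s' u s'' \<Longrightarrow> exec \<omega> (Seq c d) s (t + u) s''"
| CondTrue: "bval b s \<Longrightarrow> exec \<omega> c s t s' \<Longrightarrow> exec \<omega> (Cond b c d) s (Suc t) s'"
| CondFalse: "\<not> bval b s \<Longrightarrow> exec \<omega> d s t s' \<Longrightarrow> exec \<omega> (Cond b c d) s (Suc t) s'"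
| WhileFalse: "\<not> bval b s \<Longrightarrow> exec \<omega> (While b c) s 1 s"
| WhileTrue: "bval b s \<Longrightarrow> exec \<omega> c s t s' \<Longrightarrow> exec \<omega> (While b c) s' u s'' \<Longrightarrow>
                exec \<omega> (While b c) s (Suc (t + u)) s''"

inductive_cases Skip_elim: "exec \<omega> Skip s t s'"
inductive_cases ISet_elim: "exec \<omega> (ISet a i e) s t s'"
inductive_cases RSet_elim: "exec \<omega> (RSet a i e) s t s'"
inductive_cases Sample_elim: "exec \<omega> (Sample a i) s t s'"
inductive_cases Seq_elim: "exec \<omega> (Seq c d) s t s'"
inductive_cases Cond_elim: "exec \<omega> (Cond b c d) s t s'"
inductive_cases While_elim: "exec \<omega> (While b c) s t s'"

lemma exec_deterministic:
  "exec \<omega> c s t s' \<Longrightarrow> exec \<omega> c s u s'' \<Longrightarrow> u = t \<and> s'' = s'"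
proof (induction arbitrary: u s'' rule: exec.induct)
  case Skip
  then show ?case by (auto elim: Skip_elim)
next
  case ISet
  then show ?case by (auto elim: ISet_elim)
next
  case RSet
  then show ?case by (auto elim: RSet_elim)
next
  case Sample
  then show ?case by (auto elim: Sample_elim)
next
  case (Seq c s t s' d v r)
  from Seq.prems show ?case by (rule Seq_elim) (use Seq.IH in blast)
next
  case CondTrue
  from CondTrue.prems show ?case by (rule Cond_elim) (use CondTrue.IH CondTrue.hyps in blast)+
next
  case CondFalse
  from CondFalse.prems show ?case by (rule Cond_elim) (use CondFalse.IH CondFalse.hyps in blast)+
next
  case WhileFalse
  from WhileFalse.prems show ?case by (rule While_elim) (use WhileFalse.hyps in auto)
next
  case WhileTrue
  from WhileTrue.prems show ?case by (rule While_elim) (use WhileTrue.IH WhileTrue.hyps in blast)+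
qed

text \<open>Input: integer array 0 holds \<open>n\<close> at index 0, integer array 1 the adjacency matrix and real
  array 0 the weight matrix, both in row-major order; everything else is zero. Output: the upper
  triangle of an \<open>n \<times> n\<close> matrix in integer array 2.\<close>

definition init_state :: "ugraph \<Rightarrow> (edge \<Rightarrow> real) \<Rightarrow> state" where
  "init_state G w =
    (let n = fst G; cell = (\<lambda>k. {k div n, k mod n}); present = (\<lambda>k. k < n * n \<and> cell k \<in> edges G)
     in \<lparr>ints = (\<lambda>a k. if a = 0 \<and> k = 0 then n else if a = 1 \<and> present k then 1 else 0),
         reals = (\<lambda>a k. if a = 0 \<and> present k then w (cell k) else 0),
         drawn = 0\<rparr>)"

definition output_edges :: "ugraph \<Rightarrow> state \<Rightarrow> edge set" where
  "output_edges G s = {{u, v} | u v. u < v \<and> v < fst G \<and> ints s 2 (u * fst G + v) \<noteq> 0}"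

definition tape :: "(nat \<Rightarrow> real) measure" where
  "tape = (\<Pi>\<^sub>M i\<in>UNIV. uniform_measure lborel {0..1})"

text \<open>A single program realizes \<open>A\<close> on all inputs, with a worst-case running time, over all tapes
  with entries in \<open>[0,1]\<close> and all weights, that is polynomial in the number of vertices.\<close>

definition polytime_randomized :: "rand_alg \<Rightarrow> bool" where
  "polytime_randomized A \<longleftrightarrow>
     (\<exists>P (p :: nat poly). \<forall>G w. wf_ugraph G \<longrightarrow> w \<in> weightings G \<longrightarrow>
        (\<exists>X. X \<in> measurable tape (count_space UNIV) \<and>
             measure_pmf (A G w) = distr tape (count_space UNIV) X \<and>
             (\<forall>\<omega>. (\<forall>i. \<omega> i \<in> {0..1}) \<longrightarrow>
                (\<exists>t s. exec \<omega> P (init_state G w) t s \<and> t \<le> poly p (fst G) \<and>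
                       X \<omega> = output_edges G s))))"

end

theory Submission imports Defs begin

text \<open>Let \<open>S\<close> be the total weight and \<open>b\<close> uniform in \<open>[1, 9]\<close>, and let the thresholds
  \<open>b S / 9, b S / 81, \<dots>\<close> cut the edges into weight classes. In each class run random-order greedy
  matching on the whole class, and then discard every chosen edge that meets a chosen edge of a
  heavier class.

  Discarding keeps a fraction \<open>1 - 2 (1/9 + 1/81 + \<dots>) = 3/4\<close> of the rounded weight, a maximal
  matching is half optimal in each class, and rounding down to the threshold below keeps at least a
  third of each weight in expectation, whence the ratio \<open>1/8\<close>. The loss
  \<open>\<epsilon>\<close> comes from cutting off after \<open>O(n)\<close> classes, which makes the running time independent of
  the weights.

  For the Lipschitz bound both runs use the same random tape. An edge changes its class with
  probability inversely proportional to its relative weight, because the thresholds scale with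
  \<open>S\<close>; a change of class alters in expectation at most one edge of the greedy matching of a class; and
  one such edge affects discarded weight proportional to its own. No cascade arises, because the
  greedy matchings of the different classes do not interact.\<close>

section \<open>Greedy independent sets\<close>

definition is_greedy :: "'a set \<Rightarrow> ('a \<Rightarrow> 'a \<Rightarrow> bool) \<Rightarrow> ('a \<Rightarrow> real) \<Rightarrow> 'a set \<Rightarrow> bool" where
  "is_greedy V R \<pi> M \<longleftrightarrow>
     M \<subseteq> V \<and> (\<forall>e\<in>V. e \<in> M \<longleftrightarrow> \<not> (\<exists>f\<in>M. R f e \<and> \<pi> f < \<pi> e))"

definition greedy :: "'a set \<Rightarrow> ('a \<Rightarrow> 'a \<Rightarrow> bool) \<Rightarrow> ('a \<Rightarrow> real) \<Rightarrow> 'a set" where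
  "greedy V R \<pi> = (THE M. is_greedy V R \<pi> M)"

lemma is_greedy_agree:
  assumes "finite V" "is_greedy V R \<pi> M" "is_greedy V' R' \<pi>' M'"
    and "\<And>f. P f \<Longrightarrow> f \<in> V \<longleftrightarrow> f \<in> V'"
    and "\<And>f g. P f \<Longrightarrow> g \<in> V \<Longrightarrow> R g f \<Longrightarrow> \<pi> g < \<pi> f \<Longrightarrow> P g \<and> R' g f \<and> \<pi>' g < \<pi>' f"
    and "\<And>f g. P f \<Longrightarrow> g \<in> V' \<Longrightarrow> R' g f \<Longrightarrow> \<pi>' g < \<pi>' f \<Longrightarrow> P g \<and> R g f \<and> \<pi> g < \<pi> f"
    and "P e"
  shows "e \<in> M \<longleftrightarrow> e \<in> M'"
  using \<open>P e\<close>
proof (induction "card {f \<in> V. \<pi> f < \<pi> e}" arbitrary: e rule: less_induct)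
  case (less e)
  show ?case
  proof (cases "e \<in> V")
    case False
    then show ?thesis using assms(2-4) less.prems by (auto simp: is_greedy_def)
  next
    case True
    have IH: "f \<in> M \<longleftrightarrow> f \<in> M'" if "f \<in> V" "\<pi> f < \<pi> e" "P f" for f
    proof (rule less.hyps)
      show "card {g \<in> V. \<pi> g < \<pi> f} < card {f \<in> V. \<pi> f < \<pi> e}"
        using that \<open>finite V\<close> by (intro psubset_card_mono) force+
    qed fact
    have "(\<exists>f\<in>M. R f e \<and> \<pi> f < \<pi> e) \<longleftrightarrow> (\<exists>f\<in>M'. R' f e \<and> \<pi>' f < \<pi>' e)"
    proof
      assume "\<exists>f\<in>M. R f e \<and> \<pi> f < \<pi> e"
      then obtain f where f: "f \<in> M" "R f e" "\<pi> f < \<pi> e" by blast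
      moreover have "f \<in> V" using f assms(2) by (auto simp: is_greedy_def)
      ultimately show "\<exists>f\<in>M'. R' f e \<and> \<pi>' f < \<pi>' e"
        using IH assms(5)[of e f] less.prems by blast
    next
      assume "\<exists>f\<in>M'. R' f e \<and> \<pi>' f < \<pi>' e"
      then obtain f where f: "f \<in> M'" "R' f e" "\<pi>' f < \<pi>' e" by blast
      moreover have "f \<in> V'" using f assms(3) by (auto simp: is_greedy_def)
      ultimately show "\<exists>f\<in>M. R f e \<and> \<pi> f < \<pi> e"
        using IH assms(4)[of f] assms(6)[of e f] less.prems by blast
    qed
    moreover have "e \<in> V'" using True assms(4) less.prems by blast
    ultimately show ?thesis
      using True assms(2,3) unfolding is_greedy_def by blast
  qed
qed

lemma is_greedy_unique:
  assumes "finite V" "is_greedy V R \<pi> M" "is_greedy V R \<pi> M'"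
  shows "M = M'"
  using is_greedy_agree[OF assms, where P = "\<lambda>_. True"] by blast

lemma is_greedy_exists:
  assumes "finite V"
  shows "\<exists>M. is_greedy V R \<pi> M"
  using assms
proof (induction V rule: finite_ranking_induct[where f = \<pi>])
  case empty
  then show ?case by (auto simp: is_greedy_def)
next
  case (insert x V)
  then obtain M where M: "is_greedy V R \<pi> M" by blast
  show ?case
  proof (cases "x \<in> V")
    case True
    then show ?thesis using M by (metis insert_absorb)
  next
    case False
    have sub: "M \<subseteq> V" using M by (auto simp: is_greedy_def)
    show ?thesis
    proof (cases "\<exists>f\<in>M. R f x \<and> \<pi> f < \<pi> x")
      case True
      then have "is_greedy (insert x V) R \<pi> M"
        using M sub False by (auto simp: is_greedy_def)
      then show ?thesis by blast
    next
      case nb: False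
      have "is_greedy (insert x V) R \<pi> (insert x M)"
        unfolding is_greedy_def
      proof (intro conjI ballI)
        show "insert x M \<subseteq> insert x V" using sub by blast
        fix e assume e: "e \<in> insert x V"
        show "(e \<in> insert x M) = (\<not> (\<exists>f\<in>insert x M. R f e \<and> \<pi> f < \<pi> e))"
        proof (cases "e = x")
          case True
          then show ?thesis using nb by auto
        next
          case False
          then have "e \<in> V" "\<not> \<pi> x < \<pi> e" using e insert.hyps(2)[of e] by auto
          then show ?thesis using M False by (auto simp: is_greedy_def)
        qed
      qed
      then show ?thesis by blast
    qed
  qed
qed

lemma is_greedy_greedy: "finite V \<Longrightarrow> is_greedy V R \<pi> (greedy V R \<pi>)"
  unfolding greedy_def
  by (rule theI') (use is_greedy_exists is_greedy_unique in blast)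

lemma greedy_eqI: "finite V \<Longrightarrow> is_greedy V R \<pi> M \<Longrightarrow> greedy V R \<pi> = M"
  using is_greedy_greedy is_greedy_unique by blast

lemma greedy_subset: "finite V \<Longrightarrow> greedy V R \<pi> \<subseteq> V"
  using is_greedy_greedy[of V R \<pi>] by (auto simp: is_greedy_def)

lemma greedy_mem_iff:
  "finite V \<Longrightarrow> e \<in> V \<Longrightarrow>
     e \<in> greedy V R \<pi> \<longleftrightarrow> \<not> (\<exists>f\<in>greedy V R \<pi>. R f e \<and> \<pi> f < \<pi> e)"
  using is_greedy_greedy[of V R \<pi>] by (auto simp: is_greedy_def)

lemma greedy_independent:
  assumes "finite V" "inj_on \<pi> V" "symp R" "irreflp R"
    and "e \<in> greedy V R \<pi>" "f \<in> greedy V R \<pi>"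
  shows "\<not> R e f"
proof
  assume R: "R e f"
  then have "R f e" "e \<noteq> f" using assms by (auto dest: sympD irreflpD)
  moreover have "e \<in> V" "f \<in> V" using assms greedy_subset by blast+
  moreover from calculation have "\<pi> e \<noteq> \<pi> f" using assms by (auto dest: inj_onD)
  ultimately show False
    using greedy_mem_iff[OF \<open>finite V\<close>, of e R \<pi>] greedy_mem_iff[OF \<open>finite V\<close>, of f R \<pi>] assms R
    by (meson not_less_iff_gr_or_eq)
qed

lemma greedy_cong:
  assumes "finite V" "\<And>e f. e \<in> V \<Longrightarrow> f \<in> V \<Longrightarrow> R e f \<longleftrightarrow> R' e f"
    and "\<And>e f. e \<in> V \<Longrightarrow> f \<in> V \<Longrightarrow> \<pi> e < \<pi> f \<longleftrightarrow> \<pi>' e < \<pi>' f"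
  shows "greedy V R \<pi> = greedy V R' \<pi>'"
proof (rule greedy_eqI[OF assms(1)])
  show "is_greedy V R \<pi> (greedy V R' \<pi>')"
    using is_greedy_greedy[OF assms(1), of R' \<pi>'] assms(2,3)
    unfolding is_greedy_def by blast
qed

definition without :: "'a set \<Rightarrow> ('a \<Rightarrow> 'a \<Rightarrow> bool) \<Rightarrow> ('a \<Rightarrow> real) \<Rightarrow> 'a \<Rightarrow> 'a set" where
  "without V R \<pi> e = greedy (V - {e}) R \<pi>"

definition forced :: "'a set \<Rightarrow> ('a \<Rightarrow> 'a \<Rightarrow> bool) \<Rightarrow> ('a \<Rightarrow> real) \<Rightarrow> 'a \<Rightarrow> 'a set" where
  "forced V R \<pi> e = insert e (greedy {f \<in> V - {e}. \<not> R e f} R \<pi>)"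

text \<open>The vertices whose membership depends on whether \<open>e\<close> is absent or processed first.\<close>

definition affected :: "'a set \<Rightarrow> ('a \<Rightarrow> 'a \<Rightarrow> bool) \<Rightarrow> ('a \<Rightarrow> real) \<Rightarrow> 'a \<Rightarrow> 'a set" where
  "affected V R \<pi> e = sym_diff (forced V R \<pi> e) (without V R \<pi> e)"

lemma affected_subset: "finite V \<Longrightarrow> e \<in> V \<Longrightarrow> affected V R \<pi> e \<subseteq> V"
  using greedy_subset[of "V - {e}" R \<pi>] greedy_subset[of "{f \<in> V - {e}. \<not> R e f}" R \<pi>]
  by (auto simp: affected_def forced_def without_def)

lemma mem_affected_self: "finite V \<Longrightarrow> e \<in> affected V R \<pi> e"
  using greedy_subset[of "V - {e}" R \<pi>]
  by (auto simp: affected_def forced_def without_def)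

lemma greedy_eq_forced:
  assumes "finite V" "inj_on \<pi> V" "symp R" "irreflp R" "e \<in> greedy V R \<pi>"
  shows "greedy V R \<pi> = forced V R \<pi> e"
proof -
  let ?M = "greedy V R \<pi>" and ?V = "{f \<in> V - {e}. \<not> R e f}"
  have "is_greedy ?V R \<pi> (?M - {e})"
    using greedy_subset[OF assms(1), of R \<pi>] greedy_mem_iff[OF assms(1), of _ R \<pi>]
      greedy_independent[OF assms]
    unfolding is_greedy_def by (auto; blast)
  then have "greedy ?V R \<pi> = ?M - {e}" using assms(1) by (intro greedy_eqI) auto
  then show ?thesis using assms(5) by (auto simp: forced_def)
qed

lemma greedy_eq_without:
  assumes "finite V" "e \<notin> greedy V R \<pi>"
  shows "greedy V R \<pi> = without V R \<pi> e"
proof -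
  have "is_greedy (V - {e}) R \<pi> (greedy V R \<pi>)"
    using assms(2) is_greedy_greedy[OF assms(1), of R \<pi>] by (auto simp: is_greedy_def)
  then show ?thesis unfolding without_def using assms(1) greedy_eqI[of "V - {e}"] by (metis finite_Diff)
qed

lemma affected_after:
  assumes "finite V" "inj_on \<pi> V" "symp R" "irreflp R" "e \<in> greedy V R \<pi>" "f \<in> affected V R \<pi> e"
  shows "\<not> \<pi> f < \<pi> e"
proof
  assume less: "\<pi> f < \<pi> e"
  have "f \<in> greedy V R \<pi> \<longleftrightarrow> f \<in> greedy (V - {e}) R \<pi>"
    by (rule is_greedy_agree[OF assms(1) is_greedy_greedy is_greedy_greedy,
          where P = "\<lambda>f. \<pi> f < \<pi> e"]) (use less assms(1) in auto)
  then show False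
    using assms(6) greedy_eq_forced[OF assms(1-5)] by (auto simp: affected_def without_def)
qed

lemma sym_diff_greedy_without:
  assumes "finite V" "inj_on \<pi> V" "symp R" "irreflp R"
  shows "card (sym_diff (greedy V R \<pi>) (without V R \<pi> e)) \<le>
    (if {f \<in> affected V R \<pi> e. \<pi> f < \<pi> e} = {} then card (affected V R \<pi> e) else 0)"
proof (cases "e \<in> greedy V R \<pi>")
  case True
  have "{f \<in> affected V R \<pi> e. \<pi> f < \<pi> e} = {}"
    using affected_after[OF assms True] by blast
  moreover have "sym_diff (greedy V R \<pi>) (without V R \<pi> e) = affected V R \<pi> e"
    using greedy_eq_forced[OF assms True] by (simp add: affected_def)
  ultimately show ?thesis by simp
next
  case False
  then show ?thesis using greedy_eq_without[OF assms(1)] by simp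
qed

text \<open>Blockers of an affected vertex are themselves affected, so moving affected vertices forward
  without changing their relative order keeps both greedy sets.\<close>

lemma is_greedy_advance:
  assumes "is_greedy V R \<pi> M"
    and "\<And>f. f \<in> V \<Longrightarrow> \<pi>' f \<le> \<pi> f"
    and "\<And>f. f \<in> V \<Longrightarrow> f \<notin> T \<Longrightarrow> \<pi>' f = \<pi> f"
    and "\<And>f g. f \<in> V \<Longrightarrow> g \<in> V \<Longrightarrow> f \<in> T \<Longrightarrow> g \<in> T \<Longrightarrow> \<pi> f < \<pi> g \<Longrightarrow> \<pi>' f < \<pi>' g"
    and "\<And>f g. f \<in> M \<Longrightarrow> g \<in> M \<Longrightarrow> \<not> R f g"
    and "\<And>f g. f \<in> V - M \<Longrightarrow> f \<in> T \<Longrightarrow> g \<in> M \<Longrightarrow> R g f \<Longrightarrow> g \<in> T"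
  shows "is_greedy V R \<pi>' M"
  unfolding is_greedy_def
proof (intro conjI ballI)
  show sub: "M \<subseteq> V" using assms(1) by (auto simp: is_greedy_def)
  fix e assume e: "e \<in> V"
  show "(e \<in> M) = (\<not> (\<exists>f\<in>M. R f e \<and> \<pi>' f < \<pi>' e))"
  proof (cases "e \<in> M")
    case True
    then show ?thesis using assms(5) by blast
  next
    case False
    then obtain f where f: "f \<in> M" "R f e" "\<pi> f < \<pi> e"
      using assms(1) e by (auto simp: is_greedy_def)
    have "\<pi>' f < \<pi>' e"
    proof (cases "e \<in> T")
      case True
      then show ?thesis using assms(4)[of f e] assms(6)[of e f] f e False sub by blast
    next
      case eT: False
      then show ?thesis using assms(2)[of f] assms(3)[of e] f e sub by auto
    qed
    then show ?thesis using f False by blast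
  qed
qed

lemma affected_swap:
  assumes fin: "finite V" and inj: "inj_on \<pi> V" and R: "symp R" "irreflp R" and e: "e \<in> V"
    and t: "t \<in> affected V R \<pi> e" "\<pi> e < \<pi> t"
    and succ: "\<And>f. f \<in> affected V R \<pi> e \<Longrightarrow> \<pi> e < \<pi> f \<Longrightarrow> \<pi> t \<le> \<pi> f"
    and \<pi>': "\<pi>' e = \<pi> t" "\<pi>' t = \<pi> e" "\<And>f. f \<in> V \<Longrightarrow> f \<noteq> e \<Longrightarrow> f \<noteq> t \<Longrightarrow> \<pi>' f = \<pi> f"
  shows "affected V R \<pi>' e = affected V R \<pi> e"
proof -
  define T where "T = affected V R \<pi> e"
  define W where "W = {f \<in> V - {e}. \<not> R e f}"
  have tV: "t \<in> V" "t \<noteq> e" using t affected_subset[OF fin e, of R \<pi>] by auto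
  have le: "\<pi>' f \<le> \<pi> f" if "f \<in> V - {e}" for f
    using that \<pi>' t by (cases "f = t") auto
  have same: "\<pi>' f = \<pi> f" if "f \<in> V - {e}" "f \<notin> T" for f
    using that \<pi>' t by (auto simp: T_def)
  have mono: "\<pi>' f < \<pi>' g" if "f \<in> V - {e}" "g \<in> V - {e}" "f \<in> T" "g \<in> T" "\<pi> f < \<pi> g" for f g
  proof -
    have "\<pi> f \<noteq> \<pi> e" "\<pi> g \<noteq> \<pi> e" using inj that e by (auto dest: inj_onD)
    then show ?thesis
      using that \<pi>' t succ[of f] unfolding T_def by (cases "f = t"; cases "g = t") fastforce+
  qed
  have injV: "inj_on \<pi> (V - {e})" "inj_on \<pi> W"
    using inj by (auto simp: W_def intro: inj_on_subset)
  have fin': "finite (V - {e})" "finite W" using fin by (auto simp: W_def)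
  have ind1: "\<not> R f g" if "f \<in> without V R \<pi> e" "g \<in> without V R \<pi> e" for f g
    using greedy_independent[OF fin'(1) injV(1) R] that by (simp add: without_def)
  have ind2: "\<not> R f g" if "f \<in> forced V R \<pi> e" "g \<in> forced V R \<pi> e" for f g
  proof -
    have forced: "forced V R \<pi> e = insert e (greedy W R \<pi>)" by (simp add: forced_def W_def)
    have "\<not> R e h \<and> \<not> R h e" if "h \<in> forced V R \<pi> e" for h
      using that greedy_subset[OF fin'(2), of R \<pi>] R
      by (auto simp: forced W_def dest: sympD irreflpD)
    then show ?thesis
      using greedy_independent[OF fin'(2) injV(2) R] that unfolding forced by blast
  qed
  have T_iff: "f \<in> T \<longleftrightarrow> (f \<in> forced V R \<pi> e) \<noteq> (f \<in> without V R \<pi> e)" for f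
    by (auto simp: T_def affected_def)
  have "is_greedy (V - {e}) R \<pi>' (without V R \<pi> e)"
  proof (rule is_greedy_advance[where \<pi> = \<pi> and T = T])
    show "is_greedy (V - {e}) R \<pi> (without V R \<pi> e)"
      unfolding without_def by (rule is_greedy_greedy[OF fin'(1)])
    show "g \<in> T" if "f \<in> V - {e} - without V R \<pi> e" "f \<in> T" "g \<in> without V R \<pi> e" "R g f" for f g
      using that ind2 T_iff by blast
  qed (use le same mono ind1 in auto)
  then have 1: "without V R \<pi>' e = without V R \<pi> e"
    unfolding without_def[of V R \<pi>'] by (rule greedy_eqI[OF fin'(1)])
  have WV: "W \<subseteq> V - {e}" by (auto simp: W_def)
  have sub: "greedy W R \<pi> \<subseteq> forced V R \<pi> e" by (auto simp: forced_def W_def)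
  have "is_greedy W R \<pi>' (greedy W R \<pi>)"
  proof (rule is_greedy_advance[where \<pi> = \<pi> and T = T])
    show "is_greedy W R \<pi> (greedy W R \<pi>)" by (rule is_greedy_greedy[OF fin'(2)])
    show "g \<in> T" if "f \<in> W - greedy W R \<pi>" "f \<in> T" "g \<in> greedy W R \<pi>" "R g f" for f g
    proof -
      have "f \<notin> forced V R \<pi> e" using that by (auto simp: forced_def W_def)
      then have "f \<in> without V R \<pi> e" using that T_iff by blast
      then show ?thesis using that ind1 T_iff sub by blast
    qed
  qed (use le same mono ind2 WV sub in blast)+
  then have "greedy W R \<pi>' = greedy W R \<pi>" by (rule greedy_eqI[OF fin'(2)])
  then have 2: "forced V R \<pi>' e = forced V R \<pi> e" by (simp add: forced_def W_def)
  show ?thesis unfolding affected_def 1 2 ..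
qed

section \<open>The random tape\<close>

abbreviation unif :: "real measure" where
  "unif \<equiv> uniform_measure lborel {0..1}"

lemma prob_space_unif: "prob_space unif"
  by (rule prob_space_uniform_measure) auto

interpretation tape: prob_space tape
  unfolding tape_def by (rule prob_space_PiM) (rule prob_space_unif)

lemma space_tape [simp]: "space tape = UNIV"
  by (simp add: tape_def space_PiM)

lemma measurable_tape_component [measurable]: "(\<lambda>\<omega>. \<omega> i) \<in> borel_measurable tape"
proof -
  have "(\<lambda>\<omega>. \<omega> i) \<in> measurable (\<Pi>\<^sub>M i\<in>UNIV. unif) unif"
    by (rule measurable_component_singleton) simp
  then show ?thesis
    by (simp add: tape_def cong: measurable_cong_sets)
qed

lemma distr_tape_component: "distr tape borel (\<lambda>\<omega>. \<omega> i) = unif"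
proof -
  have "distr tape borel (\<lambda>\<omega>. \<omega> i) = distr (\<Pi>\<^sub>M i\<in>UNIV. unif) unif (\<lambda>\<omega>. \<omega> i)"
    unfolding tape_def by (rule distr_cong) auto
  also have "\<dots> = unif"
    by (rule distr_PiM_component) (auto intro: prob_space_unif)
  finally show ?thesis .
qed

lemma nn_integral_tape_component:
  assumes [measurable]: "f \<in> borel_measurable borel"
  shows "(\<integral>\<^sup>+\<omega>. f (\<omega> i) \<partial>tape) = (\<integral>\<^sup>+x. f x * indicator {0..1} x \<partial>lborel)"
proof -
  have "(\<integral>\<^sup>+\<omega>. f (\<omega> i) \<partial>tape) = (\<integral>\<^sup>+x. f x \<partial>distr tape borel (\<lambda>\<omega>. \<omega> i))"
    by (simp add: nn_integral_distr)
  also have "\<dots> = (\<integral>\<^sup>+x. f x * indicator {0..1} x \<partial>lborel)"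
    unfolding distr_tape_component by (subst nn_integral_uniform_measure) (auto simp: divide_ennreal_def)
  finally show ?thesis .
qed

lemma AE_tape_mem: "AE \<omega> in tape. \<omega> i \<in> {0..1}"
  unfolding tape_def
  by (rule AE_PiM_component) (auto intro: prob_space_unif AE_uniform_measureI)

lemma AE_tape_neq:
  assumes "i \<noteq> j"
  shows "AE \<omega> in tape. \<omega> i \<noteq> \<omega> j"
proof -
  let ?I = "UNIV - {i}"
  let ?P = "unif \<Otimes>\<^sub>M (\<Pi>\<^sub>M i\<in>?I. unif)"
  interpret U: prob_space unif by (rule prob_space_unif)
  interpret Q: prob_space "\<Pi>\<^sub>M i\<in>?I. unif" by (rule prob_space_PiM) (rule prob_space_unif)
  interpret pair_sigma_finite unif "\<Pi>\<^sub>M i\<in>?I. unif" ..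
  have j: "j \<in> ?I" using assms by auto
  have mj: "(\<lambda>X. X j) \<in> measurable (\<Pi>\<^sub>M i\<in>?I. unif) borel"
    using measurable_component_singleton[OF j, of "\<lambda>_. unif"]
    by (simp cong: measurable_cong_sets)
  have mi: "fst \<in> measurable ?P borel"
    using measurable_fst[of unif "\<Pi>\<^sub>M i\<in>?I. unif"] by (simp cong: measurable_cong_sets)
  have mj': "(\<lambda>z. snd z j) \<in> measurable ?P borel"
    by (rule measurable_compose[OF measurable_snd mj])
  have "AE X in (\<Pi>\<^sub>M i\<in>?I. unif). x \<noteq> X j" for x
  proof (rule AE_PiM_component[OF prob_space_unif j, of "\<lambda>y. x \<noteq> y"])
    show "AE y in unif. x \<noteq> y"
      using AE_lborel_singleton[of x] by (auto intro!: AE_uniform_measureI)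
  qed
  then have "AE z in ?P. fst z \<noteq> snd z j"
    by (intro AE_pair_measure borel_measurable_neq[OF mi mj']) auto
  then have *: "AE z in ?P. (case z of (x, X) \<Rightarrow> X(i := x)) i \<noteq> (case z of (x, X) \<Rightarrow> X(i := x)) j"
    using assms by (auto simp: case_prod_beta)
  have eq: "distr ?P (\<Pi>\<^sub>M i\<in>insert i ?I. unif) (\<lambda>(x, X). X(i := x)) = (\<Pi>\<^sub>M i\<in>insert i ?I. unif)"
    by (rule distr_pair_PiM_eq_PiM) (auto intro: prob_space_unif)
  have ins: "insert i ?I = UNIV" by auto
  have "AE \<omega> in distr ?P (\<Pi>\<^sub>M i\<in>insert i ?I. unif) (\<lambda>(x, X). X(i := x)). \<omega> i \<noteq> \<omega> j"
  proof (subst AE_distr_iff)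
    show "(\<lambda>(x, X). X(i := x)) \<in> measurable ?P (\<Pi>\<^sub>M i\<in>insert i ?I. unif)"
      unfolding case_prod_beta by (rule measurable_fun_upd[where J = ?I]) auto
    have "{\<omega> \<in> space tape. \<omega> i \<noteq> \<omega> j} \<in> sets tape"
      by (rule borel_measurable_neq[OF measurable_tape_component measurable_tape_component])
    then show "{\<omega> \<in> space (\<Pi>\<^sub>M i\<in>insert i ?I. unif). \<omega> i \<noteq> \<omega> j} \<in> sets (\<Pi>\<^sub>M i\<in>insert i ?I. unif)"
      unfolding ins tape_def .
  qed (use * in simp)
  then show ?thesis unfolding eq unfolding ins tape_def .
qed

lemma distr_tape_transpose: "distr tape tape (\<lambda>\<omega>. \<omega> \<circ> Transposition.transpose i j) = tape"
proof -
  have "distr (Pi\<^sub>M UNIV (\<lambda>_. unif)) (\<Pi>\<^sub>M i\<in>UNIV. unif) (\<lambda>\<omega>. \<lambda>n\<in>UNIV. \<omega> (Transposition.transpose i j n))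
     = (\<Pi>\<^sub>M i\<in>UNIV. unif)"
    by (rule distr_PiM_reindex) (auto intro: prob_space_unif inj_on_subset[OF inj_transpose])
  then show ?thesis by (simp add: tape_def restrict_UNIV comp_def)
qed

lemma measurable_tape_transpose [measurable]: "(\<lambda>\<omega>. \<omega> \<circ> Transposition.transpose i j) \<in> measurable tape tape"
proof -
  have "(\<lambda>\<omega>. \<lambda>n\<in>UNIV. \<omega> (Transposition.transpose i j n)) \<in> measurable (\<Pi>\<^sub>M i\<in>UNIV. unif) (\<Pi>\<^sub>M i\<in>UNIV. unif)"
    by (rule measurable_restrict) (rule measurable_component_singleton, simp)
  then show ?thesis by (simp add: tape_def restrict_UNIV comp_def)
qed

lemma nn_integral_tape_transpose:
  assumes "f \<in> borel_measurable tape"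
  shows "(\<integral>\<^sup>+\<omega>. f (\<omega> \<circ> Transposition.transpose i j) \<partial>tape) = (\<integral>\<^sup>+\<omega>. f \<omega> \<partial>tape)"
proof -
  have "(\<integral>\<^sup>+\<omega>. f \<omega> \<partial>tape) = (\<integral>\<^sup>+\<omega>. f \<omega> \<partial>distr tape tape (\<lambda>\<omega>. \<omega> \<circ> Transposition.transpose i j))"
    by (simp add: distr_tape_transpose)
  also have "\<dots> = (\<integral>\<^sup>+\<omega>. f (\<omega> \<circ> Transposition.transpose i j) \<partial>tape)"
    using assms by (subst nn_integral_distr) auto
  finally show ?thesis by simp
qed

section \<open>Influence of one vertex on the random greedy set\<close>

definition key :: "('a \<Rightarrow> nat) \<Rightarrow> (nat \<Rightarrow> real) \<Rightarrow> 'a \<Rightarrow> real" where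
  "key idx \<omega> e = \<omega> (Suc (idx e))"

definition same_order :: "'a set \<Rightarrow> ('a \<Rightarrow> real) \<Rightarrow> ('a \<Rightarrow> real) \<Rightarrow> bool" where
  "same_order V \<pi> \<pi>' \<longleftrightarrow> (\<forall>x\<in>V. \<forall>y\<in>V. \<pi> x < \<pi> y \<longleftrightarrow> \<pi>' x < \<pi>' y)"

lemma same_orderD: "same_order V \<pi> \<pi>' \<Longrightarrow> x \<in> V \<Longrightarrow> y \<in> V \<Longrightarrow> \<pi> x < \<pi> y \<longleftrightarrow> \<pi>' x < \<pi>' y"
  by (auto simp: same_order_def)

lemma same_order_inj_on:
  assumes "same_order V \<pi> \<pi>'"
  shows "inj_on \<pi> V \<longleftrightarrow> inj_on \<pi>' V"
  using same_orderD[OF assms] unfolding inj_on_def by (metis less_irrefl linorder_less_linear)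

lemma same_order_greedy:
  "finite V \<Longrightarrow> W \<subseteq> V \<Longrightarrow> same_order V \<pi> \<pi>' \<Longrightarrow> greedy W R \<pi> = greedy W R \<pi>'"
  by (rule greedy_cong) (auto simp: same_order_def intro: finite_subset)

lemma same_order_affected:
  assumes "finite V" "same_order V \<pi> \<pi>'"
  shows "affected V R \<pi> e = affected V R \<pi>' e"
proof -
  have "greedy W R \<pi> = greedy W R \<pi>'" if "W \<subseteq> V" for W
    using same_order_greedy assms that by blast
  from this[of "V - {e}"] this[of "{f \<in> V - {e}. \<not> R e f}"] show ?thesis
    unfolding affected_def forced_def without_def by auto
qed

lemma measurable_same_order:
  assumes fin: "finite V" and \<delta>: "\<delta> \<in> measurable borel (count_space UNIV)"
    and \<Phi>: "\<And>\<pi> \<pi>' p. same_order V \<pi> \<pi>' \<Longrightarrow> \<Phi> \<pi> p = \<Phi> \<pi>' p" and N: "space N = UNIV"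
  shows "(\<lambda>\<omega>. \<Phi> (key idx \<omega>) (\<delta> (\<omega> 0))) \<in> measurable tape N"
proof -
  define ord where "ord \<pi> = {(x, y) \<in> V \<times> V. \<pi> x < \<pi> y}" for \<pi> :: "'a \<Rightarrow> real"
  define \<Psi> where "\<Psi> r = \<Phi> (SOME \<pi>. ord \<pi> = r)" for r
  have \<Psi>: "\<Phi> \<pi> p = \<Psi> (ord \<pi>) p" for \<pi> p
  proof -
    have "ord (SOME \<pi>'. ord \<pi>' = ord \<pi>) = ord \<pi>" by (rule someI[where P = "\<lambda>\<pi>'. ord \<pi>' = ord \<pi>"]) simp
    then have "same_order V \<pi> (SOME \<pi>'. ord \<pi>' = ord \<pi>)"
      unfolding same_order_def ord_def by (auto simp: set_eq_iff)
    then show ?thesis unfolding \<Psi>_def by (rule \<Phi>)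
  qed
  have ord: "(\<lambda>\<omega>. ord (key idx \<omega>)) \<in> measurable tape (count_space (Pow (V \<times> V)))"
  proof (subst measurable_count_space_eq2)
    show "finite (Pow (V \<times> V))" using fin by simp
    show "(\<lambda>\<omega>. ord (key idx \<omega>)) \<in> space tape \<rightarrow> Pow (V \<times> V) \<and>
      (\<forall>r\<in>Pow (V \<times> V). (\<lambda>\<omega>. ord (key idx \<omega>)) -` {r} \<inter> space tape \<in> sets tape)"
    proof (intro conjI ballI)
      fix r assume r: "r \<in> Pow (V \<times> V)"
      have "(\<lambda>\<omega>. ord (key idx \<omega>)) -` {r} \<inter> space tape =
        {\<omega> \<in> space tape. \<forall>x\<in>V. \<forall>y\<in>V. key idx \<omega> x < key idx \<omega> y \<longleftrightarrow> (x, y) \<in> r}"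
        using r by (auto simp: ord_def)
      also have "\<dots> \<in> sets tape"
        unfolding key_def using fin by measurable
      finally show "(\<lambda>\<omega>. ord (key idx \<omega>)) -` {r} \<inter> space tape \<in> sets tape" .
    qed (auto simp: ord_def)
  qed
  have "(\<lambda>\<omega>. \<Psi> (ord (key idx \<omega>)) (\<delta> (\<omega> 0))) \<in> measurable tape N"
  proof (rule measurable_compose_countable'[OF _ ord])
    show "(\<lambda>\<omega>. \<Psi> r (\<delta> (\<omega> 0))) \<in> measurable tape N" for r
      by (rule measurable_compose[OF measurable_compose[OF measurable_tape_component \<delta>]])
        (simp add: N)
    show "countable (Pow (V \<times> V))" using fin by (simp add: countable_finite)
  qed
  then show ?thesis by (simp add: \<Psi>)
qed

lemma AE_inj_on_key:
  assumes "finite V" "inj_on idx V"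
  shows "AE \<omega> in tape. inj_on (key idx \<omega>) V"
proof -
  have "AE \<omega> in tape. \<forall>x\<in>V. \<forall>y\<in>V. x \<noteq> y \<longrightarrow> key idx \<omega> x \<noteq> key idx \<omega> y"
    unfolding key_def using assms
    by (intro AE_finite_allI AE_impI AE_tape_neq) (auto dest: inj_onD)
  then show ?thesis by (rule AE_mp) (auto simp: inj_on_def)
qed

lemma key_transpose:
  assumes "inj_on idx V" "e \<in> V" "t \<in> V"
  defines "\<tau> \<equiv> Transposition.transpose (Suc (idx e)) (Suc (idx t))"
  shows "key idx (\<omega> \<circ> \<tau>) e = key idx \<omega> t" "key idx (\<omega> \<circ> \<tau>) t = key idx \<omega> e"
    "f \<in> V \<Longrightarrow> f \<noteq> e \<Longrightarrow> f \<noteq> t \<Longrightarrow> key idx (\<omega> \<circ> \<tau>) f = key idx \<omega> f"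
  using assms by (auto simp: key_def Transposition.transpose_def dest: inj_onD)

context
  fixes V :: "'a set" and R :: "'p \<Rightarrow> 'a \<Rightarrow> 'a \<Rightarrow> bool" and \<delta> :: "real \<Rightarrow> 'p"
    and idx :: "'a \<Rightarrow> nat" and e :: 'a and h :: "real \<Rightarrow> ennreal"
  assumes fin: "finite V" and idx: "inj_on idx V"
    and \<delta>: "\<delta> \<in> measurable borel (count_space UNIV)"
    and R: "\<And>p. symp (R p)" "\<And>p. irreflp (R p)" and e: "e \<in> V"
    and h [measurable]: "h \<in> borel_measurable borel"
begin

definition rank_event :: "nat \<Rightarrow> nat \<Rightarrow> ('a \<Rightarrow> real) \<Rightarrow> 'p \<Rightarrow> bool" where
  "rank_event j i \<pi> p \<longleftrightarrow> inj_on \<pi> V \<and> j < card (affected V (R p) \<pi> e) \<and>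
     card {f \<in> affected V (R p) \<pi> e. \<pi> f < \<pi> e} = i"

definition next_event :: "nat \<Rightarrow> nat \<Rightarrow> 'a \<Rightarrow> ('a \<Rightarrow> real) \<Rightarrow> 'p \<Rightarrow> bool" where
  "next_event j i t \<pi> p \<longleftrightarrow> rank_event j i \<pi> p \<and> t \<in> affected V (R p) \<pi> e \<and> \<pi> e < \<pi> t \<and>
     (\<forall>f\<in>affected V (R p) \<pi> e. \<pi> e < \<pi> f \<longrightarrow> \<not> \<pi> f < \<pi> t)"

lemma rank_event_same_order:
  assumes "same_order V \<pi> \<pi>'"
  shows "rank_event j i \<pi> p = rank_event j i \<pi>' p"
proof -
  have "{f \<in> affected V (R p) \<pi>' e. \<pi> f < \<pi> e} = {f \<in> affected V (R p) \<pi>' e. \<pi>' f < \<pi>' e}"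
    using same_orderD[OF assms _ e] affected_subset[OF fin e, of "R p" \<pi>'] by blast
  then show ?thesis
    using assms by (simp add: rank_event_def same_order_affected[OF fin assms] same_order_inj_on)
qed

lemma next_event_same_order:
  assumes "same_order V \<pi> \<pi>'"
  shows "next_event j i t \<pi> p = next_event j i t \<pi>' p"
proof -
  have "f \<in> affected V (R p) \<pi>' e \<Longrightarrow> g \<in> affected V (R p) \<pi>' e \<Longrightarrow> \<pi> f < \<pi> g \<longleftrightarrow> \<pi>' f < \<pi>' g" for f g
    using same_orderD[OF assms] affected_subset[OF fin e, of "R p" \<pi>'] by blast
  then show ?thesis
    unfolding next_event_def rank_event_same_order[OF assms] same_order_affected[OF fin assms]
    using mem_affected_self[OF fin, of e "R p" \<pi>'] by blast
qed

lemma measurable_rank_event [measurable]: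
  "(\<lambda>\<omega>. indicator {\<omega>. rank_event j i (key idx \<omega>) (\<delta> (\<omega> 0))} \<omega> :: ennreal) \<in> borel_measurable tape"
  using measurable_same_order[OF fin \<delta>, of "\<lambda>\<pi> p. of_bool (rank_event j i \<pi> p) :: ennreal" borel idx]
    rank_event_same_order by (simp add: indicator_def of_bool_def)

lemma measurable_next_event [measurable]:
  "(\<lambda>\<omega>. indicator {\<omega>. next_event j i t (key idx \<omega>) (\<delta> (\<omega> 0))} \<omega> :: ennreal) \<in> borel_measurable tape"
  using measurable_same_order[OF fin \<delta>, of "\<lambda>\<pi> p. of_bool (next_event j i t \<pi> p) :: ennreal" borel idx]
    next_event_same_order by (simp add: indicator_def of_bool_def)

lemma rank_event_imp_next_event:
  assumes "rank_event j i \<pi> p" "i < j"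
  shows "\<exists>t\<in>V. next_event j i t \<pi> p"
proof -
  let ?T = "affected V (R p) \<pi> e"
  let ?L = "{f \<in> ?T. \<pi> f < \<pi> e}" and ?U = "{f \<in> ?T. \<pi> e < \<pi> f}"
  have TV: "?T \<subseteq> V" by (rule affected_subset[OF fin e])
  then have finT: "finite ?T" using fin finite_subset by blast
  have inj: "inj_on \<pi> V" using assms by (simp add: rank_event_def)
  have "?U \<noteq> {}"
  proof
    assume "?U = {}"
    have "?T \<subseteq> insert e ?L"
    proof
      fix f assume f: "f \<in> ?T"
      then have "\<not> \<pi> e < \<pi> f" using \<open>?U = {}\<close> by blast
      moreover have "f = e \<or> \<pi> f \<noteq> \<pi> e" using f TV inj e by (auto dest: inj_onD)
      ultimately show "f \<in> insert e ?L" using f by auto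
    qed
    then have "card ?T \<le> card (insert e ?L)" using finT by (intro card_mono) auto
    also have "\<dots> \<le> Suc (card ?L)" by (rule card_insert_le_m1) auto
    finally show False using assms by (simp add: rank_event_def)
  qed
  then obtain t where "is_arg_min \<pi> (\<lambda>x. x \<in> ?U) t"
    using ex_is_arg_min_if_finite[of ?U \<pi>] finT by auto
  then have "t \<in> ?T" "\<pi> e < \<pi> t" "\<forall>f\<in>?T. \<pi> e < \<pi> f \<longrightarrow> \<not> \<pi> f < \<pi> t"
    by (auto simp: is_arg_min_def)
  then show ?thesis using assms TV by (auto simp: next_event_def)
qed

lemma next_event_swap:
  assumes t: "t \<in> V" and next_event: "next_event j i t \<pi> p"
    and \<pi>': "\<pi>' e = \<pi> t" "\<pi>' t = \<pi> e" "\<And>f. f \<in> V \<Longrightarrow> f \<noteq> e \<Longrightarrow> f \<noteq> t \<Longrightarrow> \<pi>' f = \<pi> f"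
  shows "rank_event j (Suc i) \<pi>' p"
    and "t \<in> affected V (R p) \<pi>' e" "\<pi>' t < \<pi>' e"
    and "\<And>f. f \<in> affected V (R p) \<pi>' e \<Longrightarrow> \<pi>' f < \<pi>' e \<Longrightarrow> \<pi>' f \<le> \<pi>' t"
proof -
  let ?T = "affected V (R p) \<pi> e"
  have TV: "?T \<subseteq> V" by (rule affected_subset[OF fin e])
  have inj: "inj_on \<pi> V" and tT: "t \<in> ?T" and et: "\<pi> e < \<pi> t"
    and succ: "\<And>f. f \<in> ?T \<Longrightarrow> \<pi> e < \<pi> f \<Longrightarrow> \<pi> t \<le> \<pi> f"
    using next_event by (auto simp: next_event_def rank_event_def not_less)
  have T: "affected V (R p) \<pi>' e = ?T"
    by (rule affected_swap[OF fin inj R e tT et succ \<pi>'])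
  have inj': "inj_on \<pi>' V"
  proof (rule inj_onI)
    fix x y assume "x \<in> V" "y \<in> V" "\<pi>' x = \<pi>' y"
    then show "x = y"
      using inj e t \<pi>' by (cases "x = e"; cases "x = t"; cases "y = e"; cases "y = t")
        (auto dest: inj_onD)
  qed
  have low: "f \<in> ?T \<Longrightarrow> \<pi>' f < \<pi>' e \<longleftrightarrow> f = t \<or> \<pi> f < \<pi> e" for f
  proof -
    assume f: "f \<in> ?T"
    then have "f = e \<or> \<pi> f \<noteq> \<pi> e" using TV inj e by (auto dest: inj_onD)
    then show ?thesis
      using f TV \<pi>' et succ[of f] by (cases "f = e"; cases "f = t") force+
  qed
  then have "{f \<in> ?T. \<pi>' f < \<pi>' e} = insert t {f \<in> ?T. \<pi> f < \<pi> e}"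
    using tT by auto
  moreover have "finite ?T" using TV fin finite_subset by blast
  ultimately have "card {f \<in> ?T. \<pi>' f < \<pi>' e} = Suc (card {f \<in> ?T. \<pi> f < \<pi> e})"
    using et by simp
  then show "rank_event j (Suc i) \<pi>' p"
    using next_event inj' by (simp add: rank_event_def next_event_def T)
  show "t \<in> affected V (R p) \<pi>' e" "\<pi>' t < \<pi>' e" using T tT \<pi>' et by auto
  show "\<pi>' f \<le> \<pi>' t" if "f \<in> affected V (R p) \<pi>' e" "\<pi>' f < \<pi>' e" for f
    using that low[of f] TV \<pi>' et unfolding T by (cases "f = e"; cases "f = t") auto
qed

lemma rank_event_step:
  assumes "i < j"
  shows "(\<integral>\<^sup>+\<omega>. h (\<omega> 0) * indicator {\<omega>. rank_event j i (key idx \<omega>) (\<delta> (\<omega> 0))} \<omega> \<partial>tape) \<le>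
    (\<integral>\<^sup>+\<omega>. h (\<omega> 0) * indicator {\<omega>. rank_event j (Suc i) (key idx \<omega>) (\<delta> (\<omega> 0))} \<omega> \<partial>tape)"
proof -
  define A where "A i = {\<omega>. rank_event j i (key idx \<omega>) (\<delta> (\<omega> 0))}" for i
  define B where "B t = {\<omega>. next_event j i t (key idx \<omega>) (\<delta> (\<omega> 0))}" for t
  define \<tau> where "\<tau> t = Transposition.transpose (Suc (idx e)) (Suc (idx t))" for t
  have [measurable]: "(\<lambda>\<omega>. indicator (B t) \<omega> :: ennreal) \<in> borel_measurable tape"
    "(\<lambda>\<omega>. indicator (A i) \<omega> :: ennreal) \<in> borel_measurable tape" for t i
    by (auto simp: A_def B_def)
  have \<tau>0 [simp]: "\<tau> t 0 = 0" for t by (simp add: \<tau>_def Transposition.transpose_def)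
  have \<tau>\<tau>: "(\<omega> \<circ> \<tau> t) \<circ> \<tau> t = \<omega>" for \<omega> :: "nat \<Rightarrow> real" and t
    by (simp add: \<tau>_def comp_assoc)
  have cover: "(indicator (A i) \<omega> :: ennreal) \<le> (\<Sum>t\<in>V. indicator (B t) \<omega>)" for \<omega>
  proof (cases "\<omega> \<in> A i")
    case True
    then obtain t where "t \<in> V" "\<omega> \<in> B t"
      using rank_event_imp_next_event[OF _ assms] by (auto simp: A_def B_def)
    then have "(indicator (A i) \<omega> :: ennreal) \<le> indicator (B t) \<omega>" by (simp add: indicator_def)
    also have "\<dots> \<le> (\<Sum>t\<in>V. indicator (B t) \<omega>)"
      using fin \<open>t \<in> V\<close> by (intro member_le_sum) auto
    finally show ?thesis .
  qed simp
  have pack: "(\<Sum>t\<in>V. indicator (B t) (\<omega> \<circ> \<tau> t)) \<le> (indicator (A (Suc i)) \<omega> :: ennreal)" for \<omega>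
  proof -
    let ?C = "{t \<in> V. \<omega> \<circ> \<tau> t \<in> B t}"
    have C: "rank_event j (Suc i) (key idx \<omega>) (\<delta> (\<omega> 0)) \<and>
        t \<in> affected V (R (\<delta> (\<omega> 0))) (key idx \<omega>) e \<and> key idx \<omega> t < key idx \<omega> e \<and>
        (\<forall>f \<in> affected V (R (\<delta> (\<omega> 0))) (key idx \<omega>) e. key idx \<omega> f < key idx \<omega> e \<longrightarrow>
            key idx \<omega> f \<le> key idx \<omega> t)" if "t \<in> ?C" for t
    proof -
      have "t \<in> V" "next_event j i t (key idx (\<omega> \<circ> \<tau> t)) (\<delta> (\<omega> 0))"
        using that by (auto simp: B_def)
      note sw = next_event_swap[OF this, where \<pi>' = "key idx \<omega>"]
      note k = key_transpose[OF idx e \<open>t \<in> V\<close>, where \<omega> = \<omega>, folded \<tau>_def]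
      show ?thesis using sw[OF k(2)[symmetric] k(1)[symmetric] k(3)[symmetric]] by blast
    qed
    have "card ?C \<le> Suc 0"
    proof (subst card_le_Suc0_iff_eq)
      show "finite ?C" using fin by simp
      show "\<forall>t\<in>?C. \<forall>t'\<in>?C. t = t'"
      proof (intro ballI)
        fix t t' assume tt: "t \<in> ?C" "t' \<in> ?C"
        have "key idx \<omega> t = key idx \<omega> t'" using C[OF tt(1)] C[OF tt(2)] by (meson order_antisym)
        moreover have "inj_on (key idx \<omega>) V" using C[OF tt(1)] by (simp add: rank_event_def)
        ultimately show "t = t'" using tt by (auto dest: inj_onD)
      qed
    qed
    moreover have "card ?C = 0" if "\<omega> \<notin> A (Suc i)"
    proof -
      have "?C = {}" using C that unfolding A_def by blast
      then show ?thesis by (simp only: card.empty)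
    qed
    moreover have "(\<Sum>t\<in>V. indicator (B t) (\<omega> \<circ> \<tau> t)) = (of_nat (card ?C) :: ennreal)"
    proof -
      have "(\<Sum>t\<in>V. indicator (B t) (\<omega> \<circ> \<tau> t)) = (\<Sum>t\<in>?C. 1 :: ennreal)"
        using fin by (intro sum.mono_neutral_cong_right) (auto simp: indicator_def)
      then show ?thesis by simp
    qed
    ultimately show ?thesis
      by (cases "\<omega> \<in> A (Suc i)") (auto simp: le_Suc_eq)
  qed
  have "(\<integral>\<^sup>+\<omega>. h (\<omega> 0) * indicator (A i) \<omega> \<partial>tape) \<le>
      (\<integral>\<^sup>+\<omega>. (\<Sum>t\<in>V. h (\<omega> 0) * indicator (B t) \<omega>) \<partial>tape)"
    by (intro nn_integral_mono) (simp add: sum_distrib_left[symmetric] mult_left_mono cover)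
  also have "\<dots> = (\<Sum>t\<in>V. \<integral>\<^sup>+\<omega>. h (\<omega> 0) * indicator (B t) \<omega> \<partial>tape)"
    by (rule nn_integral_sum) measurable
  also have "\<dots> = (\<Sum>t\<in>V. \<integral>\<^sup>+\<omega>. h (\<omega> 0) * indicator (B t) (\<omega> \<circ> \<tau> t) \<partial>tape)"
  proof (rule sum.cong[OF refl])
    fix t
    have "(\<integral>\<^sup>+\<omega>. h (\<omega> 0) * indicator (B t) \<omega> \<partial>tape) =
        (\<integral>\<^sup>+\<omega>. h ((\<omega> \<circ> \<tau> t) 0) * indicator (B t) (\<omega> \<circ> \<tau> t) \<partial>tape)"
      unfolding \<tau>_def by (rule nn_integral_tape_transpose[symmetric]) measurable
    then show "(\<integral>\<^sup>+\<omega>. h (\<omega> 0) * indicator (B t) \<omega> \<partial>tape) =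
        (\<integral>\<^sup>+\<omega>. h (\<omega> 0) * indicator (B t) (\<omega> \<circ> \<tau> t) \<partial>tape)" by simp
  qed
  also have "\<dots> = (\<integral>\<^sup>+\<omega>. (\<Sum>t\<in>V. h (\<omega> 0) * indicator (B t) (\<omega> \<circ> \<tau> t)) \<partial>tape)"
  proof (rule nn_integral_sum[symmetric])
    fix t
    have "(\<lambda>\<omega>. indicator (B t) (\<omega> \<circ> \<tau> t) :: ennreal) \<in> borel_measurable tape"
      unfolding \<tau>_def by measurable
    then show "(\<lambda>\<omega>. h (\<omega> 0) * indicator (B t) (\<omega> \<circ> \<tau> t)) \<in> borel_measurable tape"
      by measurable
  qed
  also have "\<dots> \<le> (\<integral>\<^sup>+\<omega>. h (\<omega> 0) * indicator (A (Suc i)) \<omega> \<partial>tape)"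
    by (intro nn_integral_mono) (simp add: sum_distrib_left[symmetric] mult_left_mono pack)
  finally show ?thesis unfolding A_def .
qed

text \<open>Random greedy has expected influence at most one: \<open>e\<close> matters only if it precedes all
  \<open>affected\<close> vertices, and among the orders with a given affected set the rank of \<open>e\<close> in that set
  is at least as likely to be \<open>i + 1\<close> as \<open>i\<close>.\<close>

lemma influence_le:
  "(\<integral>\<^sup>+\<omega>. h (\<omega> 0) * of_nat (card (sym_diff (greedy V (R (\<delta> (\<omega> 0))) (key idx \<omega>))
      (without V (R (\<delta> (\<omega> 0))) (key idx \<omega>) e))) \<partial>tape) \<le> (\<integral>\<^sup>+\<omega>. h (\<omega> 0) \<partial>tape)"
    (is "?lhs \<le> _")
proof -
  define N where "N = card V"
  define A where "A j i = {\<omega>. rank_event j i (key idx \<omega>) (\<delta> (\<omega> 0))}" for j i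
  have [measurable]: "(\<lambda>\<omega>. indicator (A j i) \<omega> :: ennreal) \<in> borel_measurable tape" for j i
    by (auto simp: A_def)
  have chain: "(\<integral>\<^sup>+\<omega>. h (\<omega> 0) * indicator (A j 0) \<omega> \<partial>tape) \<le>
      (\<integral>\<^sup>+\<omega>. h (\<omega> 0) * indicator (A j i) \<omega> \<partial>tape)" if "i \<le> j" for i j
    using that
  proof (induction i)
    case (Suc i)
    then have "(\<integral>\<^sup>+\<omega>. h (\<omega> 0) * indicator (A j 0) \<omega> \<partial>tape) \<le>
      (\<integral>\<^sup>+\<omega>. h (\<omega> 0) * indicator (A j i) \<omega> \<partial>tape)" by simp
    also have "\<dots> \<le> (\<integral>\<^sup>+\<omega>. h (\<omega> 0) * indicator (A j (Suc i)) \<omega> \<partial>tape)"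
      unfolding A_def by (rule rank_event_step) (use Suc in simp)
    finally show ?case .
  qed simp
  have "?lhs \<le> (\<integral>\<^sup>+\<omega>. (\<Sum>j<N. h (\<omega> 0) * indicator (A j 0) \<omega>) \<partial>tape)"
  proof (rule nn_integral_mono_AE, rule AE_mp[OF AE_inj_on_key[OF fin idx]], rule AE_I2, rule impI)
    fix \<omega> assume inj: "inj_on (key idx \<omega>) V"
    let ?R = "R (\<delta> (\<omega> 0))" and ?k = "key idx \<omega>"
    let ?T = "affected V ?R ?k e"
    have TV: "?T \<subseteq> V" by (rule affected_subset[OF fin e])
    then have cT: "card ?T \<le> N" unfolding N_def by (rule card_mono[OF fin])
    have finT: "finite ?T" using TV fin by (rule finite_subset)
    have mem: "\<omega> \<in> A j 0 \<longleftrightarrow> j < card ?T \<and> {f \<in> ?T. ?k f < ?k e} = {}" for j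
    proof -
      have "card {f \<in> ?T. ?k f < ?k e} = 0 \<longleftrightarrow> {f \<in> ?T. ?k f < ?k e} = {}"
        using finT by (intro card_0_eq) auto
      then show ?thesis unfolding A_def rank_event_def using inj by blast
    qed
    have "(of_nat (card (sym_diff (greedy V ?R ?k) (without V ?R ?k e))) :: ennreal) \<le>
        of_nat (if {f \<in> ?T. ?k f < ?k e} = {} then card ?T else 0)"
      using sym_diff_greedy_without[OF fin inj R] by (intro of_nat_mono)
    also have "\<dots> = (\<Sum>j<N. indicator (A j 0) \<omega>)"
    proof (cases "{f \<in> ?T. ?k f < ?k e} = {}")
      case True
      have "(\<Sum>j<N. indicator (A j 0) \<omega>) = (\<Sum>j<card ?T. 1 :: ennreal)"
        by (intro sum.mono_neutral_cong_right) (use True cT mem in \<open>auto simp: indicator_def\<close>)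
      then show ?thesis using True by simp
    next
      case False
      then have "(indicator (A j 0) \<omega> :: ennreal) = 0" for j using mem by (auto simp: indicator_def)
      then show ?thesis unfolding if_not_P[OF False] by simp
    qed
    finally show "h (\<omega> 0) * of_nat (card (sym_diff (greedy V ?R ?k) (without V ?R ?k e)))
        \<le> (\<Sum>j<N. h (\<omega> 0) * indicator (A j 0) \<omega>)"
      by (simp add: sum_distrib_left[symmetric] mult_left_mono)
  qed
  also have "\<dots> = (\<Sum>j<N. \<integral>\<^sup>+\<omega>. h (\<omega> 0) * indicator (A j 0) \<omega> \<partial>tape)"
    by (rule nn_integral_sum) measurable
  also have "\<dots> \<le> (\<Sum>j<N. \<integral>\<^sup>+\<omega>. h (\<omega> 0) * indicator (A j j) \<omega> \<partial>tape)"
    by (intro sum_mono chain) simp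
  also have "\<dots> = (\<integral>\<^sup>+\<omega>. (\<Sum>j<N. h (\<omega> 0) * indicator (A j j) \<omega>) \<partial>tape)"
    by (rule nn_integral_sum[symmetric]) measurable
  also have "\<dots> \<le> (\<integral>\<^sup>+\<omega>. h (\<omega> 0) \<partial>tape)"
  proof (rule nn_integral_mono)
    fix \<omega>
    let ?r = "card {f \<in> affected V (R (\<delta> (\<omega> 0))) (key idx \<omega>) e. key idx \<omega> f < key idx \<omega> e}"
    have "(\<Sum>j<N. indicator (A j j) \<omega>) \<le> (\<Sum>j<N. if j = ?r then 1 else 0 :: ennreal)"
      by (intro sum_mono) (auto simp: A_def rank_event_def indicator_def)
    also have "\<dots> \<le> 1" by (simp add: sum.delta)
    finally show "(\<Sum>j<N. h (\<omega> 0) * indicator (A j j) \<omega>) \<le> h (\<omega> 0)"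
      using mult_left_mono[of _ 1 "h (\<omega> 0)"] by (simp add: sum_distrib_left[symmetric])
  qed
  finally show ?thesis .
qed

end

section \<open>Greedy matchings by weight class\<close>

definition conflict :: "(edge \<Rightarrow> nat) \<Rightarrow> edge \<Rightarrow> edge \<Rightarrow> bool" where
  "conflict d e f \<longleftrightarrow> e \<noteq> f \<and> e \<inter> f \<noteq> {} \<and> d e = d f"

definition undominated :: "(edge \<Rightarrow> nat) \<Rightarrow> edge set \<Rightarrow> edge set" where
  "undominated d M = {e \<in> M. \<forall>f\<in>M. e \<inter> f \<noteq> {} \<longrightarrow> \<not> d f < d e}"

lemma symp_conflict: "symp (conflict d)" and irreflp_conflict: "irreflp (conflict d)"
  by (auto simp: conflict_def intro!: sympI irreflpI)

lemma undominated_subset: "undominated d M \<subseteq> M"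
  by (auto simp: undominated_def)

lemma undominated_disjoint:
  assumes "\<And>e f. e \<in> M \<Longrightarrow> f \<in> M \<Longrightarrow> \<not> conflict d e f"
    and "e \<in> undominated d M" "f \<in> undominated d M" "e \<noteq> f"
  shows "e \<inter> f = {}"
proof (rule ccontr)
  assume "e \<inter> f \<noteq> {}"
  then have "\<not> d f < d e" "\<not> d e < d f" "e \<in> M" "f \<in> M"
    using assms by (auto simp: undominated_def)
  then show False
    using assms(1)[of e f] \<open>e \<inter> f \<noteq> {}\<close> \<open>e \<noteq> f\<close> by (auto simp: conflict_def)
qed

lemma geometric_sum_above:
  assumes "finite I" "\<And>i. i \<in> I \<Longrightarrow> m < i"
  shows "(\<Sum>i\<in>I. (1/9)^i) \<le> (1/9)^m / (8::real)"
proof -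
  obtain N where N: "I \<subseteq> {..<N}" using assms(1) finite_nat_iff_bounded by blast
  have *: "(\<Sum>i\<in>{Suc m..<Suc m + k}. (1/9)^i) = ((1/9)^m - (1/9)^(m + k)) / (8::real)" for k
  proof (induction k)
    case (Suc k)
    have "(\<Sum>i\<in>{Suc m..<Suc m + Suc k}. (1/9)^i) =
        (\<Sum>i\<in>{Suc m..<Suc m + k}. (1/9)^i) + (1/9)^Suc (m + k) / (1::real)"
      by simp
    then show ?case unfolding Suc.IH by (simp add: field_simps)
  qed simp
  have "(\<Sum>i\<in>I. (1/9)^i) \<le> (\<Sum>i\<in>{Suc m..<Suc m + N}. (1/9)^i :: real)"
    using N assms(2) by (intro sum_mono2) (auto simp: Suc_le_eq)
  also have "\<dots> \<le> (1/9)^m / 8" unfolding * by simp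
  finally show ?thesis .
qed

text \<open>In each lower class at most two edges of \<open>M\<close> meet \<open>f\<close>, so the edges of \<open>M\<close> that \<open>f\<close>
  dominates have total rounded weight at most \<open>2 * (1/9 + 1/81 + \<dots>) = 1/4\<close> times that of \<open>f\<close>.\<close>

lemma dominated_weight_le:
  assumes fin: "finite M" and ind: "\<And>e f. e \<in> M \<Longrightarrow> f \<in> M \<Longrightarrow> \<not> conflict d e f" and f: "card f = 2"
  shows "(\<Sum>g | g \<in> M \<and> d f < d g \<and> g \<inter> f \<noteq> {}. (1/9)^d g) \<le> (1/9)^d f / (4::real)"
proof -
  obtain a b where ab: "f = {a, b}" using f by (auto simp: card_2_iff)
  define A where "A x = {g \<in> M. x \<in> g \<and> d f < d g}" for x
  have finA: "finite (A x)" for x using fin by (simp add: A_def)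
  have A: "(\<Sum>g\<in>A x. (1/9)^d g) \<le> (1/9)^d f / (8::real)" for x
  proof -
    have "inj_on d (A x)" using ind by (auto simp: inj_on_def A_def conflict_def)
    then have "(\<Sum>g\<in>A x. (1/9)^d g) = (\<Sum>i\<in>d ` A x. (1/9)^i :: real)"
      by (simp add: sum.reindex)
    also have "\<dots> \<le> (1/9)^d f / 8"
      by (rule geometric_sum_above) (use finA in \<open>auto simp: A_def\<close>)
    finally show ?thesis .
  qed
  have "(\<Sum>g | g \<in> M \<and> d f < d g \<and> g \<inter> f \<noteq> {}. (1/9)^d g) \<le> (\<Sum>g\<in>A a \<union> A b. (1/9)^d g :: real)"
    by (rule sum_mono2) (use finA in \<open>auto simp: A_def ab\<close>)
  also have "\<dots> \<le> (\<Sum>g\<in>A a \<union> A b. (1/9)^d g) + (\<Sum>g\<in>A a \<inter> A b. (1/9)^d g)"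
    by (simp add: sum_nonneg)
  also have "\<dots> = (\<Sum>g\<in>A a. (1/9)^d g) + (\<Sum>g\<in>A b. (1/9)^d g)"
    by (rule sum.union_inter) (use finA in auto)
  finally show ?thesis using A[of a] A[of b] by simp
qed

lemma sum_dominated_le:
  assumes fin: "finite M" "finite D" and ind: "\<And>e f. e \<in> M \<Longrightarrow> f \<in> M \<Longrightarrow> \<not> conflict d e f"
    and D: "\<And>f. f \<in> D \<Longrightarrow> card f = 2"
    and X: "X \<subseteq> M" "\<And>g. g \<in> X \<Longrightarrow> \<exists>f\<in>D. g \<inter> f \<noteq> {} \<and> d f < d g"
  shows "(\<Sum>g\<in>X. (1/9)^d g) \<le> (\<Sum>f\<in>D. (1/9)^d f) / (4::real)"
proof -
  define B where "B f = {g \<in> M. d f < d g \<and> g \<inter> f \<noteq> {}}" for f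
  have "(\<Sum>g\<in>X. (1/9)^d g) \<le> (\<Sum>g\<in>(\<Union>f\<in>D. B f). (1/9)^d g :: real)"
    by (rule sum_mono2) (use fin X in \<open>fastforce simp: B_def\<close>)+
  also have "\<dots> \<le> (\<Sum>f\<in>D. \<Sum>g\<in>B f. (1/9)^d g)"
    using fin(2)
  proof (induction D rule: finite_induct)
    case (insert f D)
    have "(\<Sum>g\<in>B f \<union> \<Union>(B ` D). (1/9)^d g) \<le> (\<Sum>g\<in>B f. (1/9)^d g) + (\<Sum>g\<in>\<Union>(B ` D). (1/9)^d g :: real)"
      using insert.hyps(1) fin(1)
      by (subst sum.union_inter[symmetric]) (auto simp: B_def intro!: sum_nonneg)
    then show ?case using insert by simp
  qed simp
  also have "\<dots> \<le> (\<Sum>f\<in>D. (1/9)^d f / 4)"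
    unfolding B_def by (intro sum_mono dominated_weight_le fin ind D)
  finally show ?thesis by (simp add: sum_divide_distrib)
qed

lemma sym_diff_undominated_le:
  assumes fin: "finite M" "finite M'" and ind: "\<And>e f. e \<in> M \<Longrightarrow> f \<in> M \<Longrightarrow> \<not> conflict d e f"
    and two: "\<And>e. e \<in> M \<union> M' \<Longrightarrow> card e = 2"
  shows "(\<Sum>g\<in>sym_diff (undominated d M) (undominated d M'). (1/9)^d g) \<le>
    5/4 * (\<Sum>f\<in>sym_diff M M'. (1/9)^d f :: real)"
proof -
  define D where "D = sym_diff M M'"
  define X where "X = sym_diff (undominated d M) (undominated d M') - D"
  have finD: "finite D" "finite X" using fin by (auto simp: D_def X_def undominated_def)
  have "(\<Sum>g\<in>sym_diff (undominated d M) (undominated d M'). (1/9)^d g) \<le>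
      (\<Sum>g\<in>D \<union> X. (1/9)^d g :: real)"
    by (rule sum_mono2) (use finD in \<open>auto simp: X_def\<close>)
  also have "\<dots> = (\<Sum>g\<in>D. (1/9)^d g) + (\<Sum>g\<in>X. (1/9)^d g)"
    by (rule sum.union_disjoint) (use finD in \<open>auto simp: X_def\<close>)
  also have "(\<Sum>g\<in>X. (1/9)^d g) \<le> (\<Sum>f\<in>D. (1/9)^d f) / (4::real)"
  proof (rule sum_dominated_le[OF fin(1) finD(1) ind])
    show "X \<subseteq> M" by (auto simp: X_def D_def undominated_def)
    show "\<exists>f\<in>D. g \<inter> f \<noteq> {} \<and> d f < d g" if "g \<in> X" for g
      using that unfolding X_def D_def undominated_def by blast
    show "card f = 2" if "f \<in> D" for f using that two by (auto simp: D_def)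
  qed auto
  finally show ?thesis by (simp add: D_def)
qed

definition class_matching :: "edge set \<Rightarrow> (edge \<Rightarrow> nat) \<Rightarrow> (edge \<Rightarrow> real) \<Rightarrow> edge set" where
  "class_matching E d \<pi> = undominated d (greedy E (conflict d) \<pi>)"

definition influence :: "edge set \<Rightarrow> (edge \<Rightarrow> nat) \<Rightarrow> (edge \<Rightarrow> real) \<Rightarrow> edge \<Rightarrow> nat" where
  "influence E d \<pi> e = card (sym_diff (greedy E (conflict d) \<pi>) (without E (conflict d) \<pi> e))"

lemma class_matching_subset: "finite E \<Longrightarrow> class_matching E d \<pi> \<subseteq> E"
  using greedy_subset undominated_subset unfolding class_matching_def by blast

lemma sym_diff_greedy_without_class:
  assumes "finite E" "f \<in> sym_diff (greedy E (conflict d) \<pi>) (without E (conflict d) \<pi> e)"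
  shows "d f = d e"
proof (rule ccontr)
  assume "d f \<noteq> d e"
  then have "f \<in> greedy E (conflict d) \<pi> \<longleftrightarrow> f \<in> greedy (E - {e}) (conflict d) \<pi>"
    by (intro is_greedy_agree[OF assms(1) is_greedy_greedy is_greedy_greedy,
          where P = "\<lambda>f. d f \<noteq> d e"]) (use assms(1) in \<open>auto simp: conflict_def\<close>)
  then show False using assms(2) by (auto simp: without_def)
qed

lemma class_matching_removal_le:
  assumes fin: "finite E" and inj: "inj_on \<pi> E" and two: "\<And>e. e \<in> E \<Longrightarrow> card e = 2"
  shows "(\<Sum>g\<in>sym_diff (class_matching E d \<pi>) (undominated d (without E (conflict d) \<pi> e)). (1/9)^d g)
    \<le> 5/4 * (1/9)^d e * real (influence E d \<pi> e)"
proof -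
  let ?M = "greedy E (conflict d) \<pi>" and ?M' = "without E (conflict d) \<pi> e"
  have sub: "?M \<subseteq> E" "?M' \<subseteq> E"
    using greedy_subset[OF fin] greedy_subset[of "E - {e}"] fin unfolding without_def by blast+
  have "(\<Sum>g\<in>sym_diff (class_matching E d \<pi>) (undominated d ?M'). (1/9)^d g) \<le>
      5/4 * (\<Sum>f\<in>sym_diff ?M ?M'. (1/9)^d f :: real)"
    unfolding class_matching_def
    by (rule sym_diff_undominated_le)
      (use sub fin two greedy_independent[OF fin inj symp_conflict irreflp_conflict]
        in \<open>auto intro: finite_subset\<close>)
  also have "(\<Sum>f\<in>sym_diff ?M ?M'. (1/9)^d f :: real) = (\<Sum>f\<in>sym_diff ?M ?M'. (1/9)^d e)"
    by (rule sum.cong[OF refl]) (simp only: sym_diff_greedy_without_class[OF fin])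
  also have "\<dots> = real (influence E d \<pi> e) * (1/9)^d e"
    by (simp add: influence_def)
  finally show ?thesis by (simp add: mult_ac)
qed

lemma sum_sym_diff_triangle:
  fixes m :: "'a \<Rightarrow> real"
  assumes "finite A" "finite B" "finite C" "\<And>x. x \<in> A \<union> B \<union> C \<Longrightarrow> 0 \<le> m x"
  shows "sum m (sym_diff A C) \<le> sum m (sym_diff A B) + sum m (sym_diff B C)"
proof -
  have "sum m (sym_diff A C) \<le> sum m (sym_diff A B \<union> sym_diff B C)"
    using assms by (intro sum_mono2) auto
  also have "\<dots> \<le> sum m (sym_diff A B \<union> sym_diff B C) + sum m (sym_diff A B \<inter> sym_diff B C)"
    using assms by (auto intro!: sum_nonneg)
  also have "\<dots> = sum m (sym_diff A B) + sum m (sym_diff B C)"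
    using assms by (intro sum.union_inter) auto
  finally show ?thesis .
qed

lemma class_matching_update_le:
  assumes fin: "finite E" and inj: "inj_on \<pi> E" and two: "\<And>e. e \<in> E \<Longrightarrow> card e = 2"
    and m: "\<And>g. g \<in> E \<Longrightarrow> 0 \<le> m g" "\<And>g. g \<in> E \<Longrightarrow> m g \<le> c * (1/9)^d g"
      "\<And>g. g \<in> E \<Longrightarrow> m g \<le> c * (1/9)^d' g"
    and c: "0 \<le> c" and d': "\<And>g. g \<in> E \<Longrightarrow> g \<noteq> e \<Longrightarrow> d' g = d g"
  shows "sum m (sym_diff (class_matching E d \<pi>) (class_matching E d' \<pi>)) \<le>
    5/4 * c * ((1/9)^d e * real (influence E d \<pi> e) + (1/9)^d' e * real (influence E d' \<pi> e))"
proof -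
  let ?W = "without E (conflict d) \<pi> e"
  have W: "without E (conflict d') \<pi> e = ?W"
    unfolding without_def by (rule greedy_cong) (use fin d' in \<open>auto simp: conflict_def\<close>)
  have WE: "?W \<subseteq> E - {e}" unfolding without_def by (rule greedy_subset) (use fin in simp)
  have uW: "undominated d' ?W = undominated d ?W"
  proof -
    have "d' g = d g" if "g \<in> ?W" for g using that WE d' by blast
    then show ?thesis by (auto simp: undominated_def)
  qed
  have sub: "class_matching E d \<pi> \<subseteq> E" "class_matching E d' \<pi> \<subseteq> E" "undominated d ?W \<subseteq> E"
    using class_matching_subset[OF fin] undominated_subset[of d ?W] WE by auto
  note finS = sub[THEN finite_subset, OF fin]
  have bound: "sum m (sym_diff (class_matching E x \<pi>) (undominated x (without E (conflict x) \<pi> e))) \<le>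
      5/4 * c * ((1/9)^x e * real (influence E x \<pi> e))"
    if x: "\<And>g. g \<in> E \<Longrightarrow> m g \<le> c * (1/9)^x g" "undominated x (without E (conflict x) \<pi> e) \<subseteq> E" for x
  proof -
    let ?D = "sym_diff (class_matching E x \<pi>) (undominated x (without E (conflict x) \<pi> e))"
    have "sum m ?D \<le> (\<Sum>g\<in>?D. c * (1/9)^x g)"
      using x class_matching_subset[OF fin, of x \<pi>] by (intro sum_mono) auto
    also have "\<dots> = c * (\<Sum>g\<in>?D. (1/9)^x g)" by (simp add: sum_distrib_left)
    also have "\<dots> \<le> c * (5/4 * (1/9)^x e * real (influence E x \<pi> e))"
      by (intro mult_left_mono c class_matching_removal_le fin inj two)
    finally show ?thesis by (simp add: mult_ac)
  qed
  have "sum m (sym_diff (class_matching E d \<pi>) (class_matching E d' \<pi>)) \<le>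
      sum m (sym_diff (class_matching E d \<pi>) (undominated d ?W)) +
      sum m (sym_diff (undominated d ?W) (class_matching E d' \<pi>))"
    by (rule sum_sym_diff_triangle) (use finS sub m in auto)
  also have "sym_diff (undominated d ?W) (class_matching E d' \<pi>) =
      sym_diff (class_matching E d' \<pi>) (undominated d' (without E (conflict d') \<pi> e))"
    by (auto simp: W uW)
  also have "sum m (sym_diff (class_matching E d \<pi>) (undominated d ?W)) \<le>
      5/4 * c * ((1/9)^d e * real (influence E d \<pi> e))"
    by (rule bound) (use m sub in auto)
  also have "sum m (sym_diff (class_matching E d' \<pi>) (undominated d' (without E (conflict d') \<pi> e))) \<le>
      5/4 * c * ((1/9)^d' e * real (influence E d' \<pi> e))"
    by (rule bound) (use m sub W uW in auto)
  finally show ?thesis by (simp add: algebra_simps)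
qed

definition hybrid :: "edge list \<Rightarrow> nat \<Rightarrow> (edge \<Rightarrow> nat) \<Rightarrow> (edge \<Rightarrow> nat) \<Rightarrow> edge \<Rightarrow> nat" where
  "hybrid es k d d' e = (if e \<in> set (take k es) then d' e else d e)"

lemma class_matching_hybrid_le:
  assumes es: "distinct es" "set es = E" and inj: "inj_on \<pi> E" and two: "\<And>e. e \<in> E \<Longrightarrow> card e = 2"
    and m: "\<And>g. g \<in> E \<Longrightarrow> 0 \<le> m g" "\<And>g. g \<in> E \<Longrightarrow> m g \<le> c * (1/9)^d g"
      "\<And>g. g \<in> E \<Longrightarrow> m g \<le> c * (1/9)^d' g"
    and c: "0 \<le> c" and k: "k \<le> length es"
  shows "sum m (sym_diff (class_matching E d \<pi>) (class_matching E (hybrid es k d d') \<pi>)) \<le>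
    (\<Sum>i<k. if d (es ! i) = d' (es ! i) then 0 else
       5/4 * c * ((1/9)^d (es ! i) * real (influence E (hybrid es i d d') \<pi> (es ! i)) +
                  (1/9)^d' (es ! i) * real (influence E (hybrid es (Suc i) d d') \<pi> (es ! i))))"
  using k
proof (induction k)
  case 0
  have "hybrid es 0 d d' = d" by (auto simp: hybrid_def)
  then show ?case by simp
next
  case (Suc k)
  let ?h = "hybrid es k d d'" and ?h' = "hybrid es (Suc k) d d'" and ?e = "es ! k"
  have fin: "finite E" using es by auto
  have kl: "k < length es" using Suc.prems by simp
  have take: "take (Suc k) es = take k es @ [?e]" by (rule take_Suc_conv_app_nth[OF kl])
  have ne: "?e \<notin> set (take k es)"
    using es(1) kl by (auto simp: in_set_conv_nth nth_eq_iff_index_eq)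
  have he: "?h ?e = d ?e" "?h' ?e = d' ?e" using ne take by (auto simp: hybrid_def)
  have diff: "?h' g = ?h g" if "g \<noteq> ?e" for g using that take by (auto simp: hybrid_def)
  have mh: "m g \<le> c * (1/9)^hybrid es i d d' g" if "g \<in> E" for g i
    using m that by (auto simp: hybrid_def)
  have step: "sum m (sym_diff (class_matching E ?h \<pi>) (class_matching E ?h' \<pi>)) \<le>
    (if d ?e = d' ?e then 0 else
       5/4 * c * ((1/9)^d ?e * real (influence E ?h \<pi> ?e) + (1/9)^d' ?e * real (influence E ?h' \<pi> ?e)))"
  proof (cases "d ?e = d' ?e")
    case True
    then have "?h' = ?h" using he diff by (metis ext)
    then show ?thesis using True by simp
  next
    case False
    have "sum m (sym_diff (class_matching E ?h \<pi>) (class_matching E ?h' \<pi>)) \<le>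
        5/4 * c * ((1/9)^?h ?e * real (influence E ?h \<pi> ?e) + (1/9)^?h' ?e * real (influence E ?h' \<pi> ?e))"
      by (rule class_matching_update_le[OF fin inj]) (use two m(1) mh c diff in auto)
    then show ?thesis using False he by simp
  qed
  have finC: "finite (class_matching E x \<pi>)" for x
    using class_matching_subset[OF fin] fin finite_subset by blast
  have "sum m (sym_diff (class_matching E d \<pi>) (class_matching E ?h' \<pi>)) \<le>
      sum m (sym_diff (class_matching E d \<pi>) (class_matching E ?h \<pi>)) +
      sum m (sym_diff (class_matching E ?h \<pi>) (class_matching E ?h' \<pi>))"
    by (rule sum_sym_diff_triangle) (use finC class_matching_subset[OF fin] m(1) in blast)+
  also note add_mono[OF Suc.IH[OF less_imp_le[OF kl]] step]
  finally show ?case by simp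
qed

text \<open>As an automatic rule this one would match every function applied to a constant.\<close>

declare measurable_tape_component [measurable del]

section \<open>Weight classes\<close>

text \<open>Class 0 is the heaviest, and class \<open>L\<close> collects all small weights.\<close>

definition level :: "nat \<Rightarrow> real \<Rightarrow> real \<Rightarrow> real \<Rightarrow> nat" where
  "level L S x u = card {i. i < L \<and> x < (1 + 8 * u) * S / 9 ^ Suc i}"

lemma down_closed_eq_lessThan:
  assumes "finite (A :: nat set)" "\<And>i j. i \<in> A \<Longrightarrow> j < i \<Longrightarrow> j \<in> A"
  shows "A = {..<card A}"
proof (rule set_eqI)
  fix i
  show "i \<in> A \<longleftrightarrow> i \<in> {..<card A}"
  proof
    assume "i \<in> A"
    then have "{..i} \<subseteq> A" using assms(2) by (auto simp: le_less)
    then have "card {..i} \<le> card A" by (rule card_mono[OF assms(1)])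
    then show "i \<in> {..<card A}" by simp
  next
    assume i: "i \<in> {..<card A}"
    show "i \<in> A"
    proof (rule ccontr)
      assume "i \<notin> A"
      then have "A \<subseteq> {..<i}" using assms(2) by (metis lessThan_iff linorder_neqE_nat subsetI)
      then have "card A \<le> card {..<i}" by (rule card_mono[rotated]) simp
      then show False using i by simp
    qed
  qed
qed

lemma level_le: "level L S x u \<le> L"
proof -
  have "level L S x u \<le> card {..<L}" unfolding level_def by (rule card_mono) auto
  then show ?thesis by simp
qed

lemma less_level_iff:
  assumes "0 \<le> u" "0 \<le> S"
  shows "i < level L S x u \<longleftrightarrow> i < L \<and> x < (1 + 8 * u) * S / 9 ^ Suc i"
proof -
  let ?A = "{i. i < L \<and> x < (1 + 8 * u) * S / 9 ^ Suc i}"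
  have "?A = {..<card ?A}"
  proof (rule down_closed_eq_lessThan)
    show "finite ?A" by simp
    fix i j assume i: "i \<in> ?A" and "j < i"
    have "(1 + 8 * u) * S / 9 ^ Suc i \<le> (1 + 8 * u) * S / 9 ^ Suc j"
      using \<open>j < i\<close> assms by (intro divide_left_mono power_increasing mult_nonneg_nonneg) auto
    then show "j \<in> ?A" using i \<open>j < i\<close> by auto
  qed
  then show ?thesis unfolding level_def by blast
qed

lemma le_level_weight:
  assumes "0 \<le> u" "0 \<le> S" "x \<le> S"
  shows "x \<le> (1 + 8 * u) * S * (1/9)^level L S x u"
proof (cases "level L S x u")
  case 0
  have "1 * S \<le> (1 + 8 * u) * S" using assms by (intro mult_right_mono) auto
  then show ?thesis using 0 assms by simp
next
  case (Suc i)
  then have "x < (1 + 8 * u) * S / 9 ^ Suc i"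
    using less_level_iff[OF assms(1,2), of i L x] by simp
  then show ?thesis using Suc by (simp add: power_one_over)
qed

lemma level_weight_le:
  assumes "0 \<le> u" "0 \<le> S" "level L S x u < L"
  shows "(1 + 8 * u) * S / 9 * (1/9)^level L S x u \<le> x"
  using less_level_iff[OF assms(1,2), of "level L S x u" L x] assms(3)
  by (simp add: power_one_over divide_simps mult_ac)

lemma level_scale:
  assumes "0 < S"
  shows "level L S x u = level L 1 (x / S) u"
proof -
  have "x < (1 + 8 * u) * S / 9 ^ Suc i \<longleftrightarrow> x / S < (1 + 8 * u) * 1 / 9 ^ Suc i" for i
    using assms by (simp add: field_simps)
  then show ?thesis unfolding level_def by simp
qed

lemma measurable_level [measurable]: "level L S x \<in> measurable borel (count_space UNIV)"
proof -
  have "level L S x = (\<lambda>u. \<Sum>i<L. if x < (1 + 8 * u) * S / 9 ^ Suc i then 1 else 0)"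
  proof
    fix u
    have "{i. i < L \<and> x < (1 + 8 * u) * S / 9 ^ Suc i} = {i \<in> {..<L}. x < (1 + 8 * u) * S / 9 ^ Suc i}"
      by auto
    then show "level L S x u = (\<Sum>i<L. if x < (1 + 8 * u) * S / 9 ^ Suc i then 1 else 0)"
      by (simp only: level_def card_eq_sum sum.inter_filter finite_lessThan)
  qed
  also have "\<dots> \<in> measurable borel (count_space UNIV)" by measurable
  finally show ?thesis .
qed

lemma measurable_level_pair:
  assumes "\<And>a b. f a b \<in> measurable borel N"
  shows "(\<lambda>u. f (level L S x u) (level L S' x' u) u) \<in> measurable borel N"
  by (rule measurable_compose_countable[where f = "\<lambda>i u. f i (level L S' x' u) u", OF _ measurable_level])
    (rule measurable_compose_countable[where f = "\<lambda>j u. f _ j u", OF assms measurable_level])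

definition clamp_above :: "nat \<Rightarrow> real \<Rightarrow> real" where
  "clamp_above n r = min (max r ((1/9)^n)) 1"

abbreviation clamp_gap :: "real \<Rightarrow> real \<Rightarrow> nat \<Rightarrow> real" where
  "clamp_gap r r' j \<equiv> (clamp_above (Suc j) r' - clamp_above j r') - (clamp_above (Suc j) r - clamp_above j r)"

lemma min_max_split:
  fixes a b r :: real
  assumes "a \<le> b" "b \<le> 1"
  shows "min (max r a) 1 - min (max r b) 1 = min (max r a) b - b"
  using assms by (simp add: min_def max_def)

lemma clamp_above_diff:
  "clamp_above (Suc j) r - clamp_above j r = min (max r ((1/9)^Suc j)) ((1/9)^j) - (1/9)^j"
  unfolding clamp_above_def by (rule min_max_split) (auto intro: power_le_one)

lemma nn_integral_threshold_le:
  assumes "r \<le> r'"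
  shows "(\<integral>\<^sup>+u. ennreal ((1 + 8 * u) / 9 ^ Suc j * of_bool (r < (1 + 8 * u) / 9 ^ Suc j \<and> (1 + 8 * u) / 9 ^ Suc j \<le> r'))
      * indicator {0..1} u \<partial>lborel) \<le>
    ennreal (9/8 * (clamp_gap r r' j))"
    (is "?lhs \<le> ennreal (9/8 * ?gap)")
proof -
  define a :: real where "a = (1/9)^Suc j"
  have a: "0 < a" "(1/9)^j = 9 * a" by (auto simp: a_def)
  define c where "c r = min (max r a) (9 * a)" for r
  have cc: "clamp_above (Suc j) r - clamp_above j r = c r - 9 * a" for r
    using clamp_above_diff[of j r] by (simp only: a(2) c_def flip: a_def)
  have gap: "?gap = c r' - c r" unfolding cc by simp
  have mono: "c r \<le> c r'" using assms by (auto simp: c_def)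
  define l where "l r = (c r / a - 1) / 8" for r
  have "?lhs \<le> (\<integral>\<^sup>+u. ennreal (9 * a) * indicator {l r..l r'} u \<partial>lborel)"
  proof (rule nn_integral_mono)
    fix u :: real
    have t: "(1 + 8 * u) / 9 ^ Suc j = (1 + 8 * u) * a" by (simp add: a_def power_one_over)
    show "ennreal ((1 + 8 * u) / 9 ^ Suc j * of_bool (r < (1 + 8 * u) / 9 ^ Suc j \<and> (1 + 8 * u) / 9 ^ Suc j \<le> r'))
        * indicator {0..1} u \<le> ennreal (9 * a) * indicator {l r..l r'} u"
    proof (cases "u \<in> {0..1} \<and> r < (1 + 8 * u) * a \<and> (1 + 8 * u) * a \<le> r'")
      case True
      then have bd: "a \<le> (1 + 8 * u) * a" "(1 + 8 * u) * a \<le> 9 * a"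
        using a(1) by (auto simp: algebra_simps)
      then have "c r \<le> (1 + 8 * u) * a" "(1 + 8 * u) * a \<le> c r'"
        using True by (auto simp: c_def)
      then have "u \<in> {l r..l r'}" using a(1) by (auto simp: l_def field_simps)
      then show ?thesis using True bd unfolding t by (auto intro!: ennreal_leI)
    next
      case False
      then show ?thesis unfolding t by (auto simp: indicator_def)
    qed
  qed
  also have "\<dots> = ennreal (9 * a) * ennreal (l r' - l r)"
    using mono a(1) by (subst nn_integral_cmult_indicator) (auto simp: l_def divide_right_mono)
  also have "\<dots> = ennreal (9/8 * ?gap)"
    unfolding gap using a(1) mono
    by (subst ennreal_mult'[symmetric]) (auto simp: l_def field_simps intro!: arg_cong[where f = ennreal])
  finally show ?thesis .
qed

lemma clamp_above_telescope:
  assumes "r \<le> r'"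
  shows "(\<Sum>j<L. clamp_gap r r' j) \<le> r' - r"
proof -
  have "(\<Sum>j<L. clamp_gap r r' j)
      = clamp_above L r' - clamp_above L r"
    by (induction L) (auto simp: clamp_above_def)
  also have "\<dots> \<le> r' - r" using assms by (auto simp: clamp_above_def min_def max_def)
  finally show ?thesis .
qed

lemma clamp_above_gap_nonneg:
  assumes "r \<le> r'"
  shows "0 \<le> clamp_gap r r' j"
proof -
  have "min (max r a) b \<le> min (max r' a) b" for a b :: real
    by (intro min.mono max.mono order_refl assms)
  then show ?thesis unfolding clamp_above_diff by (simp only: diff_diff_eq2 diff_add_cancel diff_ge_0_iff_ge)
qed

abbreviation class_change :: "nat \<Rightarrow> real \<Rightarrow> real \<Rightarrow> real \<Rightarrow> real" where
  "class_change L r r' u \<equiv> (if level L 1 r u = level L 1 r' u then 0 else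
     (1 + 8 * u) * ((1/9)^level L 1 r u + (1/9)^level L 1 r' u))"

text \<open>If \<open>r\<close> and \<open>r'\<close> are in different classes then some threshold \<open>t\<close> separates them, and the
  costs of both classes are \<open>O(t)\<close>. Averaged over \<open>u\<close>, the separating thresholds sweep \<open>(r, r']\<close>
  with density \<open>O(1/t)\<close>.\<close>

lemma expected_class_change_ordered:
  assumes "r \<le> r'"
  shows "(\<integral>\<^sup>+u. ennreal (class_change L r r' u) * indicator {0..1} u \<partial>lborel)
    \<le> ennreal (81/4 * (r' - r))"
proof -
  define t :: "nat \<Rightarrow> real \<Rightarrow> real" where "t j u = (1 + 8 * u) / 9 ^ Suc j" for j u
  define F where "F j u = t j u * of_bool (r < t j u \<and> t j u \<le> r')" for j u
  define gap where "gap j = clamp_gap r r' j" for j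
  have F0: "0 \<le> F j u" if "0 \<le> u" for j u using that by (simp add: F_def t_def)
  have [measurable]: "F j \<in> borel_measurable borel" for j
    unfolding F_def t_def by measurable
  have pt: "class_change L r r' u \<le> 18 * (\<Sum>j<L. F j u)"
    if u: "0 \<le> u" for u
  proof (cases "level L 1 r u = level L 1 r' u")
    case True
    then show ?thesis using F0[OF u] by (simp add: sum_nonneg)
  next
    case False
    let ?i = "level L 1 r' u"
    have lt: "i < level L 1 x u \<longleftrightarrow> i < L \<and> x < t i u" for i x
      using less_level_iff[OF u, of 1 i L x] by (simp add: t_def)
    have "?i \<le> level L 1 r u"
      using lt[of "level L 1 r u" r'] lt[of "level L 1 r u" r] assms by linarith
    then have less: "?i < level L 1 r u" using False by simp
    have i: "?i < L" "r < t ?i u" "t ?i u \<le> r'" using lt[of ?i r] lt[of ?i r'] less by auto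
    have "(1/9)^level L 1 r u \<le> (1/9::real)^?i" using less by (intro power_decreasing) auto
    then have "(1 + 8 * u) * ((1/9)^level L 1 r u + (1/9)^?i) \<le> (1 + 8 * u) * (2 * (1/9)^?i)"
      using u by (intro mult_left_mono) auto
    also have "\<dots> = 18 * F ?i u" using i by (simp add: F_def t_def power_one_over field_simps)
    also have "\<dots> \<le> 18 * (\<Sum>j<L. F j u)"
      using i(1) F0[OF u] by (intro mult_left_mono member_le_sum) auto
    finally show ?thesis using False by simp
  qed
  have "(\<integral>\<^sup>+u. ennreal (class_change L r r' u) * indicator {0..1} u \<partial>lborel)
      \<le> (\<integral>\<^sup>+u. 18 * (\<Sum>j<L. ennreal (F j u) * indicator {0..1} u) \<partial>lborel)"
  proof (rule nn_integral_mono)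
    fix u :: real
    show "ennreal (class_change L r r' u) * indicator {0..1} u
        \<le> 18 * (\<Sum>j<L. ennreal (F j u) * indicator {0..1} u)"
    proof (cases "u \<in> {0..1}")
      case True
      then have u: "0 \<le> u" by simp
      have "18 * (\<Sum>j<L. ennreal (F j u)) = ennreal 18 * ennreal (\<Sum>j<L. F j u)"
        using F0[OF u] by (simp add: sum_ennreal)
      also have "\<dots> = ennreal (18 * (\<Sum>j<L. F j u))"
        using F0[OF u] by (intro ennreal_mult[symmetric]) (auto intro: sum_nonneg)
      finally have eq: "ennreal (18 * (\<Sum>j<L. F j u)) = 18 * (\<Sum>j<L. ennreal (F j u))" by simp
      show ?thesis using True ennreal_leI[OF pt[OF u]] unfolding eq by simp
    qed simp
  qed
  also have "\<dots> = 18 * (\<Sum>j<L. \<integral>\<^sup>+u. ennreal (F j u) * indicator {0..1} u \<partial>lborel)"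
  proof -
    have "(\<integral>\<^sup>+u. 18 * (\<Sum>j<L. ennreal (F j u) * indicator {0..1} u) \<partial>lborel) =
        18 * (\<integral>\<^sup>+u. (\<Sum>j<L. ennreal (F j u) * indicator {0..1} u) \<partial>lborel)"
      by (rule nn_integral_cmult) measurable
    also have "(\<integral>\<^sup>+u. (\<Sum>j<L. ennreal (F j u) * indicator {0..1} u) \<partial>lborel) =
        (\<Sum>j<L. \<integral>\<^sup>+u. ennreal (F j u) * indicator {0..1} u \<partial>lborel)"
      by (rule nn_integral_sum) measurable
    finally show ?thesis .
  qed
  also have "\<dots> \<le> 18 * (\<Sum>j<L. ennreal (9/8 * gap j))"
    unfolding F_def t_def gap_def
    by (intro mult_left_mono sum_mono nn_integral_threshold_le assms) simp
  also have "\<dots> = ennreal (18 * (\<Sum>j<L. 9/8 * gap j))"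
  proof -
    have g: "0 \<le> gap j" for j unfolding gap_def by (rule clamp_above_gap_nonneg[OF assms])
    have "(\<Sum>j<L. ennreal (9/8 * gap j)) = ennreal (\<Sum>j<L. 9/8 * gap j)"
      using g by (intro sum_ennreal) simp
    moreover have "ennreal 18 * ennreal (\<Sum>j<L. 9/8 * gap j) = ennreal (18 * (\<Sum>j<L. 9/8 * gap j))"
      using g by (intro ennreal_mult[symmetric]) (auto intro!: sum_nonneg)
    ultimately show ?thesis by simp
  qed
  also have "\<dots> \<le> ennreal (81/4 * (r' - r))"
  proof (rule ennreal_leI)
    have "18 * (9/8 * x) \<le> 81/4 * y" if "x \<le> y" for x y :: real using that by simp
    from this[OF clamp_above_telescope[OF assms, of L]]
    show "18 * (\<Sum>j<L. 9/8 * gap j) \<le> 81/4 * (r' - r)"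
      unfolding gap_def sum_distrib_left[symmetric] .
  qed
  finally show ?thesis .
qed

lemma expected_class_change:
  "(\<integral>\<^sup>+u. ennreal (class_change L r r' u) * indicator {0..1} u \<partial>lborel)
    \<le> ennreal (81/4 * \<bar>r - r'\<bar>)"
proof (cases "r \<le> r'")
  case True
  then show ?thesis using expected_class_change_ordered[OF True, of L] by simp
next
  case False
  then have "r' \<le> r" by simp
  have "(class_change L r r' u) =
    (class_change L r' r u)" for u
    by (cases "level L 1 r u = level L 1 r' u") (auto simp: add.commute)
  with expected_class_change_ordered[OF \<open>r' \<le> r\<close>, of L] False show ?thesis by simp
qed

definition classes :: "edge set \<Rightarrow> nat \<Rightarrow> (edge \<Rightarrow> real) \<Rightarrow> real \<Rightarrow> edge \<Rightarrow> nat" where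
  "classes E L w u = (\<lambda>e\<in>E. level L (sum w E) (w e) u)"

lemma measurable_count_space_fun:
  fixes d :: "'b \<Rightarrow> 'a \<Rightarrow> nat"
  assumes fin: "finite E" and d: "\<And>e. e \<in> E \<Longrightarrow> (\<lambda>u. d u e) \<in> measurable M (count_space UNIV)"
    and L: "\<And>u e. e \<in> E \<Longrightarrow> d u e \<le> L" and ext: "\<And>u. d u \<in> extensional E"
  shows "d \<in> measurable M (count_space UNIV)"
proof -
  let ?A = "E \<rightarrow>\<^sub>E {..L}"
  have finA: "finite ?A" using fin by (simp add: finite_PiE)
  have "d \<in> measurable M (count_space ?A)"
  proof (subst measurable_count_space_eq2[OF finA], intro conjI ballI)
    show "d \<in> space M \<rightarrow> ?A" using L ext by (auto simp: PiE_def)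
    fix f assume f: "f \<in> ?A"
    have "d -` {f} \<inter> space M = {u \<in> space M. \<forall>e\<in>E. d u e = f e}"
      using f ext by (auto intro!: extensionalityI[of _ E] simp: PiE_def)
    also have "\<dots> \<in> sets M"
    proof (rule sets.sets_Collect_finite_All[OF _ fin])
      show "{u \<in> space M. d u e = f e} \<in> sets M" if "e \<in> E" for e
        using d[OF that] by measurable
    qed
    finally show "d -` {f} \<inter> space M \<in> sets M" .
  qed
  from measurable_compose[OF this, of id "count_space UNIV"] show ?thesis
    by (simp add: id_def)
qed

lemma measurable_classes:
  assumes "finite E"
  shows "classes E L w \<in> measurable borel (count_space UNIV)"
  using assms by (rule measurable_count_space_fun[where L = L]) (auto simp: classes_def level_le)

lemma measurable_hybrid_classes:
  assumes "finite E" "set es \<subseteq> E"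
  shows "(\<lambda>u. hybrid es k (classes E L w u) (classes E L w' u)) \<in> measurable borel (count_space UNIV)"
  using assms(1)
proof (rule measurable_count_space_fun[where L = L])
  show "hybrid es k (classes E L w u) (classes E L w' u) \<in> extensional E" for u
    using assms(2) set_take_subset[of k es] by (auto simp: extensional_def hybrid_def classes_def)
  show "(\<lambda>u. hybrid es k (classes E L w u) (classes E L w' u) e) \<in> measurable borel (count_space UNIV)"
    if "e \<in> E" for e
    using that by (cases "e \<in> set (take k es)") (auto simp: hybrid_def classes_def)
qed (auto simp: hybrid_def classes_def level_le)

section \<open>Lipschitz continuity\<close>

lemma normalized_distance_le:
  fixes w w' :: "'a \<Rightarrow> real"
  assumes "finite E" "\<And>e. e \<in> E \<Longrightarrow> 0 \<le> w e" "\<And>e. e \<in> E \<Longrightarrow> 0 \<le> w' e"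
    and S: "0 < sum w E" "0 < sum w' E"
  shows "max (sum w E) (sum w' E) * (\<Sum>e\<in>E. \<bar>w e / sum w E - w' e / sum w' E\<bar>) \<le> 2 * (\<Sum>e\<in>E. \<bar>w e - w' e\<bar>)"
proof -
  have *: "max (sum w E) (sum w' E) * (\<Sum>e\<in>E. \<bar>w e / sum w E - w' e / sum w' E\<bar>) \<le> 2 * (\<Sum>e\<in>E. \<bar>w e - w' e\<bar>)"
    if S: "0 < sum w E" "sum w E \<le> sum w' E" and w: "\<And>e. e \<in> E \<Longrightarrow> 0 \<le> w e" for w w' :: "'a \<Rightarrow> real"
  proof -
    define s s' where "s = sum w E" and "s' = sum w' E"
    have ss: "0 < s" "s \<le> s'" using S by (auto simp: s_def s'_def)
    have "s' * \<bar>w e / s - w' e / s'\<bar> \<le> \<bar>w e - w' e\<bar> + w e * ((s' - s) / s)" if "e \<in> E" for e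
    proof -
      have "s' * \<bar>w e / s - w' e / s'\<bar> = \<bar>s' * (w e / s - w' e / s')\<bar>"
        using ss by (simp add: abs_mult)
      also have "s' * (w e / s - w' e / s') = (w e - w' e) + w e * ((s' - s) / s)"
        using ss by (simp add: field_simps)
      also have "\<bar>\<dots>\<bar> \<le> \<bar>w e - w' e\<bar> + \<bar>w e * ((s' - s) / s)\<bar>" by (rule abs_triangle_ineq)
      also have "\<bar>w e * ((s' - s) / s)\<bar> = w e * ((s' - s) / s)" using ss w[OF that] by simp
      finally show ?thesis .
    qed
    then have "(\<Sum>e\<in>E. s' * \<bar>w e / s - w' e / s'\<bar>) \<le> (\<Sum>e\<in>E. \<bar>w e - w' e\<bar> + w e * ((s' - s) / s))"
      by (rule sum_mono)
    also have "\<dots> = (\<Sum>e\<in>E. \<bar>w e - w' e\<bar>) + s * ((s' - s) / s)"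
      by (simp only: sum.distrib s_def flip: sum_distrib_right)
    also have "s * ((s' - s) / s) = s' - s" using ss by simp
    also have "s' - s \<le> (\<Sum>e\<in>E. \<bar>w e - w' e\<bar>)"
    proof -
      have "s' - s = (\<Sum>e\<in>E. w' e - w e)" by (simp add: s_def s'_def sum_subtractf)
      also have "\<dots> \<le> (\<Sum>e\<in>E. \<bar>w e - w' e\<bar>)" by (rule sum_mono) auto
      finally show ?thesis .
    qed
    finally show ?thesis
      using ss by (simp add: sum_distrib_left[symmetric] s_def[symmetric] s'_def[symmetric] max_absorb2)
  qed
  show ?thesis
  proof (cases "sum w E \<le> sum w' E")
    case True
    then show ?thesis using *[of w w'] assms by simp
  next
    case False
    have "\<bar>w' e - w e\<bar> = \<bar>w e - w' e\<bar>" "\<bar>w' e / sum w' E - w e / sum w E\<bar> = \<bar>w e / sum w E - w' e / sum w' E\<bar>" for e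
      by (rule abs_minus_commute)+
    then show ?thesis using *[of w' w] assms False by (simp add: max.commute)
  qed
qed

lemma expected_change_le:
  assumes fin: "finite E" and idx: "inj_on idx E" and two: "\<And>e. e \<in> E \<Longrightarrow> card e = 2"
    and w: "\<And>e. e \<in> E \<Longrightarrow> 0 \<le> w e" and w': "\<And>e. e \<in> E \<Longrightarrow> 0 \<le> w' e"
    and S: "0 < sum w E" "0 < sum w' E"
  shows "(\<integral>\<^sup>+\<omega>. ennreal (\<Sum>g\<in>sym_diff (class_matching E (classes E L w (\<omega> 0)) (key idx \<omega>))
        (class_matching E (classes E L w' (\<omega> 0)) (key idx \<omega>)). min (w g) (w' g)) \<partial>tape)
    \<le> ennreal (405/8 * (\<Sum>e\<in>E. \<bar>w e - w' e\<bar>))"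
    (is "?lhs \<le> _")
proof -
  obtain es where es: "distinct es" "set es = E" using finite_distinct_list[OF fin] by blast
  define n where "n = length es"
  define Sm where "Sm = max (sum w E) (sum w' E)"
  have Sm: "0 < Sm" "sum w E \<le> Sm" "sum w' E \<le> Sm" using S by (auto simp: Sm_def)
  define d d' where "d u = classes E L w u" and "d' u = classes E L w' u" for u
  define h where "h x i u = ennreal (if d u (es ! i) = d' u (es ! i) then 0 else
    5/4 * ((1 + 8 * u) * Sm) * (1/9)^x u (es ! i))" for x i u
  define I where "I k i \<omega> = influence E (hybrid es k (d (\<omega> 0)) (d' (\<omega> 0))) (key idx \<omega>) (es ! i)" for k i \<omega>
  have esE: "es ! i \<in> E" if "i < n" for i using that es by (auto simp: n_def)
  have [measurable]: "h d i \<in> borel_measurable borel" "h d' i \<in> borel_measurable borel" if "i < n" for i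
  proof -
    have dd: "d u (es ! i) = level L (sum w E) (w (es ! i)) u"
      "d' u (es ! i) = level L (sum w' E) (w' (es ! i)) u" for u
      using esE[OF that] by (simp_all add: d_def d'_def classes_def)
    have m: "(\<lambda>u. ennreal (if a = b then 0 else 5/4 * ((1 + 8 * u) * Sm) * (1/9)^c)) \<in> borel_measurable borel"
      for a b c :: nat by measurable
    show "h d i \<in> borel_measurable borel" "h d' i \<in> borel_measurable borel"
      unfolding h_def dd
      by (rule measurable_level_pair[where f = "\<lambda>a b u. ennreal (if a = b then 0 else 5/4 * ((1 + 8 * u) * Sm) * (1/9)^a)", OF m],
          rule measurable_level_pair[where f = "\<lambda>a b u. ennreal (if a = b then 0 else 5/4 * ((1 + 8 * u) * Sm) * (1/9)^b)", OF m])
  qed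
  have infl: "(\<integral>\<^sup>+\<omega>. h x i (\<omega> 0) * of_nat (I k i \<omega>) \<partial>tape) \<le> (\<integral>\<^sup>+\<omega>. h x i (\<omega> 0) \<partial>tape)"
    if "i < n" "x = d \<or> x = d'" for x i k
    unfolding I_def influence_def d_def d'_def
  proof (rule influence_le[OF fin idx, where R = conflict])
    show "(\<lambda>u. hybrid es k (classes E L w u) (classes E L w' u)) \<in> measurable borel (count_space UNIV)"
      by (rule measurable_hybrid_classes[OF fin]) (use es in simp)
  qed (use that esE symp_conflict irreflp_conflict in auto)
  have mI: "(\<lambda>\<omega>. of_nat (I k i \<omega>) :: ennreal) \<in> borel_measurable tape" if "i < n" for k i
    unfolding I_def d_def d'_def
  proof (rule measurable_same_order[where \<Phi> = "\<lambda>\<pi> p. of_nat (influence E p \<pi> (es ! i))"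
        and V = E and \<delta> = "\<lambda>u. hybrid es k (classes E L w u) (classes E L w' u)"])
    show "(\<lambda>u. hybrid es k (classes E L w u) (classes E L w' u)) \<in> measurable borel (count_space UNIV)"
      by (rule measurable_hybrid_classes[OF fin]) (use es in simp)
    show "of_nat (influence E p \<pi> (es ! i)) = of_nat (influence E p \<pi>' (es ! i))"
      if "same_order E \<pi> \<pi>'" for \<pi> \<pi>' p
      using same_order_greedy[OF fin _ that, of _ "conflict p"]
      by (simp add: influence_def without_def)
  qed (use fin in auto)
  have mh: "(\<lambda>\<omega>. h x i (\<omega> 0)) \<in> borel_measurable tape" if "i < n" "x = d \<or> x = d'" for x i
    by (rule measurable_compose[OF measurable_tape_component]) (use that in auto)
  have "?lhs \<le> (\<integral>\<^sup>+\<omega>. (\<Sum>i<n. h d i (\<omega> 0) * of_nat (I i i \<omega>) + h d' i (\<omega> 0) * of_nat (I (Suc i) i \<omega>)) \<partial>tape)"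
  proof (rule nn_integral_mono_AE)
    show "AE \<omega> in tape. ennreal (\<Sum>g\<in>sym_diff (class_matching E (classes E L w (\<omega> 0)) (key idx \<omega>))
        (class_matching E (classes E L w' (\<omega> 0)) (key idx \<omega>)). min (w g) (w' g)) \<le>
      (\<Sum>i<n. h d i (\<omega> 0) * of_nat (I i i \<omega>) + h d' i (\<omega> 0) * of_nat (I (Suc i) i \<omega>))"
      using AE_inj_on_key[OF fin idx] AE_tape_mem[of 0]
    proof eventually_elim
      case (elim \<omega>)
      let ?u = "\<omega> 0" and ?\<pi> = "key idx \<omega>"
      let ?c = "(1 + 8 * ?u) * Sm"
      have u: "0 \<le> ?u" using elim by simp
      have c: "0 \<le> ?c" using u Sm by simp
      have bd: "v g \<le> ?c * (1/9)^classes E L v ?u g"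
        if "g \<in> E" "\<And>e. e \<in> E \<Longrightarrow> 0 \<le> v e" "sum v E \<le> Sm" for v g
      proof -
        have "v g \<le> sum v E" using that fin by (intro member_le_sum) auto
        moreover have "0 \<le> sum v E" using that by (intro sum_nonneg) auto
        ultimately have "v g \<le> (1 + 8 * ?u) * sum v E * (1/9)^level L (sum v E) (v g) ?u"
          using u by (intro le_level_weight) auto
        also have "\<dots> \<le> ?c * (1/9)^level L (sum v E) (v g) ?u"
          using u that by (intro mult_right_mono mult_left_mono) auto
        finally show ?thesis using that by (simp add: classes_def)
      qed
      have "hybrid es (length es) (d ?u) (d' ?u) = d' ?u"
        using es by (auto simp: hybrid_def fun_eq_iff d_def d'_def classes_def)
      moreover have "(\<Sum>g\<in>sym_diff (class_matching E (d ?u) ?\<pi>)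
          (class_matching E (hybrid es (length es) (d ?u) (d' ?u)) ?\<pi>). min (w g) (w' g)) \<le>
        (\<Sum>i<length es. if d ?u (es ! i) = d' ?u (es ! i) then 0 else
          5/4 * ?c * ((1/9)^d ?u (es ! i) * real (influence E (hybrid es i (d ?u) (d' ?u)) ?\<pi> (es ! i)) +
            (1/9)^d' ?u (es ! i) * real (influence E (hybrid es (Suc i) (d ?u) (d' ?u)) ?\<pi> (es ! i))))"
      proof (rule class_matching_hybrid_le[OF es elim(1) two])
        show "min (w g) (w' g) \<le> ?c * (1/9)^d ?u g" if "g \<in> E" for g
          using bd[OF that w Sm(2)] by (simp add: d_def)
        show "min (w g) (w' g) \<le> ?c * (1/9)^d' ?u g" if "g \<in> E" for g
          using bd[OF that w' Sm(3)] by (simp add: d'_def)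
      qed (use w w' c in auto)
      ultimately have "ennreal (\<Sum>g\<in>sym_diff (class_matching E (d ?u) ?\<pi>)
          (class_matching E (d' ?u) ?\<pi>). min (w g) (w' g)) \<le>
        ennreal (\<Sum>i<n. if d ?u (es ! i) = d' ?u (es ! i) then 0 else
          5/4 * ?c * ((1/9)^d ?u (es ! i) * real (I i i \<omega>) + (1/9)^d' ?u (es ! i) * real (I (Suc i) i \<omega>)))"
        unfolding I_def n_def by (intro ennreal_leI) simp
      also have "\<dots> = (\<Sum>i<n. ennreal (if d ?u (es ! i) = d' ?u (es ! i) then 0 else
          5/4 * ?c * ((1/9)^d ?u (es ! i) * real (I i i \<omega>) + (1/9)^d' ?u (es ! i) * real (I (Suc i) i \<omega>))))"
        using c by (intro sum_ennreal[symmetric]) auto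
      also have "\<dots> = (\<Sum>i<n. h d i ?u * of_nat (I i i \<omega>) + h d' i ?u * of_nat (I (Suc i) i \<omega>))"
      proof (rule sum.cong[OF refl])
        fix i
        show "ennreal (if d ?u (es ! i) = d' ?u (es ! i) then 0 else
          5/4 * ?c * ((1/9)^d ?u (es ! i) * real (I i i \<omega>) + (1/9)^d' ?u (es ! i) * real (I (Suc i) i \<omega>)))
          = h d i ?u * of_nat (I i i \<omega>) + h d' i ?u * of_nat (I (Suc i) i \<omega>)"
        proof (cases "d ?u (es ! i) = d' ?u (es ! i)")
          case False
          have "h x i ?u * of_nat k = ennreal (5/4 * ?c * (1/9)^x ?u (es ! i) * real k)" for x k
            unfolding h_def ennreal_of_nat_eq_real_of_nat
            using False c by (subst ennreal_mult[symmetric]) auto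
          moreover have "ennreal (K * (a * p + b * q)) = ennreal (K * a * p) + ennreal (K * b * q)"
            if "0 \<le> K" "0 \<le> a" "0 \<le> b" "0 \<le> p" "0 \<le> q" for K a b p q :: real
            using that by (simp add: distrib_left mult.assoc flip: ennreal_plus)
          from this[of "5/4 * ?c"] have "ennreal (5/4 * ?c * ((1/9)^d ?u (es ! i) * real (I i i \<omega>) +
              (1/9)^d' ?u (es ! i) * real (I (Suc i) i \<omega>))) =
            ennreal (5/4 * ?c * (1/9)^d ?u (es ! i) * real (I i i \<omega>)) +
            ennreal (5/4 * ?c * (1/9)^d' ?u (es ! i) * real (I (Suc i) i \<omega>))"
            using c by simp
          ultimately show ?thesis using False by (simp only: if_False)
        qed (simp add: h_def)
      qed
      finally show ?case by (simp add: d_def d'_def)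
    qed
  qed
  also have "\<dots> = (\<Sum>i<n. (\<integral>\<^sup>+\<omega>. h d i (\<omega> 0) * of_nat (I i i \<omega>) \<partial>tape) +
      (\<integral>\<^sup>+\<omega>. h d' i (\<omega> 0) * of_nat (I (Suc i) i \<omega>) \<partial>tape))"
    by (subst nn_integral_sum)
      (auto intro!: sum.cong nn_integral_add borel_measurable_add borel_measurable_times_ennreal mh mI)
  also have "\<dots> \<le> (\<Sum>i<n. (\<integral>\<^sup>+\<omega>. h d i (\<omega> 0) \<partial>tape) + (\<integral>\<^sup>+\<omega>. h d' i (\<omega> 0) \<partial>tape))"
    by (intro sum_mono add_mono infl) auto
  also have "\<dots> \<le> (\<Sum>i<n. ennreal (5/4 * Sm * (81/4 * \<bar>w (es ! i) / sum w E - w' (es ! i) / sum w' E\<bar>)))"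
  proof (rule sum_mono)
    fix i assume "i \<in> {..<n}"
    then have i: "i < n" and e: "es ! i \<in> E" using esE by auto
    let ?r = "w (es ! i) / sum w E" and ?r' = "w' (es ! i) / sum w' E"
    define g where "g u = (class_change L ?r ?r' u)" for u
    have [measurable]: "g \<in> borel_measurable borel"
      unfolding g_def
      by (rule measurable_level_pair[where f = "\<lambda>a b u. if a = b then 0 else (1 + 8 * u) * ((1/9)^a + (1/9)^b)"])
        measurable
    have dd: "d u (es ! i) = level L 1 ?r u" "d' u (es ! i) = level L 1 ?r' u" for u
      using e by (simp_all add: d_def d'_def classes_def level_scale[OF S(1)] level_scale[OF S(2)])
    have "(\<integral>\<^sup>+\<omega>. h d i (\<omega> 0) \<partial>tape) + (\<integral>\<^sup>+\<omega>. h d' i (\<omega> 0) \<partial>tape) =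
        (\<integral>\<^sup>+\<omega>. h d i (\<omega> 0) + h d' i (\<omega> 0) \<partial>tape)"
      by (rule nn_integral_add[symmetric]) (use mh i in auto)
    also have "\<dots> = (\<integral>\<^sup>+u. (h d i u + h d' i u) * indicator {0..1} u \<partial>lborel)"
      using i by (subst nn_integral_tape_component[where f = "\<lambda>u. h d i u + h d' i u"]) auto
    also have "\<dots> = (\<integral>\<^sup>+u. ennreal (5/4 * Sm) * (ennreal (g u) * indicator {0..1} u) \<partial>lborel)"
    proof (rule nn_integral_cong)
      fix u :: real
      show "(h d i u + h d' i u) * indicator {0..1} u = ennreal (5/4 * Sm) * (ennreal (g u) * indicator {0..1} u)"
      proof (cases "u \<in> {0..1}")
        case True
        then have "h d i u + h d' i u = ennreal (5/4 * Sm * g u)"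
        proof -
          have "ennreal (5/4 * (b * Sm) * x) + ennreal (5/4 * (b * Sm) * y) = ennreal (5/4 * Sm * (b * (x + y)))"
            if "0 \<le> b" "0 \<le> x" "0 \<le> y" for b x y :: real
            using that Sm(1) by (simp add: algebra_simps flip: ennreal_plus)
          from this[of "1 + 8 * u"] show ?thesis using True by (simp add: h_def g_def dd)
        qed
        also have "\<dots> = ennreal (5/4 * Sm) * ennreal (g u)"
          using True Sm(1) by (intro ennreal_mult) (auto simp: g_def)
        finally show ?thesis using True by simp
      qed simp
    qed
    also have "\<dots> = ennreal (5/4 * Sm) * (\<integral>\<^sup>+u. ennreal (g u) * indicator {0..1} u \<partial>lborel)"
      by (rule nn_integral_cmult) measurable
    also have "\<dots> \<le> ennreal (5/4 * Sm) * ennreal (81/4 * \<bar>?r - ?r'\<bar>)"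
      unfolding g_def by (intro mult_left_mono expected_class_change) simp
    also have "\<dots> = ennreal (5/4 * Sm * (81/4 * \<bar>?r - ?r'\<bar>))"
      using Sm(1) by (intro ennreal_mult[symmetric]) auto
    finally show "(\<integral>\<^sup>+\<omega>. h d i (\<omega> 0) \<partial>tape) + (\<integral>\<^sup>+\<omega>. h d' i (\<omega> 0) \<partial>tape) \<le>
        ennreal (5/4 * Sm * (81/4 * \<bar>?r - ?r'\<bar>))" .
  qed
  also have "\<dots> = ennreal (\<Sum>i<n. 5/4 * Sm * (81/4 * \<bar>w (es ! i) / sum w E - w' (es ! i) / sum w' E\<bar>))"
    using Sm(1) by (intro sum_ennreal) auto
  also have "(\<Sum>i<n. 5/4 * Sm * (81/4 * \<bar>w (es ! i) / sum w E - w' (es ! i) / sum w' E\<bar>)) =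
      (\<Sum>e\<in>E. 5/4 * Sm * (81/4 * \<bar>w e / sum w E - w' e / sum w' E\<bar>))"
    using es unfolding n_def
    by (intro sum.reindex_bij_betw[OF bij_betw_nth[OF es(1)]]) auto
  also have "\<dots> = 405/16 * (Sm * (\<Sum>e\<in>E. \<bar>w e / sum w E - w' e / sum w' E\<bar>))"
    by (simp add: sum_distrib_left)
  also have "ennreal \<dots> \<le> ennreal (405/8 * (\<Sum>e\<in>E. \<bar>w e - w' e\<bar>))"
    using normalized_distance_le[OF fin w w' S] by (intro ennreal_leI) (simp add: Sm_def)
  finally show ?thesis .
qed

section \<open>Approximation ratio\<close>

lemma card_disjoint_meeting_le:
  assumes "\<And>e f. e \<in> A \<Longrightarrow> f \<in> A \<Longrightarrow> e \<noteq> f \<Longrightarrow> e \<inter> f = {}" and "finite A" "card g = 2"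
  shows "card {e \<in> A. e \<inter> g \<noteq> {}} \<le> 2"
proof -
  obtain a b where g: "g = {a, b}" using assms(3) by (auto simp: card_2_iff)
  have one: "card {e \<in> A. x \<in> e} \<le> Suc 0" for x
    using assms(1,2) by (subst card_le_Suc0_iff_eq) auto
  have "card {e \<in> A. e \<inter> g \<noteq> {}} \<le> card ({e \<in> A. a \<in> e} \<union> {e \<in> A. b \<in> e})"
    using assms(2) by (intro card_mono) (auto simp: g)
  also have "\<dots> \<le> card {e \<in> A. a \<in> e} + card {e \<in> A. b \<in> e}" by (rule card_Un_le)
  also have "\<dots> \<le> 2" using one[of a] one[of b] by simp
  finally show ?thesis .
qed

lemma class_matching_weight_ge:
  fixes d :: "edge \<Rightarrow> nat" and L :: nat and c :: real
  assumes fin: "finite E" and inj: "inj_on \<pi> E" and two: "\<And>e. e \<in> E \<Longrightarrow> card e = 2"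
    and A: "A \<subseteq> E" "\<And>e f. e \<in> A \<Longrightarrow> f \<in> A \<Longrightarrow> e \<noteq> f \<Longrightarrow> e \<inter> f = {}"
    and c: "0 \<le> c"
  defines "v \<equiv> \<lambda>e. if d e < L then c * (1/9)^d e else 0"
  assumes w: "\<And>e. e \<in> E \<Longrightarrow> v e \<le> w e"
  shows "3/8 * sum v A \<le> sum w (class_matching E d \<pi>)"
proof -
  define M where "M = greedy E (conflict d) \<pi>"
  define F where "F = undominated d M"
  have ME: "M \<subseteq> E" unfolding M_def by (rule greedy_subset[OF fin])
  have FM: "F \<subseteq> M" unfolding F_def by (rule undominated_subset)
  have finM: "finite M" "finite F" "finite A"
    using ME FM A fin by (auto intro: finite_subset)
  have ind: "\<not> conflict d e f" if "e \<in> M" "f \<in> M" for e f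
    using greedy_independent[OF fin inj symp_conflict irreflp_conflict] that unfolding M_def by blast
  have v0: "0 \<le> v e" for e using c by (simp add: v_def)
  have vd: "v e = v f" if "d e = d f" for e f using that by (simp add: v_def)
  have "\<exists>f\<in>M. e \<inter> f \<noteq> {} \<and> d e = d f" if eA: "e \<in> A" for e
  proof (cases "e \<in> M")
    case True
    have "e \<noteq> {}" using two[of e] eA A(1) by auto
    then show ?thesis using True by (intro bexI[of _ e]) auto
  next
    case False
    then obtain f where "f \<in> M" "conflict d f e"
      using greedy_mem_iff[OF fin, of e "conflict d" \<pi>] eA A(1) unfolding M_def by blast
    then show ?thesis by (auto simp: conflict_def Int_commute)
  qed
  then obtain \<phi> where \<phi>: "\<And>e. e \<in> A \<Longrightarrow> \<phi> e \<in> M \<and> e \<inter> \<phi> e \<noteq> {} \<and> d e = d (\<phi> e)" by metis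
  have "sum v A = (\<Sum>f\<in>M. sum v {e \<in> A. \<phi> e = f})"
    by (rule sum.group[symmetric]) (use finM \<phi> in auto)
  also have "\<dots> \<le> (\<Sum>f\<in>M. 2 * v f)"
  proof (rule sum_mono)
    fix f assume f: "f \<in> M"
    have "sum v {e \<in> A. \<phi> e = f} = (\<Sum>e\<in>{e \<in> A. \<phi> e = f}. v f)"
      using \<phi> by (intro sum.cong vd) auto
    also have "\<dots> = real (card {e \<in> A. \<phi> e = f}) * v f" by simp
    also have "\<dots> \<le> 2 * v f"
    proof (rule mult_right_mono[OF _ v0])
      have "card {e \<in> A. \<phi> e = f} \<le> card {e \<in> A. e \<inter> f \<noteq> {}}"
        using finM \<phi> by (intro card_mono) auto
      also have "\<dots> \<le> 2"
        using f ME two A(2) finM by (intro card_disjoint_meeting_le) auto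
      finally show "real (card {e \<in> A. \<phi> e = f}) \<le> 2" by simp
    qed
    finally show "sum v {e \<in> A. \<phi> e = f} \<le> 2 * v f" .
  qed
  finally have AM: "sum v A \<le> 2 * sum v M" by (simp add: sum_distrib_left)
  have sum_v: "sum v X = c * (\<Sum>e\<in>{e \<in> X. d e < L}. (1/9)^d e)" if "finite X" for X
  proof -
    have "sum v X = (\<Sum>e\<in>{e \<in> X. d e < L}. c * (1/9)^d e)"
      using that by (intro sum.mono_neutral_cong_right) (auto simp: v_def)
    then show ?thesis by (simp add: sum_distrib_left)
  qed
  have "(\<Sum>e\<in>{e \<in> M - F. d e < L}. (1/9)^d e) \<le> (\<Sum>e\<in>{e \<in> M. d e < L}. (1/9)^d e) / (4::real)"
  proof (rule sum_dominated_le[OF finM(1) _ ind])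
    show "\<exists>f\<in>{e \<in> M. d e < L}. g \<inter> f \<noteq> {} \<and> d f < d g" if "g \<in> {e \<in> M - F. d e < L}" for g
      using that unfolding F_def undominated_def by fastforce
  qed (use finM ME two in auto)
  then have "sum v (M - F) \<le> sum v M / 4"
    using sum_v[of M] sum_v[of "M - F"] finM c mult_left_mono[OF _ c] by fastforce
  moreover have "sum v (M - F) = sum v M - sum v F"
    using finM FM by (intro sum_diff) auto
  ultimately have "3/4 * sum v M \<le> sum v F" by simp
  moreover have "sum v F \<le> sum w F" using FM ME w by (intro sum_mono) auto
  moreover have "class_matching E d \<pi> = F" by (simp add: class_matching_def F_def M_def)
  ultimately show ?thesis using AM by simp
qed

text \<open>With \<open>r = a x\<close>, \<open>1 \<le> x \<le> 9\<close>, the rounded weight is \<open>a b\<close> if \<open>b = 1 + 8u \<le> x\<close> and \<open>a b / 9\<close>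
  otherwise. Its expectation is \<open>a (x\<^sup>2/18 + 1/2) = r/3 + a (x - 3)\<^sup>2/18\<close>.\<close>

lemma expected_rounded_ge:
  assumes L: "2 \<le> L" and r: "r \<le> 1"
  shows "ennreal ((r - (1/9)^(L - 1)) / 3) \<le> (\<integral>\<^sup>+u. ennreal (if level L 1 r u < L then
      (1 + 8 * u) / 9 * (1/9)^level L 1 r u else 0) * indicator {0..1} u \<partial>lborel)"
    (is "_ \<le> (\<integral>\<^sup>+u. ennreal (?v u) * _ \<partial>lborel)")
proof (cases "r < (1/9)^(L - 1)")
  case True
  then show ?thesis by (simp add: ennreal_neg)
next
  case False
  define i where "i = (LEAST i. (1/9)^Suc i \<le> r)"
  have ex: "(1/9)^Suc (L - 2) \<le> r" using False L by (simp add: numeral_2_eq_2 Suc_diff_Suc)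
  have i: "(1/9)^Suc i \<le> r" "i \<le> L - 2"
    unfolding i_def using ex by (rule LeastI, intro Least_le)
  have upper: "r \<le> (1/9)^i"
  proof (cases i)
    case (Suc j)
    then have "\<not> (1/9)^Suc j \<le> r" using not_less_Least[of j "\<lambda>i. (1/9)^Suc i \<le> r"] by (simp add: i_def)
    then show ?thesis using Suc by simp
  qed (use r in simp)
  define a :: real where "a = (1/9)^Suc i"
  have a: "0 < a" "a \<le> r" "r \<le> 9 * a" using i upper by (auto simp: a_def)
  define x where "x = r / a"
  have x: "1 \<le> x" "x \<le> 9" "r = a * x" using a by (auto simp: x_def field_simps)
  define z where "z = (x - 1) / 8"
  have z: "0 \<le> z" "z \<le> 1" using x by (auto simp: z_def)
  have lower: "(if u \<le> z then a * (1 + 8 * u) else a * (1 + 8 * u) / 9) \<le> ?v u"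
    if u: "u \<in> {0..1}" for u
  proof -
    have u0: "0 \<le> u" using u by simp
    have lev: "k < level L 1 r u \<longleftrightarrow> k < L \<and> r < (1 + 8 * u) * (1/9)^Suc k" for k
      using less_level_iff[OF u0, of 1 k L r] by (simp add: power_one_over)
    have bound: "(1 + 8 * u) * (1/9)^Suc k \<le> ?v u" if k: "k < L" "(1 + 8 * u) * (1/9)^Suc k \<le> r" for k
    proof -
      have le: "level L 1 r u \<le> k" using lev[of k] k by auto
      then have "(1/9::real)^k \<le> (1/9)^level L 1 r u" by (intro power_decreasing) auto
      then have "(1 + 8 * u) / 9 * (1/9)^k \<le> (1 + 8 * u) / 9 * (1/9)^level L 1 r u"
        using u0 by (intro mult_left_mono) auto
      then show ?thesis using le k by simp
    qed
    show ?thesis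
    proof (cases "u \<le> z")
      case True
      then have "(1 + 8 * u) * a \<le> x * a" using a by (intro mult_right_mono) (auto simp: z_def)
      then have "(1 + 8 * u) * (1/9)^Suc i \<le> r" using x by (simp add: a_def mult_ac)
      from bound[OF _ this] show ?thesis using True i L by (simp add: a_def mult_ac)
    next
      case False
      have "(1 + 8 * u) * a \<le> 9 * a" using a u by (intro mult_right_mono) auto
      moreover have "(1 + 8 * u) * (1/9)^Suc (Suc i) = (1 + 8 * u) * a / 9" by (simp add: a_def)
      ultimately have "(1 + 8 * u) * (1/9)^Suc (Suc i) \<le> r" using a(2) by linarith
      from bound[OF _ this] show ?thesis using False i L by (simp add: a_def mult_ac)
    qed
  qed
  have FTC: "(\<integral>\<^sup>+u. ennreal (k * (1 + 8 * u)) * indicator {p..q} u \<partial>lborel) =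
      ennreal (k * (q + 4 * q\<^sup>2) - k * (p + 4 * p\<^sup>2))" if "0 \<le> k" "0 \<le> p" "p \<le> q" for k p q :: real
  proof (rule nn_integral_FTC_Icc)
    show "((\<lambda>u. k * (u + 4 * u\<^sup>2)) has_real_derivative k * (1 + 8 * u)) (at u)" for u
      by (auto intro!: derivative_eq_intros)
  qed (use that in auto)
  have "ennreal ((r - (1/9)^(L - 1)) / 3) \<le> ennreal (r / 3)" by (intro ennreal_leI) simp
  also have "\<dots> \<le> ennreal ((a * (z + 4 * z\<^sup>2) - a * (0 + 4 * 0\<^sup>2)) + (a / 9 * (1 + 4 * 1\<^sup>2) - a / 9 * (z + 4 * z\<^sup>2)))"
  proof (rule ennreal_leI)
    have "(a * (z + 4 * z\<^sup>2) - a * (0 + 4 * 0\<^sup>2)) + (a / 9 * (1 + 4 * 1\<^sup>2) - a / 9 * (z + 4 * z\<^sup>2)) - r / 3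
        = a * (x - 3)\<^sup>2 / 18"
      unfolding x(3) z_def by (simp add: power2_eq_square field_simps)
    moreover have "0 \<le> a * (x - 3)\<^sup>2 / 18" using a by simp
    ultimately show "r / 3 \<le> (a * (z + 4 * z\<^sup>2) - a * (0 + 4 * 0\<^sup>2)) + (a / 9 * (1 + 4 * 1\<^sup>2) - a / 9 * (z + 4 * z\<^sup>2))" by linarith
  qed
  also have "\<dots> = ennreal (a * (z + 4 * z\<^sup>2) - a * (0 + 4 * 0\<^sup>2)) +
      ennreal (a / 9 * (1 + 4 * 1\<^sup>2) - a / 9 * (z + 4 * z\<^sup>2))"
  proof (rule ennreal_plus)
    show "0 \<le> a * (z + 4 * z\<^sup>2) - a * (0 + 4 * 0\<^sup>2)" using a z by simp
    have "z + 4 * z\<^sup>2 \<le> 1 + 4 * 1\<^sup>2" using z by (intro add_mono mult_left_mono power_mono) auto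
    then show "0 \<le> a / 9 * (1 + 4 * 1\<^sup>2) - a / 9 * (z + 4 * z\<^sup>2)"
      using a(1) by (simp add: right_diff_distrib[symmetric])
  qed
  also have "\<dots> = (\<integral>\<^sup>+u. ennreal (a * (1 + 8 * u)) * indicator {0..z} u \<partial>lborel) +
      (\<integral>\<^sup>+u. ennreal (a / 9 * (1 + 8 * u)) * indicator {z..1} u \<partial>lborel)"
    using a(1) z by (subst (1 2) FTC) auto
  also have "\<dots> = (\<integral>\<^sup>+u. ennreal (a * (1 + 8 * u)) * indicator {0..z} u +
      ennreal (a / 9 * (1 + 8 * u)) * indicator {z..1} u \<partial>lborel)"
    by (rule nn_integral_add[symmetric]) measurable
  also have "\<dots> \<le> (\<integral>\<^sup>+u. ennreal (?v u) * indicator {0..1} u \<partial>lborel)"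
  proof (rule nn_integral_mono_AE)
    show "AE u in lborel. ennreal (a * (1 + 8 * u)) * indicator {0..z} u +
        ennreal (a / 9 * (1 + 8 * u)) * indicator {z..1} u \<le> ennreal (?v u) * indicator {0..1} u"
      using AE_lborel_singleton[of z]
    proof eventually_elim
      case (elim u)
      consider "u \<in> {0..1}" "u < z" | "u \<in> {0..1}" "z < u" | "u \<notin> {0..1}" using elim by force
      then show ?case
      proof cases
        case 1
        then show ?thesis using ennreal_leI[OF lower[OF 1(1)]] by simp
      next
        case 2
        then show ?thesis using ennreal_leI[OF lower[OF 2(1)]] by simp
      next
        case 3
        then show ?thesis using z by (auto simp: indicator_def)
      qed
    qed
  qed
  finally show ?thesis .
qed

lemma expected_weight_ge:
  assumes fin: "finite E" and idx: "inj_on idx E" and two: "\<And>e. e \<in> E \<Longrightarrow> card e = 2"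
    and w: "\<And>e. e \<in> E \<Longrightarrow> 0 \<le> w e" and L: "2 \<le> L"
    and A: "A \<subseteq> E" "\<And>e f. e \<in> A \<Longrightarrow> f \<in> A \<Longrightarrow> e \<noteq> f \<Longrightarrow> e \<inter> f = {}"
  shows "ennreal (\<Sum>e\<in>A. (w e - sum w E * (1/9)^(L - 1)) / 8) \<le>
    (\<integral>\<^sup>+\<omega>. ennreal (sum w (class_matching E (classes E L w (\<omega> 0)) (key idx \<omega>))) \<partial>tape)"
proof -
  let ?S = "sum w E" and ?q = "(1/9::real)^(L - 1)"
  have finA: "finite A" using A(1) fin by (rule finite_subset)
  have S0: "0 \<le> ?S" using w by (rule sum_nonneg)
  show ?thesis
  proof (cases "?S = 0")
    case True
    then have "w e = 0" if "e \<in> E" for e using that sum_nonneg_eq_0_iff[OF fin] w by auto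
    then have "(\<Sum>e\<in>A. (w e - ?S * ?q) / 8) = 0" using A(1) True by (intro sum.neutral) auto
    then show ?thesis by simp
  next
    case False
    then have S: "0 < ?S" using S0 by simp
    define r where "r e = w e / ?S" for e
    define v where "v e u = (if level L 1 (r e) u < L then (1 + 8 * u) / 9 * (1/9)^level L 1 (r e) u else 0)" for e u
    have [measurable]: "v e \<in> borel_measurable borel" for e
      unfolding v_def
      by (rule measurable_level_pair[where f = "\<lambda>a b u. if a < L then (1 + 8 * u) / 9 * (1/9)^b else 0"]) measurable
    have v0: "0 \<le> v e u" if "0 \<le> u" for e u using that by (simp add: v_def)
    have mv: "(\<lambda>\<omega>. ennreal (v e (\<omega> 0))) \<in> borel_measurable tape" for e
      by (rule measurable_compose[OF measurable_tape_component]) measurable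
    have r1: "r e \<le> 1" if "e \<in> A" for e
    proof -
      have "w e \<le> ?S" using that A(1) fin w by (intro member_le_sum) auto
      then show ?thesis using S by (simp add: r_def)
    qed
    have "(\<Sum>e\<in>A. (w e - ?S * ?q) / 8) = (\<Sum>e\<in>A. 3/8 * ?S * ((r e - ?q) / 3))"
      using S by (intro sum.cong refl) (simp add: r_def field_simps)
    also have "ennreal \<dots> \<le> ennreal (\<Sum>e\<in>A. max 0 (3/8 * ?S * ((r e - ?q) / 3)))"
      by (intro ennreal_leI sum_mono) simp
    also have "\<dots> = (\<Sum>e\<in>A. ennreal (max 0 (3/8 * ?S * ((r e - ?q) / 3))))"
      by (rule sum_ennreal[symmetric]) simp
    also have "\<dots> = (\<Sum>e\<in>A. ennreal (3/8 * ?S) * ennreal ((r e - ?q) / 3))"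
    proof (rule sum.cong[OF refl])
      fix e
      have "ennreal (max 0 (3/8 * ?S * ((r e - ?q) / 3))) = ennreal (3/8 * ?S * ((r e - ?q) / 3))"
        by (cases "0 \<le> 3/8 * ?S * ((r e - ?q) / 3)") (auto simp: max_def ennreal_neg)
      also have "\<dots> = ennreal (3/8 * ?S) * ennreal ((r e - ?q) / 3)"
        by (rule ennreal_mult') (use S in simp)
      finally show "ennreal (max 0 (3/8 * ?S * ((r e - ?q) / 3))) = ennreal (3/8 * ?S) * ennreal ((r e - ?q) / 3)" .
    qed
    also have "\<dots> \<le> (\<Sum>e\<in>A. ennreal (3/8 * ?S) * (\<integral>\<^sup>+\<omega>. ennreal (v e (\<omega> 0)) \<partial>tape))"
    proof (intro sum_mono mult_left_mono)
      fix e assume "e \<in> A"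
      from expected_rounded_ge[OF L r1[OF this]]
      show "ennreal ((r e - ?q) / 3) \<le> (\<integral>\<^sup>+\<omega>. ennreal (v e (\<omega> 0)) \<partial>tape)"
        by (subst nn_integral_tape_component[where f = "\<lambda>u. ennreal (v e u)"]) (auto simp: v_def)
    qed simp
    also have "\<dots> = (\<integral>\<^sup>+\<omega>. (\<Sum>e\<in>A. ennreal (3/8 * ?S) * ennreal (v e (\<omega> 0))) \<partial>tape)"
      using mv by (subst nn_integral_sum) (auto simp: nn_integral_cmult)
    also have "\<dots> \<le> (\<integral>\<^sup>+\<omega>. ennreal (sum w (class_matching E (classes E L w (\<omega> 0)) (key idx \<omega>))) \<partial>tape)"
    proof (rule nn_integral_mono_AE)
      show "AE \<omega> in tape. (\<Sum>e\<in>A. ennreal (3/8 * ?S) * ennreal (v e (\<omega> 0))) \<le>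
          ennreal (sum w (class_matching E (classes E L w (\<omega> 0)) (key idx \<omega>)))"
        using AE_inj_on_key[OF fin idx] AE_tape_mem[of 0]
      proof eventually_elim
        case (elim \<omega>)
        let ?u = "\<omega> 0"
        let ?d = "classes E L w ?u"
        let ?c = "(1 + 8 * ?u) * ?S / 9"
        have u: "0 \<le> ?u" using elim by simp
        have d: "?d e = level L 1 (r e) ?u" if "e \<in> E" for e
          using that by (simp add: classes_def r_def level_scale[OF S])
        have v: "?S * v e ?u = (if ?d e < L then ?c * (1/9)^?d e else 0)" if "e \<in> E" for e
          by (simp add: v_def d[OF that])
        have "3/8 * (\<Sum>e\<in>A. if ?d e < L then ?c * (1/9)^?d e else 0) \<le> sum w (class_matching E ?d (key idx \<omega>))"
        proof (rule class_matching_weight_ge[OF fin elim(1) two A])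
          show "0 \<le> ?c" using u S by simp
          show "(if ?d e < L then ?c * (1/9)^?d e else 0) \<le> w e" if "e \<in> E" for e
            using that w level_weight_le[OF u S0, of L "w e"] by (simp add: classes_def)
        qed
        also have "(\<Sum>e\<in>A. if ?d e < L then ?c * (1/9)^?d e else 0) = (\<Sum>e\<in>A. ?S * v e ?u)"
          by (rule sum.cong[OF refl], rule v[symmetric]) (use A(1) in blast)
        finally have "(\<Sum>e\<in>A. 3/8 * ?S * v e ?u) \<le> sum w (class_matching E ?d (key idx \<omega>))"
          by (simp add: sum_distrib_left mult_ac)
        then have "ennreal (\<Sum>e\<in>A. 3/8 * ?S * v e ?u) \<le> ennreal (sum w (class_matching E ?d (key idx \<omega>)))"
          by (rule ennreal_leI)
        moreover have "ennreal (\<Sum>e\<in>A. 3/8 * ?S * v e ?u) = (\<Sum>e\<in>A. ennreal (3/8 * ?S) * ennreal (v e ?u))"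
        proof -
          have "(\<Sum>e\<in>A. ennreal (3/8 * ?S) * ennreal (v e ?u)) = (\<Sum>e\<in>A. ennreal (3/8 * ?S * v e ?u))"
            using S v0[OF u] by (intro sum.cong ennreal_mult[symmetric]) auto
          also have "\<dots> = ennreal (\<Sum>e\<in>A. 3/8 * ?S * v e ?u)"
            using S v0[OF u] by (intro sum_ennreal) auto
          finally show ?thesis by simp
        qed
        ultimately show ?case by simp
      qed
    qed
    finally show ?thesis .
  qed
qed

section \<open>The program\<close>

subsection \<open>Verification conditions\<close>

definition runs :: "(nat \<Rightarrow> real) \<Rightarrow> com \<Rightarrow> state \<Rightarrow> nat \<Rightarrow> (state \<Rightarrow> bool) \<Rightarrow> bool" where
  "runs \<omega> c s b Q \<longleftrightarrow> (\<exists>t s'. exec \<omega> c s t s' \<and> t \<le> b \<and> Q s')"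

primrec wp :: "(nat \<Rightarrow> real) \<Rightarrow> com \<Rightarrow> (state \<Rightarrow> bool) \<Rightarrow> state \<Rightarrow> bool" where
  "wp \<omega> Skip Q s = Q s"
| "wp \<omega> (ISet a i e) Q s = Q (iupd a (ival i s) (ival e s) s)"
| "wp \<omega> (RSet a i e) Q s = Q (rupd a (ival i s) (rval e s) s)"
| "wp \<omega> (Sample a i) Q s = Q ((rupd a (ival i s) (\<omega> (drawn s)) s)\<lparr>drawn := Suc (drawn s)\<rparr>)"
| "wp \<omega> (Seq c d) Q s = wp \<omega> c (wp \<omega> d Q) s"
| "wp \<omega> (Cond b c d) Q s = (if bval b s then wp \<omega> c Q s else wp \<omega> d Q s)"
| "wp \<omega> (While b c) Q s = False"

primrec cost :: "com \<Rightarrow> nat" where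
  "cost Skip = 1"
| "cost (ISet a i e) = 1"
| "cost (RSet a i e) = 1"
| "cost (Sample a i) = 1"
| "cost (Seq c d) = cost c + cost d"
| "cost (Cond b c d) = Suc (max (cost c) (cost d))"
| "cost (While b c) = 0"

lemma ints_iupd [simp]: "ints (iupd a i x s) b j = (if b = a \<and> j = i then x else ints s b j)"
  and ints_rupd [simp]: "ints (rupd a i y s) = ints s"
  and reals_iupd [simp]: "reals (iupd a i x s) = reals s"
  and reals_rupd [simp]: "reals (rupd a i y s) b j = (if b = a \<and> j = i then y else reals s b j)"
  and drawn_iupd [simp]: "drawn (iupd a i x s) = drawn s"
  and drawn_rupd [simp]: "drawn (rupd a i y s) = drawn s"
  by (auto simp: iupd_def rupd_def)

lemma runs_mono:
  assumes "runs \<omega> c s b Q" "b \<le> b'" "\<And>s'. Q s' \<Longrightarrow> Q' s'"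
  shows "runs \<omega> c s b' Q'"
  using assms unfolding runs_def by (meson order_trans)

lemma runs_wp: "wp \<omega> c Q s \<Longrightarrow> runs \<omega> c s (cost c) Q"
proof (induction c arbitrary: s Q)
  case (Seq c d)
  from Seq.IH(1)[of "wp \<omega> d Q" s] Seq.prems
  obtain t s' where 1: "exec \<omega> c s t s'" "t \<le> cost c" "wp \<omega> d Q s'" by (auto simp: runs_def)
  from Seq.IH(2)[OF 1(3)]
  obtain u s'' where 2: "exec \<omega> d s' u s''" "u \<le> cost d" "Q s''" by (auto simp: runs_def)
  show ?case unfolding runs_def using exec.Seq[OF 1(1) 2(1)] 1(2) 2(2,3)
    by (metis add_mono cost.simps(5))
next
  case (Cond b c d)
  show ?case
  proof (cases "bval b s")
    case True
    then obtain t s' where "exec \<omega> c s t s'" "t \<le> cost c" "Q s'"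
      using Cond.IH(1)[of Q s] Cond.prems by (auto simp: runs_def)
    then show ?thesis using exec.CondTrue[OF True]
      by (metis Suc_le_mono cost.simps(6) max.coboundedI1 runs_def)
  next
    case False
    then obtain t s' where "exec \<omega> d s t s'" "t \<le> cost d" "Q s'"
      using Cond.IH(2)[of Q s] Cond.prems by (auto simp: runs_def)
    then show ?thesis using exec.CondFalse[OF False]
      by (metis Suc_le_mono cost.simps(6) max.coboundedI2 runs_def)
  qed
qed (simp_all add: runs_def, (use exec.intros(1-4)[unfolded One_nat_def] in blast)+)

lemma runs_Seq:
  assumes "runs \<omega> c s b P" "\<And>s'. P s' \<Longrightarrow> runs \<omega> d s' b' Q"
  shows "runs \<omega> (Seq c d) s (b + b') Q"
  using assms unfolding runs_def by (meson add_mono exec.Seq)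

lemma runs_Cond:
  assumes "bval b s \<Longrightarrow> runs \<omega> c s t Q" "\<not> bval b s \<Longrightarrow> runs \<omega> d s t Q"
  shows "runs \<omega> (Cond b c d) s (Suc t) Q"
  using assms unfolding runs_def by (meson Suc_le_mono exec.CondTrue exec.CondFalse)

abbreviation scalar :: "nat \<Rightarrow> iexp" where
  "scalar a \<equiv> IGet a (IConst 0)"

definition For :: "nat \<Rightarrow> iexp \<Rightarrow> com \<Rightarrow> com" where
  "For v m c = Seq (ISet v (IConst 0) (IConst 0))
     (While (ILess (scalar v) m) (Seq c (ISet v (IConst 0) (IAdd (scalar v) (IConst 1)))))"

abbreviation advance :: "nat \<Rightarrow> (nat \<Rightarrow> state \<Rightarrow> bool) \<Rightarrow> nat \<Rightarrow> state \<Rightarrow> bool" where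
  "advance v Inv k s \<equiv> ints s v 0 = k \<and> Inv (Suc k) (iupd v 0 (Suc k) s)"

lemma runs_For:
  assumes init: "Inv 0 (iupd v 0 0 s)"
    and step: "\<And>k s. k < N \<Longrightarrow> Inv k s \<Longrightarrow>
      runs \<omega> c s b (advance v Inv k)"
    and bound: "\<And>k s. Inv k s \<Longrightarrow> ints s v 0 = k \<and> ival m s = N"
  shows "runs \<omega> (For v m c) s (2 + N * (b + 2)) (Inv N)"
proof -
  let ?inc = "ISet v (IConst 0) (IAdd (scalar v) (IConst 1))"
  let ?W = "While (ILess (scalar v) m) (Seq c ?inc)"
  have loop: "runs \<omega> ?W s (1 + j * (b + 2)) (Inv N)" if "Inv k s" "k + j = N" for j k s
    using that
  proof (induction j arbitrary: k s)
    case 0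
    then have "\<not> bval (ILess (scalar v) m) s" using bound[OF 0(1)] by simp
    from exec.WhileFalse[OF this, of \<omega> "Seq c ?inc"] show ?case using 0 by (auto simp: runs_def)
  next
    case (Suc j)
    have test: "bval (ILess (scalar v) m) s" using bound[OF Suc.prems(1)] Suc.prems(2) by simp
    obtain t s' where 1: "exec \<omega> c s t s'" "t \<le> b" "ints s' v 0 = k" "Inv (Suc k) (iupd v 0 (Suc k) s')"
      using step[OF _ Suc.prems(1)] Suc.prems(2) by (auto simp: runs_def)
    have 2: "exec \<omega> ?inc s' 1 (iupd v 0 (Suc k) s')"
      using exec.ISet[of \<omega> v "IConst 0" "IAdd (scalar v) (IConst 1)" s'] 1(3) by simp
    obtain u s'' where 3: "exec \<omega> ?W (iupd v 0 (Suc k) s') u s''" "u \<le> 1 + j * (b + 2)" "Inv N s''"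
      using Suc.IH[OF 1(4)] Suc.prems(2) by (auto simp: runs_def)
    have "exec \<omega> ?W s (Suc (t + 1 + u)) s''"
      by (rule exec.WhileTrue[OF test exec.Seq[OF 1(1) 2] 3(1)])
    moreover have "Suc (t + 1 + u) \<le> 1 + Suc j * (b + 2)" using 1(2) 3(2) by simp
    ultimately show ?case using 3(3) unfolding runs_def by blast
  qed
  have "runs \<omega> (For v m c) s (cost (ISet v (IConst 0) (IConst 0)) + (1 + N * (b + 2))) (Inv N)"
    unfolding For_def
  proof (rule runs_Seq[OF runs_wp])
    show "wp \<omega> (ISet v (IConst 0) (IConst 0)) (Inv 0) s" using init by simp
  qed (rule loop, auto)
  then show ?thesis by simp
qed

subsection \<open>The code\<close>

text \<open>Integer arrays: 3 the number of cells, 4 to 6 loop counters, 7 and 8 the row and column of a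
  cell, 9 its class, 10 membership in the greedy set, 11 whether it represents an edge, 12 and 13
  the current row and column. Real arrays: 1 the sample \<open>u\<close> and then the current threshold, 2 the
  keys, 3 the total weight.\<close>

abbreviation iat :: "nat \<Rightarrow> nat \<Rightarrow> iexp" where
  "iat a v \<equiv> IGet a (scalar v)"

abbreviation rat :: "nat \<Rightarrow> nat \<Rightarrow> rexp" where
  "rat a v \<equiv> RGet a (scalar v)"

abbreviation rscalar :: "nat \<Rightarrow> rexp" where
  "rscalar a \<equiv> RGet a (IConst 0)"

abbreviation set_scalar :: "nat \<Rightarrow> iexp \<Rightarrow> com" where
  "set_scalar a e \<equiv> ISet a (IConst 0) e"

definition IEq :: "iexp \<Rightarrow> iexp \<Rightarrow> bexp" where
  "IEq i j = BAnd (BNot (ILess i j)) (BNot (ILess j i))"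

definition IPos :: "iexp \<Rightarrow> bexp" where
  "IPos i = ILess (IConst 0) i"

definition BOr :: "bexp \<Rightarrow> bexp \<Rightarrow> bexp" where
  "BOr b c = BNot (BAnd (BNot b) (BNot c))"

definition share :: bexp where
  "share = BOr (BOr (IEq (iat 7 5) (iat 7 4)) (IEq (iat 7 5) (iat 8 4)))
               (BOr (IEq (iat 8 5) (iat 7 4)) (IEq (iat 8 5) (iat 8 4)))"

definition scan :: com where
  "scan = Seq (ISet 7 (scalar 4) (scalar 12)) (Seq (ISet 8 (scalar 4) (scalar 13))
    (Seq (Sample 2 (scalar 4))
    (Seq (Cond (BAnd (IPos (iat 1 4)) (ILess (scalar 12) (scalar 13)))
            (Seq (ISet 11 (scalar 4) (IConst 1)) (RSet 3 (IConst 0) (RAdd (rscalar 3) (rat 0 4))))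
            (ISet 11 (scalar 4) (IConst 0)))
    (Seq (set_scalar 13 (IAdd (scalar 13) (IConst 1)))
         (Cond (ILess (scalar 13) (scalar 0)) Skip
            (Seq (set_scalar 13 (IConst 0)) (set_scalar 12 (IAdd (scalar 12) (IConst 1)))))))))"

definition classify :: com where
  "classify = Cond (RLess (rat 0 4) (rscalar 1)) (ISet 9 (scalar 4) (IAdd (iat 9 4) (IConst 1))) Skip"

definition block :: com where
  "block = Cond (BAnd (BAnd (IPos (iat 10 5)) (RLess (rat 2 5) (rat 2 4)))
                      (BAnd (IEq (iat 9 5) (iat 9 4)) share))
             (ISet 10 (scalar 4) (IConst 0)) Skip"

definition sweep :: com where
  "sweep = Cond (IPos (iat 11 4)) (Seq (ISet 10 (scalar 4) (IConst 1)) (For 5 (scalar 3) block)) Skip"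

definition kill :: com where
  "kill = Cond (BAnd (IPos (iat 10 5)) (BAnd (ILess (iat 9 5) (iat 9 4)) share))
            (ISet 2 (scalar 4) (IConst 0)) Skip"

definition select :: com where
  "select = Cond (IPos (iat 10 4)) (Seq (ISet 2 (scalar 4) (IConst 1)) (For 5 (scalar 3) kill)) Skip"

definition prog :: "nat \<Rightarrow> com" where
  "prog K = Seq (Sample 1 (IConst 0))
    (Seq (For 4 (scalar 0) (set_scalar 3 (IAdd (scalar 3) (scalar 0))))
    (Seq (For 4 (scalar 3) scan)
    (Seq (RSet 1 (IConst 0)
            (RDiv (RMul (RAdd (RConst 1) (RMul (RConst 8) (rscalar 1))) (rscalar 3)) (RConst 9)))
    (Seq (For 6 (IAdd (IAdd (scalar 0) (scalar 0)) (IConst K))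
            (Seq (For 4 (scalar 3) classify) (RSet 1 (IConst 0) (RDiv (rscalar 1) (RConst 9)))))
    (Seq (For 6 (scalar 3) (For 4 (scalar 3) sweep))
         (For 4 (scalar 3) select))))))"

lemma bval_simps [simp]:
  "bval (IEq i j) s \<longleftrightarrow> ival i s = ival j s"
  "bval (IPos i) s \<longleftrightarrow> ival i s \<noteq> 0"
  "bval (BOr b c) s \<longleftrightarrow> bval b s \<or> bval c s"
  by (auto simp: IEq_def IPos_def BOr_def)

definition eidx :: "ugraph \<Rightarrow> edge \<Rightarrow> nat" where
  "eidx G e = Min e * fst G + Max e"

context
  fixes G :: ugraph and w :: "edge \<Rightarrow> real" and \<omega> :: "nat \<Rightarrow> real" and K :: nat
  assumes G: "wf_ugraph G"
begin

private abbreviation (input) n where "n \<equiv> fst G"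
private abbreviation (input) E where "E \<equiv> edges G"

definition cell :: "nat \<Rightarrow> edge" where
  "cell k = {k div n, k mod n}"

definition active :: "nat \<Rightarrow> bool" where
  "active k \<longleftrightarrow> cell k \<in> E \<and> k div n < k mod n"

definition wcell :: "nat \<Rightarrow> real" where
  "wcell k = (if k < n * n \<and> cell k \<in> E then w (cell k) else 0)"

lemma eidx_cell: "active k \<Longrightarrow> eidx G (cell k) = k"
  by (auto simp: eidx_def cell_def active_def)

lemma cell_eidx:
  assumes "e \<in> E"
  shows "eidx G e < n * n" "cell (eidx G e) = e" "active (eidx G e)"
proof -
  have e: "e \<subseteq> {..<n}" "card e = 2" using G assms by (auto simp: wf_ugraph_def verts_def)
  then obtain a b where ab: "e = {a, b}" "a < b"
    by (metis card_2_iff insert_commute linorder_neqE_nat)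
  then have b: "b < n" using e by auto
  have idx: "eidx G e = a * n + b" using ab by (simp add: eidx_def)
  have "a * n + b < (a + 1) * n" using b by simp
  also have "\<dots> \<le> n * n" using ab b by (intro mult_right_mono) auto
  finally show "eidx G e < n * n" by (simp add: idx)
  have dm: "(a * n + b) div n = a" "(a * n + b) mod n = b" using b by auto
  have c: "cell (a * n + b) = e" unfolding cell_def dm using ab by simp
  show "cell (eidx G e) = e" "active (eidx G e)"
    unfolding active_def idx c dm using assms ab by auto
qed

lemma inj_on_eidx: "inj_on (eidx G) E"
  using cell_eidx(2) by (rule inj_on_inverseI)

lemma finite_edges: "finite E"
proof (rule finite_subset)
  show "E \<subseteq> Pow {..<n}" using G by (auto simp: wf_ugraph_def verts_def)
qed simp

lemma card_edges_le: "card E \<le> n * n"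
proof -
  have "card E \<le> card {..<n * n}"
    by (rule card_inj_on_le[OF inj_on_eidx]) (use cell_eidx(1) in auto)
  then show ?thesis by simp
qed

lemma sum_active: "(\<Sum>k | k < n * n \<and> active k. wcell k) = sum w E"
proof (rule sum.reindex_bij_witness[where i = "eidx G" and j = cell])
  fix k assume "k \<in> {k. k < n * n \<and> active k}"
  then show "eidx G (cell k) = k" "cell k \<in> E" "w (cell k) = wcell k"
    using eidx_cell by (auto simp: active_def wcell_def)
qed (use cell_eidx in auto)

definition scanned :: "state \<Rightarrow> bool" where
  "scanned s \<longleftrightarrow> ints s 0 0 = n \<and> ints s 3 0 = n * n \<and>
     (\<forall>k<n * n. ints s 7 k = k div n \<and> ints s 8 k = k mod n \<and> (ints s 11 k \<noteq> 0 \<longleftrightarrow> active k) \<and>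
        reals s 2 k = \<omega> (Suc k) \<and> reals s 0 k = wcell k)"

lemma runs_count:
  assumes "ints s 0 0 = n" "ints s 3 0 = 0"
  shows "runs \<omega> (For 4 (scalar 0) (set_scalar 3 (IAdd (scalar 3) (scalar 0)))) s (2 + n * (1 + 2))
    (\<lambda>s'. ints s' 3 0 = n * n \<and> reals s' = reals s \<and> drawn s' = drawn s \<and>
       (\<forall>a j. a \<noteq> 3 \<and> a \<noteq> 4 \<longrightarrow> ints s' a j = ints s a j))"
proof -
  define Inv where "Inv k s' \<longleftrightarrow> ints s' 4 0 = k \<and> ints s' 3 0 = k * n \<and> reals s' = reals s \<and>
    drawn s' = drawn s \<and> (\<forall>a j. a \<noteq> 3 \<and> a \<noteq> 4 \<longrightarrow> ints s' a j = ints s a j)" for k and s' :: state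
  have "runs \<omega> (For 4 (scalar 0) (set_scalar 3 (IAdd (scalar 3) (scalar 0)))) s (2 + n * (1 + 2)) (Inv n)"
  proof (rule runs_For)
    show "runs \<omega> (set_scalar 3 (IAdd (scalar 3) (scalar 0))) s' 1
        (advance 4 Inv k)" if "Inv k s'" for k and s' :: state
      using runs_wp[of \<omega> "set_scalar 3 (IAdd (scalar 3) (scalar 0))"] that assms
      by (simp add: Inv_def)
  qed (use assms in \<open>auto simp: Inv_def\<close>)
  then show ?thesis by (rule runs_mono) (auto simp: Inv_def)
qed

lemma runs_scan:
  assumes "ints s 0 0 = n" "ints s 3 0 = n * n" "ints s 12 0 = 0" "ints s 13 0 = 0"
    "reals s 3 0 = 0" "drawn s = 1" "\<And>k. k < n * n \<Longrightarrow> ints s 1 k \<noteq> 0 \<longleftrightarrow> cell k \<in> E"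
    "\<And>k. k < n * n \<Longrightarrow> reals s 0 k = wcell k"
  shows "runs \<omega> (For 4 (scalar 3) scan) s (2 + n * n * (cost scan + 2))
    (\<lambda>s'. scanned s' \<and> reals s' 1 0 = reals s 1 0 \<and> reals s' 3 0 = sum w E \<and>
       ints s' 2 = ints s 2 \<and> ints s' 9 = ints s 9 \<and> ints s' 10 = ints s 10)"
proof -
  define Inv where "Inv k s' \<longleftrightarrow> ints s' 4 0 = k \<and> ints s' 0 0 = n \<and> ints s' 3 0 = n * n \<and>
    ints s' 12 0 = k div n \<and> ints s' 13 0 = k mod n \<and> drawn s' = Suc k \<and>
    (\<forall>j<k. ints s' 7 j = j div n \<and> ints s' 8 j = j mod n \<and> (ints s' 11 j \<noteq> 0 \<longleftrightarrow> active j) \<and>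
        reals s' 2 j = \<omega> (Suc j)) \<and>
    reals s' 3 0 = (\<Sum>j | j < k \<and> active j. wcell j) \<and>
    (\<forall>j<n * n. (ints s' 1 j \<noteq> 0 \<longleftrightarrow> cell j \<in> E) \<and> reals s' 0 j = wcell j) \<and>
    reals s' 1 0 = reals s 1 0 \<and>
    (\<forall>j. ints s' 2 j = ints s 2 j \<and> ints s' 9 j = ints s 9 j \<and> ints s' 10 j = ints s 10 j)" for k and s' :: state
  have "runs \<omega> (For 4 (scalar 3) scan) s (2 + n * n * (cost scan + 2)) (Inv (n * n))"
  proof (rule runs_For)
    show "Inv 0 (iupd 4 0 0 s)" using assms by (simp add: Inv_def)
    show "runs \<omega> scan s' (cost scan) (advance 4 Inv k)"
      if k: "k < n * n" and I: "Inv k s'" for k and s' :: state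
    proof (rule runs_wp)
      have n: "0 < n" using k by (cases "n = 0") auto
      have "{j. j < Suc k \<and> active j} = (if active k then insert k else id) {j. j < k \<and> active j}"
        by (auto simp: less_Suc_eq)
      then have sum: "(\<Sum>j | j < Suc k \<and> active j. wcell j) =
          (\<Sum>j | j < k \<and> active j. wcell j) + (if active k then wcell k else 0)"
        by auto
      have dm: "Suc k div n = (if Suc (k mod n) < n then k div n else Suc (k div n))"
        "Suc k mod n = (if Suc (k mod n) < n then Suc (k mod n) else 0)"
        using n mod_less_divisor[OF n, of k] by (auto simp: div_Suc mod_Suc)
      have act: "active k \<longleftrightarrow> ints s' 1 k \<noteq> 0 \<and> k div n < k mod n"
        using I k by (auto simp: Inv_def active_def)
      show "wp \<omega> scan (advance 4 Inv k) s'"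
        using I k act unfolding scan_def Inv_def sum dm
        by (auto simp: less_Suc_eq)
    qed
  qed (auto simp: Inv_def)
  then show ?thesis
    by (rule runs_mono) (auto simp: Inv_def scanned_def sum_active)
qed

definition threshold :: "nat \<Rightarrow> real" where
  "threshold i = (1 + 8 * \<omega> 0) * sum w E / 9 ^ Suc i"

definition classified :: "nat \<Rightarrow> state \<Rightarrow> bool" where
  "classified i s \<longleftrightarrow> scanned s \<and> (\<forall>k<n * n. ints s 9 k = card {j. j < i \<and> wcell k < threshold j})"

lemma runs_classify_round:
  assumes "classified i s" "reals s 1 0 = threshold i"
  shows "runs \<omega> (For 4 (scalar 3) classify) s (2 + n * n * (cost classify + 2))
    (\<lambda>s'. classified (Suc i) s' \<and> reals s' = reals s \<and>
       (\<forall>a j. a \<noteq> 4 \<and> a \<noteq> 9 \<longrightarrow> ints s' a j = ints s a j))"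
proof -
  define Inv where "Inv k s' \<longleftrightarrow> ints s' 4 0 = k \<and> reals s' = reals s \<and>
    (\<forall>a j. a \<noteq> 4 \<and> a \<noteq> 9 \<longrightarrow> ints s' a j = ints s a j) \<and>
    (\<forall>j<n * n. ints s' 9 j = card {l. l < (if j < k then Suc i else i) \<and> wcell j < threshold l})" for k and s' :: state
  have Suc_card: "card {l. l < Suc i \<and> x < threshold l} =
      card {l. l < i \<and> x < threshold l} + (if x < threshold i then 1 else 0)" for x
  proof -
    have "{l. l < Suc i \<and> x < threshold l} =
        (if x < threshold i then insert i else id) {l. l < i \<and> x < threshold l}"
      by (auto simp: less_Suc_eq)
    then show ?thesis by auto
  qed
  have N: "ints s 3 0 = n * n" and W: "\<And>k. k < n * n \<Longrightarrow> reals s 0 k = wcell k"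
    using assms by (auto simp: classified_def scanned_def)
  have "runs \<omega> (For 4 (scalar 3) classify) s (2 + n * n * (cost classify + 2)) (Inv (n * n))"
  proof (rule runs_For)
    show "Inv 0 (iupd 4 0 0 s)" using assms by (auto simp: Inv_def classified_def)
    show "runs \<omega> classify s' (cost classify) (advance 4 Inv k)"
      if k: "k < n * n" and I: "Inv k s'" for k and s' :: state
    proof (rule runs_wp)
      show "wp \<omega> classify (advance 4 Inv k) s'"
        using I k W[OF k] assms(2) unfolding classify_def Inv_def
        by (auto simp: less_Suc_eq Suc_card[unfolded less_Suc_eq])
    qed
  qed (use N in \<open>auto simp: Inv_def\<close>)
  then show ?thesis
    by (rule runs_mono) (use assms in \<open>auto simp: Inv_def classified_def scanned_def\<close>)
qed

lemma runs_classify: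
  assumes "scanned s" "reals s 1 0 = threshold 0" "\<And>k. ints s 9 k = 0"
  shows "runs \<omega> (For 6 (IAdd (IAdd (scalar 0) (scalar 0)) (IConst K))
      (Seq (For 4 (scalar 3) classify) (RSet 1 (IConst 0) (RDiv (rscalar 1) (RConst 9))))) s
    (2 + (2 * n + K) * (2 + n * n * (cost classify + 2) + 1 + 2))
    (\<lambda>s'. classified (2 * n + K) s' \<and> ints s' 2 = ints s 2 \<and> ints s' 10 = ints s 10)"
proof -
  define Inv where "Inv i s' \<longleftrightarrow> ints s' 6 0 = i \<and> classified i s' \<and> reals s' 1 0 = threshold i \<and>
    ints s' 2 = ints s 2 \<and> ints s' 10 = ints s 10" for i and s' :: state
  have "runs \<omega> (For 6 (IAdd (IAdd (scalar 0) (scalar 0)) (IConst K))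
      (Seq (For 4 (scalar 3) classify) (RSet 1 (IConst 0) (RDiv (rscalar 1) (RConst 9))))) s
    (2 + (2 * n + K) * (2 + n * n * (cost classify + 2) + 1 + 2)) (Inv (2 * n + K))"
  proof (rule runs_For)
    show "Inv 0 (iupd 6 0 0 s)"
      using assms by (auto simp: Inv_def classified_def scanned_def fun_eq_iff)
    show "runs \<omega> (Seq (For 4 (scalar 3) classify) (RSet 1 (IConst 0) (RDiv (rscalar 1) (RConst 9)))) s'
        (2 + n * n * (cost classify + 2) + 1) (advance 6 Inv i)"
      if I: "Inv i s'" for i and s' :: state
    proof (rule runs_Seq)
      show "runs \<omega> (For 4 (scalar 3) classify) s' (2 + n * n * (cost classify + 2))
        (\<lambda>s''. classified (Suc i) s'' \<and> reals s'' = reals s' \<and>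
           (\<forall>a j. a \<noteq> 4 \<and> a \<noteq> 9 \<longrightarrow> ints s'' a j = ints s' a j))"
        by (rule runs_classify_round) (use I in \<open>auto simp: Inv_def\<close>)
      show "runs \<omega> (RSet 1 (IConst 0) (RDiv (rscalar 1) (RConst 9))) s'' 1
          (advance 6 Inv i)"
        if "classified (Suc i) s'' \<and> reals s'' = reals s' \<and>
           (\<forall>a j. a \<noteq> 4 \<and> a \<noteq> 9 \<longrightarrow> ints s'' a j = ints s' a j)" for s''
        using runs_wp[of \<omega> "RSet 1 (IConst 0) (RDiv (rscalar 1) (RConst 9))"] that I
        by (auto simp: Inv_def classified_def scanned_def threshold_def fun_eq_iff)
    qed
  qed (auto simp: Inv_def classified_def scanned_def)
  then show ?thesis by (rule runs_mono) (auto simp: Inv_def)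
qed

text \<open>The greedy set is computed by repeated in-place sweeps: after \<open>t\<close> sweeps the entries of the
  \<open>t\<close> edges with the smallest keys are final.\<close>

private abbreviation (input) cls where "cls \<equiv> classes E (2 * n + K) w (\<omega> 0)"
private abbreviation (input) \<pi> where "\<pi> \<equiv> key (eidx G) \<omega>"
private abbreviation (input) greedy_set where "greedy_set \<equiv> greedy E (conflict cls) \<pi>"

definition rank :: "nat \<Rightarrow> nat" where
  "rank k = card {f \<in> E. \<pi> f < \<pi> (cell k)}"

definition swept :: "nat \<Rightarrow> nat \<Rightarrow> state \<Rightarrow> bool" where
  "swept t k s \<longleftrightarrow> classified (2 * n + K) s \<and> (\<forall>j<n * n. \<not> active j \<longrightarrow> ints s 10 j = 0) \<and>
     (\<forall>j<n * n. active j \<and> (rank j < t \<or> rank j = t \<and> j < k) \<longrightarrow>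
        (ints s 10 j \<noteq> 0 \<longleftrightarrow> cell j \<in> greedy_set))"

lemma classified_cls:
  assumes "classified (2 * n + K) s" "k < n * n" "active k"
  shows "ints s 9 k = cls (cell k)"
proof -
  have "cell k \<in> E" using assms by (simp add: active_def)
  then show ?thesis
    using assms by (simp add: classified_def classes_def level_def threshold_def wcell_def)
qed

lemma key_cell: "active k \<Longrightarrow> \<pi> (cell k) = \<omega> (Suc k)"
  by (simp add: key_def eidx_cell)

definition shares :: "nat \<Rightarrow> nat \<Rightarrow> bool" where
  "shares j k \<longleftrightarrow> (j div n = k div n \<or> j div n = k mod n) \<or> (j mod n = k div n \<or> j mod n = k mod n)"

lemma shares_iff: "shares j k \<longleftrightarrow> cell j \<inter> cell k \<noteq> {}"
  by (auto simp: shares_def cell_def)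

lemma bval_share:
  assumes "scanned s" "ints s 4 0 = k" "ints s 5 0 = j" "k < n * n" "j < n * n"
  shows "bval share s \<longleftrightarrow> shares j k"
  using assms by (auto simp: share_def shares_def scanned_def)

definition blocks :: "nat \<Rightarrow> nat \<Rightarrow> state \<Rightarrow> bool" where
  "blocks j k s \<longleftrightarrow> ints s 10 j \<noteq> 0 \<and> \<omega> (Suc j) < \<omega> (Suc k) \<and> ints s 9 j = ints s 9 k \<and> shares j k"

lemma runs_reset:
  assumes sc: "scanned s" and k: "ints s 4 0 = k" "k < n * n" and a: "a \<notin> {0, 3, 4, 5, 7, 8, 11}"
    and test: "\<And>j s'. j < n * n \<Longrightarrow> scanned s' \<Longrightarrow> ints s' 4 0 = k \<Longrightarrow> ints s' 5 0 = j \<Longrightarrow>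
      (\<And>b i. b \<noteq> 5 \<Longrightarrow> (b = a \<Longrightarrow> i \<noteq> k) \<Longrightarrow> ints s' b i = ints s b i) \<Longrightarrow> bval b s' \<longleftrightarrow> B j"
  defines "c \<equiv> Cond b (ISet a (scalar 4) (IConst 0)) Skip"
  shows "runs \<omega> (For 5 (scalar 3) c) (iupd a k 1 s) (2 + n * n * (cost c + 2))
    (\<lambda>s'. (ints s' a k \<noteq> 0 \<longleftrightarrow> (\<forall>j<n * n. \<not> B j)) \<and> reals s' = reals s \<and>
       (\<forall>b j. b \<noteq> 5 \<and> (b = a \<longrightarrow> j \<noteq> k) \<longrightarrow> ints s' b j = ints s b j))"
proof -
  define Inv where "Inv j s' \<longleftrightarrow> ints s' 5 0 = j \<and> reals s' = reals s \<and>
    (ints s' a k \<noteq> 0 \<longleftrightarrow> (\<forall>i<j. \<not> B i)) \<and>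
    (\<forall>b j. b \<noteq> 5 \<and> (b = a \<longrightarrow> j \<noteq> k) \<longrightarrow> ints s' b j = ints s b j)" for j and s' :: state
  have sc': "scanned s'" "ints s' 4 0 = k" if "Inv j s'" for j s'
    using that sc k a by (auto simp: Inv_def scanned_def)
  have "runs \<omega> (For 5 (scalar 3) c) (iupd a k 1 s) (2 + n * n * (cost c + 2)) (Inv (n * n))"
  proof (rule runs_For)
    show "Inv 0 (iupd 5 0 0 (iupd a k 1 s))" using a by (auto simp: Inv_def)
    show "ints s' 5 0 = j \<and> ival (scalar 3) s' = n * n" if "Inv j s'" for j s'
      using that sc'[OF that] by (auto simp: Inv_def scanned_def)
    show "runs \<omega> c s' (cost c) (advance 5 Inv j)" if j: "j < n * n" and I: "Inv j s'" for j s'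
    proof (rule runs_wp)
      have "bval b s' \<longleftrightarrow> B j" by (rule test[OF j sc'[OF I]]) (use I in \<open>auto simp: Inv_def\<close>)
      then show "wp \<omega> c (advance 5 Inv j) s'"
        using I sc'(2)[OF I] a by (auto simp: c_def Inv_def less_Suc_eq)
    qed
  qed
  then show ?thesis by (rule runs_mono) (auto simp: Inv_def)
qed

lemma runs_block:
  assumes "scanned s" "ints s 4 0 = k" "k < n * n"
  shows "runs \<omega> (For 5 (scalar 3) block) (iupd 10 k 1 s) (2 + n * n * (cost block + 2))
    (\<lambda>s'. (ints s' 10 k \<noteq> 0 \<longleftrightarrow> (\<forall>j<n * n. \<not> blocks j k s)) \<and> reals s' = reals s \<and>
       (\<forall>a j. a \<noteq> 5 \<and> (a = 10 \<longrightarrow> j \<noteq> k) \<longrightarrow> ints s' a j = ints s a j))"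
  unfolding block_def
proof (rule runs_reset[OF assms])
  fix j s' assume j: "j < n * n" and s': "scanned s'" "ints s' 4 0 = k" "ints s' 5 0 = j"
    and frame: "\<And>b i. b \<noteq> 5 \<Longrightarrow> (b = 10 \<Longrightarrow> i \<noteq> k) \<Longrightarrow> ints s' b i = ints s b i"
  have keys: "reals s' 2 j = \<omega> (Suc j)" "reals s' 2 k = \<omega> (Suc k)"
    using s' j assms by (auto simp: scanned_def)
  have "ints s' 9 j = ints s 9 j" "ints s' 9 k = ints s 9 k" "j \<noteq> k \<Longrightarrow> ints s' 10 j = ints s 10 j"
    using frame by auto
  then show "bval (BAnd (BAnd (IPos (iat 10 5)) (RLess (rat 2 5) (rat 2 4)))
      (BAnd (IEq (iat 9 5) (iat 9 4)) share)) s' \<longleftrightarrow> blocks j k s"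
    by (cases "j = k") (auto simp: blocks_def s' keys bval_share[OF s' assms(3) j])
qed simp

lemma rank_less:
  assumes "active j" "active k" "\<omega> (Suc j) < \<omega> (Suc k)"
  shows "rank j < rank k"
  unfolding rank_def
proof (rule psubset_card_mono)
  show "finite {f \<in> E. \<pi> f < \<pi> (cell k)}" using finite_edges by simp
  have "cell j \<in> E" using assms by (simp add: active_def)
  moreover have "\<pi> (cell j) < \<pi> (cell k)" using assms by (simp add: key_cell)
  ultimately show "{f \<in> E. \<pi> f < \<pi> (cell j)} \<subset> {f \<in> E. \<pi> f < \<pi> (cell k)}"
    by (intro psubsetI subsetI notI) (auto dest: equalityD2)
qed

lemma not_blocked_iff:
  assumes s: "swept t k s" and k: "k < n * n" "active k" "rank k \<le> t"
  shows "(\<forall>j<n * n. \<not> blocks j k s) \<longleftrightarrow> cell k \<in> greedy_set"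
proof -
  have cls: "classified (2 * n + K) s" using s by (simp add: swept_def)
  have final: "ints s 10 j \<noteq> 0 \<longleftrightarrow> cell j \<in> greedy_set"
    if "j < n * n" "active j" "\<omega> (Suc j) < \<omega> (Suc k)" for j
    using rank_less[OF that(2) k(2) that(3)] k(3) s that by (auto simp: swept_def)
  have kE: "cell k \<in> E" using k by (simp add: active_def)
  have "(\<exists>j<n * n. blocks j k s) \<longleftrightarrow> (\<exists>f\<in>greedy_set. conflict cls f (cell k) \<and> \<pi> f < \<pi> (cell k))"
  proof
    assume "\<exists>j<n * n. blocks j k s"
    then obtain j where j: "j < n * n" "blocks j k s" by blast
    then have act: "active j" using s by (auto simp: blocks_def swept_def)
    then have "cell j \<in> greedy_set" using final[of j] j by (simp add: blocks_def)
    moreover have "\<pi> (cell j) < \<pi> (cell k)" using j act k by (simp add: blocks_def key_cell)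
    moreover have "conflict cls (cell j) (cell k)"
      using j calculation(2) classified_cls[OF cls j(1) act] classified_cls[OF cls k(1,2)]
      by (auto simp: conflict_def blocks_def shares_iff)
    ultimately show "\<exists>f\<in>greedy_set. conflict cls f (cell k) \<and> \<pi> f < \<pi> (cell k)" by blast
  next
    assume "\<exists>f\<in>greedy_set. conflict cls f (cell k) \<and> \<pi> f < \<pi> (cell k)"
    then obtain f where f: "f \<in> greedy_set" "conflict cls f (cell k)" "\<pi> f < \<pi> (cell k)" by blast
    then have "f \<in> E" using greedy_subset[OF finite_edges] by blast
    note fj = cell_eidx[OF this]
    have "\<omega> (Suc (eidx G f)) < \<omega> (Suc k)" using f(3) key_cell[OF k(2)] by (simp add: key_def)
    then have "blocks (eidx G f) k s"
      using f final[OF fj(1,3)] classified_cls[OF cls fj(1,3)] classified_cls[OF cls k(1,2)] fj(2)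
      by (auto simp: blocks_def conflict_def shares_iff)
    then show "\<exists>j<n * n. blocks j k s" using fj(1) by blast
  qed
  then show ?thesis unfolding greedy_mem_iff[OF finite_edges kE, of "conflict cls" \<pi>] by blast
qed

lemma runs_sweep:
  assumes "swept t 0 s"
  shows "runs \<omega> (For 4 (scalar 3) sweep) s (2 + n * n * (Suc (1 + (2 + n * n * (cost block + 2))) + 2))
    (\<lambda>s'. swept (Suc t) 0 s' \<and> (\<forall>a j. a \<noteq> 4 \<and> a \<noteq> 5 \<and> a \<noteq> 10 \<longrightarrow> ints s' a j = ints s a j))"
proof -
  define Inv where "Inv k s' \<longleftrightarrow> ints s' 4 0 = k \<and> swept t k s' \<and>
    (\<forall>a j. a \<noteq> 4 \<and> a \<noteq> 5 \<and> a \<noteq> 10 \<longrightarrow> ints s' a j = ints s a j)" for k and s' :: state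
  have "runs \<omega> (For 4 (scalar 3) sweep) s (2 + n * n * (Suc (1 + (2 + n * n * (cost block + 2))) + 2))
      (Inv (n * n))"
  proof (rule runs_For)
    show "Inv 0 (iupd 4 0 0 s)"
      using assms by (auto simp: Inv_def swept_def classified_def scanned_def)
    show "ints s' 4 0 = k \<and> ival (scalar 3) s' = n * n" if "Inv k s'" for k s'
      using that by (auto simp: Inv_def swept_def classified_def scanned_def)
    show "runs \<omega> sweep s' (Suc (1 + (2 + n * n * (cost block + 2))))
        (advance 4 Inv k)"
      if k: "k < n * n" and I: "Inv k s'" for k s'
      unfolding sweep_def
    proof (rule runs_Cond)
      have sw: "swept t k s'" and k4: "ints s' 4 0 = k" using I by (auto simp: Inv_def)
      have sc: "scanned s'" using sw by (simp add: swept_def classified_def)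
      have test: "bval (IPos (iat 11 4)) s' \<longleftrightarrow> active k"
        using sc k k4 by (auto simp: scanned_def)
      show "runs \<omega> (Seq (ISet 10 (scalar 4) (IConst 1)) (For 5 (scalar 3) block)) s'
          (1 + (2 + n * n * (cost block + 2)))
          (advance 4 Inv k)"
        if "bval (IPos (iat 11 4)) s'"
      proof (rule runs_Seq)
        have act: "active k" using test that by simp
        show "runs \<omega> (ISet 10 (scalar 4) (IConst 1)) s' 1 (\<lambda>s''. s'' = iupd 10 k 1 s')"
          using runs_wp[of \<omega> "ISet 10 (scalar 4) (IConst 1)" "\<lambda>s''. s'' = iupd 10 k 1 s'"] k4 by simp
        fix s'' assume "s'' = iupd 10 k 1 s'"
        then show "runs \<omega> (For 5 (scalar 3) block) s'' (2 + n * n * (cost block + 2))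
          (advance 4 Inv k)"
        proof (simp only:, intro runs_mono[OF runs_block[OF sc k4 k]])
          fix r :: state assume r: "(ints r 10 k \<noteq> 0 \<longleftrightarrow> (\<forall>j<n * n. \<not> blocks j k s')) \<and> reals r = reals s' \<and>
            (\<forall>a j. a \<noteq> 5 \<and> (a = 10 \<longrightarrow> j \<noteq> k) \<longrightarrow> ints r a j = ints s' a j)"
          have new: "rank k \<le> t \<Longrightarrow> ints r 10 k \<noteq> 0 \<longleftrightarrow> cell k \<in> greedy_set"
            using r not_blocked_iff[OF sw k act] by simp
          have old: "ints r 10 j = ints s' 10 j" if "j \<noteq> k" for j using r that by simp
          have "classified (2 * n + K) (iupd 4 0 (Suc k) r)"
            using r sw by (auto simp: swept_def classified_def scanned_def)
          moreover have "ints r 10 j \<noteq> 0 \<longleftrightarrow> cell j \<in> greedy_set"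
            if "j < n * n" "active j" "rank j < t \<or> rank j = t \<and> j < Suc k" for j
            using that new old[of j] sw by (cases "j = k") (auto simp: swept_def less_Suc_eq)
          moreover have "ints r 10 j = 0" if "j < n * n" "\<not> active j" for j
            using that act old[of j] sw by (cases "j = k") (auto simp: swept_def)
          ultimately have "swept t (Suc k) (iupd 4 0 (Suc k) r)" by (simp add: swept_def)
          then show "ints r 4 0 = k \<and> Inv (Suc k) (iupd 4 0 (Suc k) r)"
            using r I by (simp add: Inv_def)
        qed simp
      qed
      show "runs \<omega> Skip s' (1 + (2 + n * n * (cost block + 2)))
          (advance 4 Inv k)"
        if "\<not> bval (IPos (iat 11 4)) s'"
      proof (rule runs_mono[OF runs_wp])
        have "\<not> active k" using test that by simp
        then have "swept t (Suc k) (iupd 4 0 (Suc k) s')"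
          using sw by (auto simp: swept_def classified_def scanned_def less_Suc_eq)
        then show "wp \<omega> Skip (advance 4 Inv k) s'"
          using I by (simp add: Inv_def)
      qed auto
    qed
  qed
  then show ?thesis
    by (rule runs_mono) (auto simp: Inv_def swept_def less_Suc_eq)
qed

lemma runs_sweeps:
  assumes "swept 0 0 s"
  shows "runs \<omega> (For 6 (scalar 3) (For 4 (scalar 3) sweep)) s
    (2 + n * n * ((2 + n * n * (Suc (1 + (2 + n * n * (cost block + 2))) + 2)) + 2))
    (\<lambda>s'. classified (2 * n + K) s' \<and> ints s' 2 = ints s 2 \<and>
       (\<forall>k<n * n. ints s' 10 k \<noteq> 0 \<longleftrightarrow> active k \<and> cell k \<in> greedy_set))"
proof -
  define Inv where "Inv t s' \<longleftrightarrow> ints s' 6 0 = t \<and> swept t 0 s' \<and> ints s' 2 = ints s 2" for t and s' :: state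
  have "runs \<omega> (For 6 (scalar 3) (For 4 (scalar 3) sweep)) s
    (2 + n * n * ((2 + n * n * (Suc (1 + (2 + n * n * (cost block + 2))) + 2)) + 2)) (Inv (n * n))"
  proof (rule runs_For)
    show "Inv 0 (iupd 6 0 0 s)"
      using assms by (auto simp: Inv_def swept_def classified_def scanned_def fun_eq_iff)
    show "ints s' 6 0 = t \<and> ival (scalar 3) s' = n * n" if "Inv t s'" for t s'
      using that by (auto simp: Inv_def swept_def classified_def scanned_def)
    fix t s' assume I: "Inv t s'"
    show "runs \<omega> (For 4 (scalar 3) sweep) s' (2 + n * n * (Suc (1 + (2 + n * n * (cost block + 2))) + 2))
        (advance 6 Inv t)"
    proof (rule runs_mono[OF runs_sweep])
      show "swept t 0 s'" using I by (simp add: Inv_def)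
    qed (use I in \<open>auto simp: Inv_def swept_def classified_def scanned_def fun_eq_iff\<close>)
  qed
  then show ?thesis
  proof (rule runs_mono)
    fix s' assume I: "Inv (n * n) s'"
    have "rank k < n * n" if "active k" for k
    proof -
      have "cell k \<in> E" using that by (simp add: active_def)
      then have "rank k < card E"
        unfolding rank_def by (intro psubset_card_mono finite_edges) auto
      then show ?thesis using card_edges_le by simp
    qed
    then show "classified (2 * n + K) s' \<and> ints s' 2 = ints s 2 \<and>
        (\<forall>k<n * n. ints s' 10 k \<noteq> 0 \<longleftrightarrow> active k \<and> cell k \<in> greedy_set)"
      using I by (auto simp: Inv_def swept_def)
  qed simp
qed

definition kills :: "nat \<Rightarrow> nat \<Rightarrow> state \<Rightarrow> bool" where
  "kills j k s \<longleftrightarrow> ints s 10 j \<noteq> 0 \<and> ints s 9 j < ints s 9 k \<and> shares j k"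

lemma runs_kill:
  assumes "scanned s" "ints s 4 0 = k" "k < n * n"
  shows "runs \<omega> (For 5 (scalar 3) kill) (iupd 2 k 1 s) (2 + n * n * (cost kill + 2))
    (\<lambda>s'. (ints s' 2 k \<noteq> 0 \<longleftrightarrow> (\<forall>j<n * n. \<not> kills j k s)) \<and> reals s' = reals s \<and>
       (\<forall>a j. a \<noteq> 5 \<and> (a = 2 \<longrightarrow> j \<noteq> k) \<longrightarrow> ints s' a j = ints s a j))"
  unfolding kill_def
proof (rule runs_reset[OF assms])
  fix j s' assume j: "j < n * n" and s': "scanned s'" "ints s' 4 0 = k" "ints s' 5 0 = j"
    and frame: "\<And>b i. b \<noteq> 5 \<Longrightarrow> (b = 2 \<Longrightarrow> i \<noteq> k) \<Longrightarrow> ints s' b i = ints s b i"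
  have "ints s' 10 j = ints s 10 j" "ints s' 9 j = ints s 9 j" "ints s' 9 k = ints s 9 k"
    using frame by auto
  then show "bval (BAnd (IPos (iat 10 5)) (BAnd (ILess (iat 9 5) (iat 9 4)) share)) s' \<longleftrightarrow> kills j k s"
    by (simp add: kills_def s' bval_share[OF s' assms(3) j])
qed simp

lemma not_killed_iff:
  assumes cls: "classified (2 * n + K) s"
    and s: "\<And>j. j < n * n \<Longrightarrow> ints s 10 j \<noteq> 0 \<longleftrightarrow> active j \<and> cell j \<in> greedy_set"
    and k: "k < n * n" "active k" "cell k \<in> greedy_set"
  shows "(\<forall>j<n * n. \<not> kills j k s) \<longleftrightarrow> cell k \<in> class_matching E cls \<pi>"
proof -
  have "(\<exists>j<n * n. kills j k s) \<longleftrightarrow> (\<exists>f\<in>greedy_set. cell k \<inter> f \<noteq> {} \<and> cls f < cls (cell k))"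
  proof
    assume "\<exists>j<n * n. kills j k s"
    then obtain j where j: "j < n * n" "kills j k s" by blast
    then have act: "active j" "cell j \<in> greedy_set" using s by (auto simp: kills_def)
    then show "\<exists>f\<in>greedy_set. cell k \<inter> f \<noteq> {} \<and> cls f < cls (cell k)"
      using j classified_cls[OF cls j(1)] classified_cls[OF cls k(1,2)]
      by (intro bexI[of _ "cell j"]) (auto simp: kills_def shares_iff)
  next
    assume "\<exists>f\<in>greedy_set. cell k \<inter> f \<noteq> {} \<and> cls f < cls (cell k)"
    then obtain f where f: "f \<in> greedy_set" "cell k \<inter> f \<noteq> {}" "cls f < cls (cell k)" by blast
    then have "f \<in> E" using greedy_subset[OF finite_edges] by blast
    note fj = cell_eidx[OF this]
    have "kills (eidx G f) k s"
      using f s[OF fj(1)] classified_cls[OF cls fj(1,3)] classified_cls[OF cls k(1,2)] fj(2,3)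
      by (auto simp: kills_def shares_iff)
    then show "\<exists>j<n * n. kills j k s" using fj(1) by blast
  qed
  then show ?thesis using k(3) unfolding class_matching_def undominated_def by blast
qed

lemma runs_select:
  assumes cls: "classified (2 * n + K) s" and out: "\<And>k. ints s 2 k = 0"
    and s: "\<And>j. j < n * n \<Longrightarrow> ints s 10 j \<noteq> 0 \<longleftrightarrow> active j \<and> cell j \<in> greedy_set"
  shows "runs \<omega> (For 4 (scalar 3) select) s (2 + n * n * (Suc (1 + (2 + n * n * (cost kill + 2))) + 2))
    (\<lambda>s'. \<forall>k<n * n. ints s' 2 k \<noteq> 0 \<longleftrightarrow> active k \<and> cell k \<in> class_matching E cls \<pi>)"
proof -
  define Inv where "Inv k s' \<longleftrightarrow> ints s' 4 0 = k \<and> reals s' = reals s \<and>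
    (\<forall>a j. a \<noteq> 2 \<and> a \<noteq> 4 \<and> a \<noteq> 5 \<longrightarrow> ints s' a j = ints s a j) \<and>
    (\<forall>j<n * n. ints s' 2 j \<noteq> 0 \<longleftrightarrow> j < k \<and> active j \<and> cell j \<in> class_matching E cls \<pi>)"
    for k and s' :: state
  have sub: "class_matching E cls \<pi> \<subseteq> greedy_set"
    unfolding class_matching_def by (rule undominated_subset)
  have "runs \<omega> (For 4 (scalar 3) select) s (2 + n * n * (Suc (1 + (2 + n * n * (cost kill + 2))) + 2))
      (Inv (n * n))"
  proof (rule runs_For)
    show "Inv 0 (iupd 4 0 0 s)" using out by (auto simp: Inv_def)
    show "ints s' 4 0 = k \<and> ival (scalar 3) s' = n * n" if "Inv k s'" for k s'
      using that cls by (auto simp: Inv_def classified_def scanned_def)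
    show "runs \<omega> select s' (Suc (1 + (2 + n * n * (cost kill + 2))))
        (advance 4 Inv k)"
      if k: "k < n * n" and I: "Inv k s'" for k s'
      unfolding select_def
    proof (rule runs_Cond)
      have k4: "ints s' 4 0 = k" using I by (auto simp: Inv_def)
      have cls': "classified (2 * n + K) s'"
        using cls I by (auto simp: Inv_def classified_def scanned_def)
      then have sc: "scanned s'" by (simp add: classified_def)
      have s': "ints s' 10 j \<noteq> 0 \<longleftrightarrow> active j \<and> cell j \<in> greedy_set" if "j < n * n" for j
        using s[OF that] I by (simp add: Inv_def)
      have test: "bval (IPos (iat 10 4)) s' \<longleftrightarrow> active k \<and> cell k \<in> greedy_set"
        using s'[OF k] k4 by simp
      show "runs \<omega> (Seq (ISet 2 (scalar 4) (IConst 1)) (For 5 (scalar 3) kill)) s'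
          (1 + (2 + n * n * (cost kill + 2)))
          (advance 4 Inv k)"
        if "bval (IPos (iat 10 4)) s'"
      proof (rule runs_Seq)
        have act: "active k" "cell k \<in> greedy_set" using test that by auto
        show "runs \<omega> (ISet 2 (scalar 4) (IConst 1)) s' 1 (\<lambda>s''. s'' = iupd 2 k 1 s')"
          using runs_wp[of \<omega> "ISet 2 (scalar 4) (IConst 1)" "\<lambda>s''. s'' = iupd 2 k 1 s'"] k4 by simp
        fix s'' assume "s'' = iupd 2 k 1 s'"
        then show "runs \<omega> (For 5 (scalar 3) kill) s'' (2 + n * n * (cost kill + 2))
          (advance 4 Inv k)"
        proof (simp only:, intro runs_mono[OF runs_kill[OF sc k4 k]])
          fix r :: state assume r: "(ints r 2 k \<noteq> 0 \<longleftrightarrow> (\<forall>j<n * n. \<not> kills j k s')) \<and> reals r = reals s' \<and>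
            (\<forall>a j. a \<noteq> 5 \<and> (a = 2 \<longrightarrow> j \<noteq> k) \<longrightarrow> ints r a j = ints s' a j)"
          have new: "ints r 2 k \<noteq> 0 \<longleftrightarrow> cell k \<in> class_matching E cls \<pi>"
            using r not_killed_iff[OF cls' s' k act] by simp
          have "ints r 2 j \<noteq> 0 \<longleftrightarrow> j < Suc k \<and> active j \<and> cell j \<in> class_matching E cls \<pi>"
            if "j < n * n" for j
            using that new act r I by (cases "j = k") (auto simp: Inv_def less_Suc_eq)
          then show "ints r 4 0 = k \<and> Inv (Suc k) (iupd 4 0 (Suc k) r)"
            using r I by (simp add: Inv_def)
        qed simp
      qed
      show "runs \<omega> Skip s' (1 + (2 + n * n * (cost kill + 2)))
          (advance 4 Inv k)"
        if "\<not> bval (IPos (iat 10 4)) s'"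
      proof (rule runs_mono[OF runs_wp])
        have "\<not> (active k \<and> cell k \<in> class_matching E cls \<pi>)" using test that sub by blast
        then show "wp \<omega> Skip (advance 4 Inv k) s'"
          using I by (auto simp: Inv_def less_Suc_eq)
      qed auto
    qed
  qed
  then show ?thesis by (rule runs_mono) (auto simp: Inv_def)
qed

end

subsection \<open>Correctness and running time\<close>

definition rand_matching :: "nat \<Rightarrow> ugraph \<Rightarrow> (edge \<Rightarrow> real) \<Rightarrow> (nat \<Rightarrow> real) \<Rightarrow> edge set" where
  "rand_matching K G w \<omega> =
     class_matching (edges G) (classes (edges G) (2 * fst G + K) w (\<omega> 0)) (key (eidx G) \<omega>)"

definition prog_time :: "nat \<Rightarrow> nat \<Rightarrow> nat" where
  "prog_time K n = 1 + ((2 + n * (1 + 2)) + ((2 + n * n * (cost scan + 2)) + (1 +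
     ((2 + (2 * n + K) * (2 + n * n * (cost classify + 2) + 1 + 2)) +
     ((2 + n * n * ((2 + n * n * (Suc (1 + (2 + n * n * (cost block + 2))) + 2)) + 2)) +
      (2 + n * n * (Suc (1 + (2 + n * n * (cost kill + 2))) + 2)))))))"

lemma runs_prog:
  assumes G: "wf_ugraph G"
  shows "runs \<omega> (prog K) (init_state G w) (prog_time K (fst G))
    (\<lambda>s. output_edges G s = rand_matching K G w \<omega>)"
proof -
  let ?n = "fst G" and ?s = "init_state G w" and ?E = "edges G"
  let ?L = "2 * ?n + K"
  let ?cls = "classes ?E ?L w (\<omega> 0)" and ?k = "key (eidx G) \<omega>"
  let ?M = "greedy ?E (conflict ?cls) ?k"
  have init: "ints ?s 0 0 = ?n" "\<And>a k. a \<noteq> 0 \<Longrightarrow> a \<noteq> 1 \<Longrightarrow> ints ?s a k = 0"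
    "\<And>k. k < ?n * ?n \<Longrightarrow> ints ?s 1 k \<noteq> 0 \<longleftrightarrow> cell G k \<in> ?E"
    "\<And>k. reals ?s 0 k = wcell G w k" "\<And>a k. a \<noteq> 0 \<Longrightarrow> reals ?s a k = 0" "drawn ?s = 0"
    by (auto simp: init_state_def Let_def cell_def[OF G] wcell_def[OF G])
  define Q1 where "Q1 s \<longleftrightarrow> ints s = ints ?s \<and> reals s 0 = reals ?s 0 \<and>
    reals s 1 0 = \<omega> 0 \<and> reals s 3 0 = 0 \<and> drawn s = 1" for s :: state
  have r1: "runs \<omega> (Sample 1 (IConst 0)) ?s 1 Q1"
    using runs_wp[of \<omega> "Sample 1 (IConst 0)"] init(5,6) by (simp add: Q1_def fun_eq_iff)
  define Q2 where "Q2 s \<longleftrightarrow> ints s 3 0 = ?n * ?n \<and> (\<forall>a j. a \<noteq> 3 \<and> a \<noteq> 4 \<longrightarrow> ints s a j = ints ?s a j) \<and>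
    reals s 0 = reals ?s 0 \<and> reals s 1 0 = \<omega> 0 \<and> reals s 3 0 = 0 \<and> drawn s = 1" for s :: state
  have r2: "runs \<omega> (For 4 (scalar 0) (set_scalar 3 (IAdd (scalar 3) (scalar 0)))) s (2 + ?n * (1 + 2)) Q2"
    if "Q1 s" for s
    by (rule runs_mono[OF runs_count[OF G]]) (use that init(1,2) in \<open>auto simp: Q1_def Q2_def\<close>)
  define Q3 where "Q3 s \<longleftrightarrow> scanned G w \<omega> s \<and> reals s 1 0 = \<omega> 0 \<and> reals s 3 0 = sum w ?E \<and>
    (\<forall>k. ints s 2 k = 0 \<and> ints s 9 k = 0 \<and> ints s 10 k = 0)" for s
  have r3: "runs \<omega> (For 4 (scalar 3) scan) s (2 + ?n * ?n * (cost scan + 2)) Q3" if "Q2 s" for s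
    by (rule runs_mono[OF runs_scan[OF G, where w = w]])
      (use that init in \<open>auto simp: Q2_def Q3_def\<close>)
  define Q4 where "Q4 s \<longleftrightarrow> scanned G w \<omega> s \<and> reals s 1 0 = threshold G w \<omega> 0 \<and>
    (\<forall>k. ints s 2 k = 0 \<and> ints s 9 k = 0 \<and> ints s 10 k = 0)" for s
  have r4: "runs \<omega> (RSet 1 (IConst 0)
      (RDiv (RMul (RAdd (RConst 1) (RMul (RConst 8) (rscalar 1))) (rscalar 3)) (RConst 9))) s 1 Q4"
    if "Q3 s" for s
    using runs_wp[of \<omega> "RSet 1 (IConst 0)
      (RDiv (RMul (RAdd (RConst 1) (RMul (RConst 8) (rscalar 1))) (rscalar 3)) (RConst 9))" Q4 s] that
    by (simp add: Q3_def Q4_def scanned_def[OF G] threshold_def[OF G])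
  define Q5 where "Q5 s \<longleftrightarrow> classified G w \<omega> ?L s \<and> (\<forall>k. ints s 2 k = 0 \<and> ints s 10 k = 0)" for s
  have r5: "runs \<omega> (For 6 (IAdd (IAdd (scalar 0) (scalar 0)) (IConst K))
      (Seq (For 4 (scalar 3) classify) (RSet 1 (IConst 0) (RDiv (rscalar 1) (RConst 9))))) s
      (2 + ?L * (2 + ?n * ?n * (cost classify + 2) + 1 + 2)) Q5" if "Q4 s" for s
    by (rule runs_mono[OF runs_classify[OF G]]) (use that in \<open>auto simp: Q4_def Q5_def\<close>)
  define Q6 where "Q6 s \<longleftrightarrow> classified G w \<omega> ?L s \<and> (\<forall>k. ints s 2 k = 0) \<and>
    (\<forall>k<?n * ?n. ints s 10 k \<noteq> 0 \<longleftrightarrow> active G k \<and> cell G k \<in> ?M)" for s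
  have r6: "runs \<omega> (For 6 (scalar 3) (For 4 (scalar 3) sweep)) s
      (2 + ?n * ?n * ((2 + ?n * ?n * (Suc (1 + (2 + ?n * ?n * (cost block + 2))) + 2)) + 2)) Q6"
    if "Q5 s" for s
    by (rule runs_mono[OF runs_sweeps[OF G]])
      (use that in \<open>auto simp: Q5_def Q6_def swept_def[OF G]\<close>)
  define Q7 where "Q7 s \<longleftrightarrow> (\<forall>k<?n * ?n. ints s 2 k \<noteq> 0 \<longleftrightarrow>
    active G k \<and> cell G k \<in> rand_matching K G w \<omega>)" for s :: state
  have r7: "runs \<omega> (For 4 (scalar 3) select) s
      (2 + ?n * ?n * (Suc (1 + (2 + ?n * ?n * (cost kill + 2))) + 2)) Q7" if "Q6 s" for s
    unfolding Q7_def rand_matching_def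
    by (rule runs_select[OF G]) (use that in \<open>auto simp: Q6_def\<close>)
  have "runs \<omega> (prog K) ?s (prog_time K ?n) Q7"
    unfolding prog_def prog_time_def
    by (rule runs_Seq[OF r1 runs_Seq[OF r2 runs_Seq[OF r3 runs_Seq[OF r4 runs_Seq[OF r5 runs_Seq[OF r6 r7]]]]]])
  then show ?thesis
  proof (rule runs_mono)
    fix s assume Q: "Q7 s"
    have sub: "rand_matching K G w \<omega> \<subseteq> ?E"
      unfolding rand_matching_def by (rule class_matching_subset[OF finite_edges[OF G]])
    show "output_edges G s = rand_matching K G w \<omega>"
    proof (intro equalityI subsetI)
      fix e assume "e \<in> output_edges G s"
      then obtain u v where uv: "e = {u, v}" "u < v" "v < ?n" "ints s 2 (u * ?n + v) \<noteq> 0"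
        by (auto simp: output_edges_def)
      have "u * ?n + v < (u + 1) * ?n" using uv by simp
      also have "\<dots> \<le> ?n * ?n" using uv by (intro mult_right_mono) auto
      finally have "cell G (u * ?n + v) \<in> rand_matching K G w \<omega>" using Q uv(4) by (simp add: Q7_def)
      moreover have "cell G (u * ?n + v) = e" using uv by (simp add: cell_def[OF G])
      ultimately show "e \<in> rand_matching K G w \<omega>" by simp
    next
      fix e assume e: "e \<in> rand_matching K G w \<omega>"
      then have "e \<in> ?E" using sub by blast
      note c = cell_eidx[OF G this]
      have ne: "ints s 2 (eidx G e) \<noteq> 0" using Q c e by (simp add: Q7_def)
      define k where "k = eidx G e"
      have n: "0 < ?n" using c(1) by (cases "?n = 0") auto
      have "e = {k div ?n, k mod ?n}" "k div ?n < k mod ?n"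
        using c by (auto simp: k_def cell_def[OF G] active_def[OF G])
      moreover have "k mod ?n < ?n" using n by simp
      moreover have "ints s 2 (k div ?n * ?n + k mod ?n) \<noteq> 0" using ne by (simp add: k_def)
      ultimately show "e \<in> output_edges G s" unfolding output_edges_def by blast
    qed
  qed simp
qed

lemma prog_time_poly: "\<exists>p :: nat poly. \<forall>n. prog_time K n = poly p n"
proof -
  let ?P = "\<lambda>f :: nat \<Rightarrow> nat. \<exists>p. \<forall>n. f n = poly p n"
  have const: "?P (\<lambda>_. c)" for c by (rule exI[of _ "[:c:]"]) simp
  have id: "?P (\<lambda>n. n)" by (rule exI[of _ "[:0, 1:]"]) simp
  have add: "?P (\<lambda>n. f n + g n)" if "?P f" "?P g" for f g using that by (metis poly_add)
  have mult: "?P (\<lambda>n. f n * g n)" if "?P f" "?P g" for f g using that by (metis poly_mult)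
  show ?thesis
    unfolding prog_time_def Suc_eq_plus1 by (intro add mult const id)
qed

section \<open>The algorithm as a distribution\<close>

definition tape_pmf :: "((nat \<Rightarrow> real) \<Rightarrow> 'a) \<Rightarrow> 'a pmf" where
  "tape_pmf X = Abs_pmf (distr tape (count_space UNIV) X)"

lemma measure_tape_pmf:
  assumes X: "X \<in> measurable tape (count_space UNIV)" and fin: "finite (range X)"
  shows "measure_pmf (tape_pmf X) = distr tape (count_space UNIV) X"
  unfolding tape_pmf_def
proof (rule Abs_pmf_inverse, intro CollectI conjI)
  let ?D = "distr tape (count_space UNIV) X"
  interpret D: prob_space ?D by (rule tape.prob_space_distr[OF X])
  show "prob_space ?D" by (rule tape.prob_space_distr[OF X])
  show "sets ?D = UNIV" by simp
  have "AE x in ?D. \<forall>y\<in>{y \<in> range X. measure ?D {y} = 0}. x \<noteq> y"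
  proof (rule AE_finite_allI)
    show "AE x in ?D. x \<noteq> y" if "y \<in> {y \<in> range X. measure ?D {y} = 0}" for y
      using that by (intro AE_I[of _ _ "{y}"]) (auto simp: D.emeasure_eq_measure)
  qed (use fin in simp)
  moreover have "AE x in ?D. x \<in> range X"
    using X by (subst AE_distr_iff) auto
  ultimately show "AE x in ?D. measure ?D {x} \<noteq> 0" by eventually_elim auto
qed

lemma map_tape_pmf:
  assumes X: "X \<in> measurable tape (count_space UNIV)" "finite (range X)"
  shows "map_pmf f (tape_pmf X) = tape_pmf (\<lambda>\<omega>. f (X \<omega>))"
proof -
  have fX: "(\<lambda>\<omega>. f (X \<omega>)) \<in> measurable tape (count_space UNIV)"
    by (rule measurable_compose[OF X(1)]) simp
  have "finite (range (\<lambda>\<omega>. f (X \<omega>)))" using finite_imageI[OF X(2), of f] by (simp add: image_image)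
  then have "measure_pmf (tape_pmf (\<lambda>\<omega>. f (X \<omega>))) = measure_pmf (map_pmf f (tape_pmf X))"
    using X fX by (simp add: measure_tape_pmf map_pmf_rep_eq distr_distr comp_def)
  then show ?thesis by (simp add: measure_pmf_inject)
qed

lemma measurable_Pair_count_space:
  assumes X: "X \<in> measurable M (count_space UNIV)" "finite (range X)"
    and Y: "Y \<in> measurable M (count_space UNIV)"
  shows "(\<lambda>\<omega>. (X \<omega>, Y \<omega>)) \<in> measurable M (count_space UNIV)"
proof (rule measurable_compose_countable'[where I = "range X" and f = "\<lambda>x \<omega>. (x, Y \<omega>)" and g = X])
  show "(\<lambda>\<omega>. (x, Y \<omega>)) \<in> measurable M (count_space UNIV)" for x
    by (rule measurable_compose[OF Y]) simp
  show "X \<in> measurable M (count_space (range X))"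
    using X by (subst measurable_count_space_eq2) (auto intro: measurable_sets)
  show "countable (range X)" using X(2) by (rule countable_finite)
qed

definition alg :: "nat \<Rightarrow> rand_alg" where
  "alg K G w = tape_pmf (rand_matching K G w)"

context
  fixes G :: ugraph and K :: nat
  assumes G: "wf_ugraph G"
begin

lemma measurable_rand_matching: "rand_matching K G w \<in> measurable tape (count_space UNIV)"
proof -
  have "(\<lambda>\<omega>. class_matching (edges G) (classes (edges G) (2 * fst G + K) w (\<omega> 0)) (key (eidx G) \<omega>))
      \<in> measurable tape (count_space UNIV)"
  proof (rule measurable_same_order[where \<Phi> = "\<lambda>\<pi> p. class_matching (edges G) p \<pi>",
        OF finite_edges[OF G] measurable_classes[OF finite_edges[OF G]]])
    show "class_matching (edges G) p \<pi> = class_matching (edges G) p \<pi>'" if "same_order (edges G) \<pi> \<pi>'" for \<pi> \<pi>' p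
      using same_order_greedy[OF finite_edges[OF G] order_refl that] by (simp add: class_matching_def)
  qed simp
  then show ?thesis by (simp add: rand_matching_def[abs_def])
qed

lemma rand_matching_subset: "rand_matching K G w \<omega> \<subseteq> edges G"
  unfolding rand_matching_def by (rule class_matching_subset[OF finite_edges[OF G]])

lemma finite_range_rand_matching: "finite (range (rand_matching K G w))"
  by (rule finite_subset[of _ "Pow (edges G)"]) (use rand_matching_subset finite_edges[OF G] in auto)

lemmas measure_alg = measure_tape_pmf[OF measurable_rand_matching finite_range_rand_matching,
    folded alg_def]

lemma card_edge: "e \<in> edges G \<Longrightarrow> card e = 2"
  using G by (simp add: wf_ugraph_def)

lemma AE_matching_rand_matching: "AE \<omega> in tape. matching G (rand_matching K G w \<omega>)"
  using AE_inj_on_key[OF finite_edges[OF G] inj_on_eidx[OF G]]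
proof eventually_elim
  case (elim \<omega>)
  let ?d = "classes (edges G) (2 * fst G + K) w (\<omega> 0)"
  have "e \<inter> f = {}" if "e \<in> rand_matching K G w \<omega>" "f \<in> rand_matching K G w \<omega>" "e \<noteq> f" for e f
  proof (rule undominated_disjoint)
    show "\<not> conflict ?d e f" if "e \<in> greedy (edges G) (conflict ?d) (key (eidx G) \<omega>)"
        "f \<in> greedy (edges G) (conflict ?d) (key (eidx G) \<omega>)" for e f
      by (rule greedy_independent[OF finite_edges[OF G] elim symp_conflict irreflp_conflict that])
  qed (use that in \<open>auto simp: rand_matching_def class_matching_def\<close>)
  then show ?case using rand_matching_subset by (auto simp: matching_def)
qed

lemma matching_alg: "M \<in> set_pmf (alg K G w) \<Longrightarrow> matching G M"
proof -
  have "AE M in measure_pmf (alg K G w). matching G M"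
    unfolding measure_alg using AE_matching_rand_matching
    by (subst AE_distr_iff[OF measurable_rand_matching]) auto
  then show "M \<in> set_pmf (alg K G w) \<Longrightarrow> matching G M" by (simp add: AE_measure_pmf_iff)
qed

lemma matching_singleton: "e \<in> edges G \<Longrightarrow> matching G {e}"
  by (simp add: matching_def)

lemma finite_matchings: "finite {M. matching G M}"
  by (rule finite_subset[of _ "Pow (edges G)"]) (use finite_edges[OF G] in \<open>auto simp: matching_def\<close>)

lemma weight_le_max: "matching G M \<Longrightarrow> weight w M \<le> max_matching_weight G w"
  unfolding max_matching_weight_def using finite_matchings by (intro Max_ge) auto

lemma max_matching_attained: "\<exists>A. matching G A \<and> weight w A = max_matching_weight G w"
proof -
  have "matching G {}" by (simp add: matching_def)
  then have "max_matching_weight G w \<in> weight w ` {M. matching G M}"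
    unfolding max_matching_weight_def using finite_matchings by (intro Max_in) auto
  then show ?thesis by auto
qed

lemma expected_weight_alg_ge:
  assumes w: "w \<in> weightings G" and K: "2 \<le> K" and \<epsilon>: "(1/9)^(K - 1) \<le> \<epsilon>"
  shows "(1 / 8 - \<epsilon>) * max_matching_weight G w \<le> measure_pmf.expectation (alg K G w) (weight w)"
proof -
  let ?E = "edges G" and ?opt = "max_matching_weight G w" and ?X = "rand_matching K G w"
  let ?S = "sum w ?E" and ?q = "(1/9::real)^(2 * fst G + K - 1)"
  have fin: "finite ?E" by (rule finite_edges[OF G])
  have w0: "0 \<le> w e" if "e \<in> ?E" for e using w that by (auto simp: weightings_def)
  obtain A where A: "matching G A" "weight w A = ?opt" using max_matching_attained by blast
  have AE: "A \<subseteq> ?E" using A by (simp add: matching_def)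
  have le_opt: "w e \<le> ?opt" if "e \<in> ?E" for e
    using weight_le_max[OF matching_singleton[OF that], of w] by (simp add: weight_def)
  have opt0: "0 \<le> ?opt" unfolding A(2)[symmetric] weight_def using w0 AE by (intro sum_nonneg) auto
  define m where "m = real (fst G * fst G)"
  have cardE: "real (card ?E) \<le> m" unfolding m_def using card_edges_le[OF G] by (rule of_nat_mono)
  have S: "?S \<le> m * ?opt"
  proof -
    have "?S \<le> (\<Sum>e\<in>?E. ?opt)" by (rule sum_mono[OF le_opt])
    also have "\<dots> = real (card ?E) * ?opt" by simp
    also have "\<dots> \<le> m * ?opt" by (rule mult_right_mono[OF cardE opt0])
    finally show ?thesis .
  qed
  have cardA: "real (card A) \<le> m"
    using card_mono[OF fin AE] cardE by linarith
  have mm: "m * m * ?q \<le> \<epsilon>"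
  proof -
    have "real (fst G) \<le> 3 ^ fst G"
    proof -
      have "real (fst G) \<le> 2 ^ fst G" using less_exp[of "fst G"] by (metis less_imp_le of_nat_le_iff of_nat_numeral of_nat_power)
      also have "\<dots> \<le> 3 ^ fst G" by (rule power_mono) auto
      finally show ?thesis .
    qed
    then have "real (fst G) ^ 4 \<le> (3 ^ fst G) ^ 4" by (rule power_mono) simp
    also have "((3::real) ^ fst G) ^ 4 = (3 ^ 2) ^ (2 * fst G)"
      unfolding power_mult[symmetric] by (rule arg_cong[where f = "(^) 3"]) simp
    also have "((3::real) ^ 2) ^ (2 * fst G) = 9 ^ (2 * fst G)" by simp
    finally have "m * m \<le> 9 ^ (2 * fst G)" by (simp add: m_def power4_eq_xxxx)
    then have "m * m * ?q \<le> 9 ^ (2 * fst G) * ?q" by (rule mult_right_mono) simp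
    also have "9 ^ (2 * fst G) * ?q = (1/9)^(K - 1)"
    proof -
      have "?q = (1/9)^(2 * fst G) * (1/9)^(K - 1)" using K by (simp add: power_add[symmetric])
      then show ?thesis by (simp add: mult.assoc[symmetric] power_mult_distrib[symmetric])
    qed
    also note \<epsilon>
    finally show ?thesis .
  qed
  have S0: "0 \<le> ?S" by (rule sum_nonneg[OF w0])
  have "real (card A) * (?S * ?q) \<le> m * ((m * ?opt) * ?q)"
    using cardA S S0 opt0 by (intro mult_mono mult_right_mono) (auto simp: m_def)
  also have "\<dots> = (m * m * ?q) * ?opt" by (simp add: mult_ac)
  also have "\<dots> \<le> \<epsilon> * ?opt" by (rule mult_right_mono[OF mm opt0])
  finally have loss: "real (card A) * (?S * ?q) \<le> \<epsilon> * ?opt" .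
  have sum_eq: "(\<Sum>e\<in>A. (w e - ?S * ?q) / 8) = (?opt - real (card A) * (?S * ?q)) / 8"
    unfolding A(2)[symmetric] weight_def
    by (simp only: sum_divide_distrib[symmetric] sum_subtractf sum_constant)
  have lower: "(1 / 8 - \<epsilon>) * ?opt \<le> (\<Sum>e\<in>A. (w e - ?S * ?q) / 8)"
  proof -
    have "0 \<le> (1/9::real)^(K - 1)" by simp
    then have "0 \<le> \<epsilon>" using \<epsilon> by (rule order_trans)
    then have "0 \<le> \<epsilon> * ?opt" using opt0 by simp
    then show ?thesis unfolding sum_eq using loss by (simp add: left_diff_distrib diff_divide_distrib)
  qed
  have mX: "(\<lambda>\<omega>. weight w (?X \<omega>)) \<in> borel_measurable tape"
    by (rule measurable_compose[OF measurable_rand_matching]) simp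
  have nonneg: "0 \<le> weight w (?X \<omega>)" for \<omega>
    unfolding weight_def using w0 rand_matching_subset by (intro sum_nonneg) auto
  have bound: "weight w (?X \<omega>) \<le> ?S" for \<omega>
    unfolding weight_def using w0 rand_matching_subset fin by (intro sum_mono2) auto
  have int: "integrable tape (\<lambda>\<omega>. weight w (?X \<omega>))"
    by (rule tape.integrable_const_bound[where B = ?S]) (use nonneg bound mX in auto)
  have "measure_pmf.expectation (alg K G w) (weight w) = (\<integral>\<omega>. weight w (?X \<omega>) \<partial>tape)"
    unfolding measure_alg by (rule integral_distr[OF measurable_rand_matching]) simp
  moreover have "ennreal (\<integral>\<omega>. weight w (?X \<omega>) \<partial>tape) = (\<integral>\<^sup>+\<omega>. ennreal (weight w (?X \<omega>)) \<partial>tape)"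
    using nonneg by (intro nn_integral_eq_integral[symmetric] int) auto
  moreover have "ennreal (\<Sum>e\<in>A. (w e - ?S * ?q) / 8) \<le> (\<integral>\<^sup>+\<omega>. ennreal (weight w (?X \<omega>)) \<partial>tape)"
    unfolding weight_def rand_matching_def
    by (rule expected_weight_ge[OF fin inj_on_eidx[OF G] card_edge w0 _ AE])
      (use K A in \<open>auto simp: matching_def\<close>)
  moreover have "0 \<le> (\<integral>\<omega>. weight w (?X \<omega>) \<partial>tape)" using nonneg by simp
  ultimately have "(\<Sum>e\<in>A. (w e - ?S * ?q) / 8) \<le> measure_pmf.expectation (alg K G w) (weight w)"
    by (metis ennreal_le_iff)
  then show ?thesis using lower by linarith
qed

lemma dist_w_le:
  assumes w: "w \<in> weightings G" "w' \<in> weightings G" and F: "F \<subseteq> edges G" "F' \<subseteq> edges G"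
  shows "dist_w G (F, w) (F', w') \<le>
    l1_norm G (\<lambda>e. w e - w' e) + (\<Sum>g\<in>sym_diff F F'. min (w g) (w' g))"
proof -
  let ?E = "edges G"
  have fin: "finite ?E" by (rule finite_edges[OF G])
  have ind: "weighted_indicator A v g = (if g \<in> A then v g else 0)" if "A \<subseteq> ?E" for A v g
  proof -
    have "finite A" using that fin by (rule finite_subset)
    then show ?thesis by (simp add: weighted_indicator_def indicator_def if_distrib sum.delta cong: if_cong)
  qed
  have w0: "0 \<le> w e" "0 \<le> w' e" if "e \<in> ?E" for e using w that by (auto simp: weightings_def)
  have "dist_w G (F, w) (F', w') = (\<Sum>g\<in>?E. \<bar>(if g \<in> F then w g else 0) - (if g \<in> F' then w' g else 0)\<bar>)"
    by (simp add: dist_w_def l1_norm_def ind[OF F(1)] ind[OF F(2)])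
  also have "\<dots> \<le> (\<Sum>g\<in>?E. \<bar>w g - w' g\<bar> + (if g \<in> sym_diff F F' then min (w g) (w' g) else 0))"
    using w0 by (intro sum_mono) (fastforce simp: min_def)
  also have "\<dots> = l1_norm G (\<lambda>e. w e - w' e) + (\<Sum>g\<in>?E. if g \<in> sym_diff F F' then min (w g) (w' g) else 0)"
    by (simp add: sum.distrib l1_norm_def)
  also have "(\<Sum>g\<in>?E. if g \<in> sym_diff F F' then min (w g) (w' g) else 0) = (\<Sum>g\<in>sym_diff F F'. min (w g) (w' g))"
    using fin F by (intro sum.mono_neutral_cong_right) auto
  finally show ?thesis .
qed

lemma EM_w_alg_le:
  assumes w: "w \<in> weightings G" "w' \<in> weightings G"
  shows "EM_w G (alg K G w, w) (alg K G w', w') \<le> ennreal (52 * l1_norm G (\<lambda>e. w e - w' e))"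
proof -
  let ?E = "edges G" and ?X = "rand_matching K G w" and ?Y = "rand_matching K G w'"
  define Z where "Z \<omega> = (?X \<omega>, ?Y \<omega>)" for \<omega>
  define D where "D = l1_norm G (\<lambda>e. w e - w' e)"
  have D0: "0 \<le> D" by (simp add: D_def l1_norm_def sum_nonneg)
  have fin: "finite ?E" by (rule finite_edges[OF G])
  have w0: "0 \<le> w e" "0 \<le> w' e" if "e \<in> ?E" for e using w that by (auto simp: weightings_def)
  have Z: "Z \<in> measurable tape (count_space UNIV)"
    unfolding Z_def
    by (rule measurable_Pair_count_space[OF measurable_rand_matching finite_range_rand_matching measurable_rand_matching])
  have "range Z \<subseteq> range ?X \<times> range ?Y" by (auto simp: Z_def)
  then have finZ: "finite (range Z)"
    using finite_range_rand_matching by (meson finite_SigmaI finite_subset)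
  have coupling: "tape_pmf Z \<in> couplings (alg K G w) (alg K G w')"
    by (simp add: couplings_def map_tape_pmf[OF Z finZ] alg_def Z_def)
  define m where "m \<omega> = (\<Sum>g\<in>sym_diff (?X \<omega>) (?Y \<omega>). min (w g) (w' g))" for \<omega>
  have m0: "0 \<le> m \<omega>" for \<omega>
    unfolding m_def
  proof (rule sum_nonneg)
    fix g assume "g \<in> sym_diff (?X \<omega>) (?Y \<omega>)"
    then have "g \<in> ?E" using rand_matching_subset[of w \<omega>] rand_matching_subset[of w' \<omega>] by blast
    then show "0 \<le> min (w g) (w' g)" using w0 by simp
  qed
  have mm: "(\<lambda>\<omega>. ennreal (m \<omega>)) \<in> borel_measurable tape"
    using measurable_compose[OF Z, of "\<lambda>(A, B). ennreal (\<Sum>g\<in>sym_diff A B. min (w g) (w' g))" borel]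
    by (simp add: Z_def m_def)
  have change: "(\<integral>\<^sup>+\<omega>. ennreal (m \<omega>) \<partial>tape) \<le> ennreal (405/8 * D)"
  proof (cases "0 < sum w ?E \<and> 0 < sum w' ?E")
    case True
    then show ?thesis
      unfolding m_def D_def l1_norm_def rand_matching_def
      by (intro expected_change_le fin inj_on_eidx[OF G] card_edge w0) auto
  next
    case False
    have "sum w ?E = 0 \<or> sum w' ?E = 0"
      using False sum_nonneg[of ?E w] sum_nonneg[of ?E w'] w0 by force
    then have "(\<forall>e\<in>?E. w e = 0) \<or> (\<forall>e\<in>?E. w' e = 0)"
      using sum_nonneg_eq_0_iff[OF fin] w0 by metis
    then have "min (w e) (w' e) = 0" if "e \<in> ?E" for e using w0[OF that] that by auto
    then have "m \<omega> = 0" for \<omega>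
      unfolding m_def using rand_matching_subset[of w \<omega>] rand_matching_subset[of w' \<omega>]
      by (intro sum.neutral) blast
    then show ?thesis by simp
  qed
  have "EM_w G (alg K G w, w) (alg K G w', w') \<le>
      (\<integral>\<^sup>+ (F, F'). ennreal (dist_w G (F, w) (F', w')) \<partial>measure_pmf (tape_pmf Z))"
    unfolding EM_w_def prod.case by (rule INF_lower[OF coupling])
  also have "\<dots> = (\<integral>\<^sup>+\<omega>. ennreal (dist_w G (?X \<omega>, w) (?Y \<omega>, w')) \<partial>tape)"
    unfolding measure_tape_pmf[OF Z finZ] by (subst nn_integral_distr[OF Z]) (auto simp: Z_def)
  also have "\<dots> \<le> (\<integral>\<^sup>+\<omega>. ennreal D + ennreal (m \<omega>) \<partial>tape)"
  proof (rule nn_integral_mono)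
    fix \<omega>
    have "ennreal (dist_w G (?X \<omega>, w) (?Y \<omega>, w')) \<le> ennreal (D + m \<omega>)"
      unfolding D_def m_def by (intro ennreal_leI dist_w_le w rand_matching_subset)
    then show "ennreal (dist_w G (?X \<omega>, w) (?Y \<omega>, w')) \<le> ennreal D + ennreal (m \<omega>)"
      using D0 m0 by simp
  qed
  also have "\<dots> = ennreal D + (\<integral>\<^sup>+\<omega>. ennreal (m \<omega>) \<partial>tape)"
    by (subst nn_integral_add) (use mm tape.emeasure_space_1 in auto)
  also have "\<dots> \<le> ennreal D + ennreal (405/8 * D)" by (rule add_left_mono[OF change])
  also have "\<dots> = ennreal (D + 405/8 * D)" by (rule ennreal_plus[symmetric]) (use D0 in auto)
  also have "\<dots> \<le> ennreal (52 * D)" using D0 by (intro ennreal_leI) simp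
  finally show ?thesis unfolding D_def .
qed

lemma lipschitz_constant_alg_le:
  assumes "52 \<le> c"
  shows "lipschitz_constant (alg K) G \<le> ennreal c"
  unfolding lipschitz_constant_def
proof (rule SUP_least, clarify)
  fix w w' assume w: "w \<in> weightings G" "w' \<in> weightings G" and ne: "w \<noteq> w'"
  let ?D = "l1_norm G (\<lambda>e. w e - w' e)"
  obtain e where e: "e \<in> edges G" "w e \<noteq> w' e"
    using w ne unfolding weightings_def by (meson PiE_ext)
  have "0 < ?D"
    unfolding l1_norm_def using e finite_edges[OF G] by (intro sum_pos2[of _ e]) auto
  moreover have "EM_w G (alg K G w, w) (alg K G w', w') \<le> ennreal ?D * ennreal c"
  proof -
    have "52 * ?D \<le> c * ?D" using \<open>0 < ?D\<close> assms by simp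
    then have "ennreal (52 * ?D) \<le> ennreal (c * ?D)" by (rule ennreal_leI)
    also have "ennreal (c * ?D) = ennreal ?D * ennreal c"
      using \<open>0 < ?D\<close> assms by (subst ennreal_mult[symmetric]) (auto simp: mult.commute)
    finally show ?thesis using EM_w_alg_le[OF w] by (rule order_trans[rotated])
  qed
  ultimately show "EM_w G (alg K G w, w) (alg K G w', w') / ennreal ?D \<le> ennreal c"
    by (intro divide_le_posI_ennreal) auto
qed

end

lemma polytime_alg: "polytime_randomized (alg K)"
proof -
  obtain p :: "nat poly" where p: "\<And>n. prog_time K n = poly p n" using prog_time_poly by metis
  show ?thesis
    unfolding polytime_randomized_def
  proof (intro exI[of _ "prog K"] exI[of _ p] allI impI)
    fix G w assume G: "wf_ugraph G"
    show "\<exists>X. X \<in> measurable tape (count_space UNIV) \<and>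
        measure_pmf (alg K G w) = distr tape (count_space UNIV) X \<and>
        (\<forall>\<omega>. (\<forall>i. \<omega> i \<in> {0..1}) \<longrightarrow> (\<exists>t s. exec \<omega> (prog K) (init_state G w) t s \<and>
          t \<le> poly p (fst G) \<and> X \<omega> = output_edges G s))"
    proof (intro exI[of _ "rand_matching K G w"] conjI allI impI)
      show "\<exists>t s. exec \<omega> (prog K) (init_state G w) t s \<and> t \<le> poly p (fst G) \<and>
          rand_matching K G w \<omega> = output_edges G s" for \<omega>
        using runs_prog[OF G, of \<omega> K w] unfolding runs_def p by metis
    qed (rule measurable_rand_matching[OF G] measure_alg[OF G])+
  qed
qed

theorem theorem5p1:
  "\<exists>C::real. C > 0 \<and>
     (\<forall>\<epsilon>::real. 0 < \<epsilon> \<and> \<epsilon> < 1 / 8 \<longrightarrow>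
        (\<exists>A. polytime_randomized A \<and>
             approx_max_weight_matching (1 / 8 - \<epsilon>) A \<and>
             (\<forall>G. wf_ugraph G \<longrightarrow> lipschitz_constant A G \<le> ennreal (C / \<epsilon>))))"
proof (intro exI[of _ 52] conjI allI impI)
  fix \<epsilon> :: real assume \<epsilon>: "0 < \<epsilon> \<and> \<epsilon> < 1 / 8"
  obtain k where k: "(1/9)^k < \<epsilon>" using real_arch_pow_inv[of \<epsilon> "1/9"] \<epsilon> by auto
  define K where "K = k + 2"
  have "(1/9)^(K - 1) \<le> (1/9::real)^k" unfolding K_def by (rule power_decreasing) auto
  then have "(1/9)^(K - 1) \<le> \<epsilon>" using k by linarith
  moreover have "2 \<le> K" by (simp add: K_def)
  ultimately have K: "2 \<le> K" "(1/9)^(K - 1) \<le> \<epsilon>" by blast+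
  show "\<exists>A. polytime_randomized A \<and> approx_max_weight_matching (1 / 8 - \<epsilon>) A \<and>
      (\<forall>G. wf_ugraph G \<longrightarrow> lipschitz_constant A G \<le> ennreal (52 / \<epsilon>))"
  proof (intro exI[of _ "alg K"] conjI allI impI)
    show "polytime_randomized (alg K)" by (rule polytime_alg)
    show "approx_max_weight_matching (1 / 8 - \<epsilon>) (alg K)"
      unfolding approx_max_weight_matching_def
      using matching_alg expected_weight_alg_ge K by blast
    show "lipschitz_constant (alg K) G \<le> ennreal (52 / \<epsilon>)" if "wf_ugraph G" for G
      using \<epsilon> by (intro lipschitz_constant_alg_le that) (simp add: field_simps)
  qed
qed simp

end
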